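(* Let $p\ge1$, let $Y$ be the solution of $dY_t=\nu\,dW_t+\kappa(\theta-Y_t)dt$, $Y_0=y_0$, and let $\widetilde X^N$ be the WeakTraj_1 scheme with exact simulation of $Y$ defined in the context. Assume: (1) $\underline\psi>0$; (2) $f$ is a $\mathcal{C}^3$ function; (3) there exist three constants $c_0>0$, $c_1>0$ and $c_2\in[0,1)$ such that for all $y\in\mathbb{R}$, $$\Big|\kappa(\theta-y)h'(y)+\tfrac{\nu^2}{2}h''(y)\Big|\le c_0e^{c_1|y|^{1+c_2}},\qquad |h'(y)|\le c_0e^{c_1|y|^{1+c_2}},$$ $$\Big|\kappa(\theta-y)\psi'(y)+\tfrac{\nu^2}{2}\psi''(y)\Big|\le c_0e^{c_1|y|^{1+c_2}},\qquad |\psi''(y)|\le c_0e^{c_1|y|^{1+c_2}}.$$ Then there exists a constant $C$ independent of the number of time steps $N\ge1$ such that $$\mathbb{E}\left[\max_{0\le k\le N}\big|\widetilde X_{t_k}-\widetilde X^N_{t_k}\big|^{2p}\right]\le\frac{C}{N^{2p}}.$$ The same result holds true when assumption (1) is replaced by: (1') $\psi(y)>0$ for all $y\in\mathbb{R}$, and there exists $\epsilon>0$ such that $\displaystyle\sup_{t\le T}\mathbb{E}\left(\frac1{\psi^{p(1+\epsilon)}(Y_t)}\right)<\infty$.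
   Context: Let $T>0$, $r\in\mathbb{R}$, $\rho\in[-1,1]$, $s_0>0$, $y_0\in\mathbb{R}$, $\nu>0$, $\kappa,\theta\in\mathbb{R}$, $f:\mathbb{R}\to\mathbb{R}$. Let $(W_t)_{t\in[0,T]}$ and $(B_t)_{t\in[0,T]}$ be independent standard one-dimensional Brownian motions; $Y$ is the Ornstein-Uhlenbeck process driven by $W$ given in the claim. Define $\psi=f^2$, $\underline\psi=\inf_{y\in\mathbb{R}}\psi(y)$, $F(y)=\frac1\nu\int_0^yf(z)dz$ and $$h(y)=r-\tfrac12f^2(y)-\rho\Big(\tfrac{\kappa(\theta-y)}{\nu}f(y)+\tfrac{\nu}{2}f'(y)\Big).$$ For $N\ge1$ let $\delta_N=T/N$, $t_k=k\delta_N$ for $0\le k\le N$, $\Delta B_{k+1}=B_{t_{k+1}}-B_{t_k}$. The vector $(\widetilde X_{t_k})_{0\le k\le N}$ is defined by $\widetilde X_{t_0}=\log(s_0)$ and, for $1\le k\le N$, $$\widetilde X_{t_k}=\widetilde X_{t_0}+\rho(F(Y_{t_k})-F(Y_{t_0}))+\int_0^{t_k}h(Y_s)ds+\sqrt{1-\rho^2}\sum_{l=0}^{k-1}\sqrt{v_l}\,\Delta B_{l+1},\qquad v_l=\frac1{\delta_N}\int_{t_l}^{t_{l+1}}\psi(Y_s)ds.$$ (It has the same law as $(X_{t_k})_{0\le k\le N}$ where $dX_t=(r-\frac12f^2(Y_t))dt+f(Y_t)(\rho\,dW_t+\sqrt{1-\rho^2}\,dB_t)$, $X_0=\log(s_0)$.)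 The WeakTraj_1 scheme with exact simulation of $Y$ is: $\widetilde X^N_{t_0}=\log(s_0)$ and, for $0\le k\le N-1$, $$\widetilde X^N_{t_{k+1}}=\widetilde X^N_{t_k}+\rho\big(F(Y_{t_{k+1}})-F(Y_{t_k})\big)+\delta_Nh(Y_{t_k})+\sqrt{1-\rho^2}\sqrt{\Big(\psi(Y_{t_k})+\frac{\nu\psi'(Y_{t_k})}{\delta_N}\int_{t_k}^{t_{k+1}}(W_s-W_{t_k})ds\Big)\vee\underline\psi}\;\Delta B_{k+1},$$ where $a\vee b=\max(a,b)$. *)

theory Defs
  imports "HOL-Probability.Probability"
begin

definition C_k :: "nat \<Rightarrow> (real \<Rightarrow> real) \<Rightarrow> bool" where
  "C_k n f \<longleftrightarrow>
     (\<forall>i<n. \<forall>x. (deriv ^^ i) f differentiable (at x)) \<and> continuous_on UNIV ((deriv ^^ n) f)"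


text \<open>
  Path properties are required almost surely only, so surely continuous processes are a
  special case.
\<close>

definition brownian_motion :: "'a measure \<Rightarrow> real \<Rightarrow> (real \<Rightarrow> 'a \<Rightarrow> real) \<Rightarrow> bool" where
  "brownian_motion M T W \<longleftrightarrow>
     (\<forall>t\<in>{0..T}. W t \<in> borel_measurable M) \<and>
     (AE \<omega> in M. W 0 \<omega> = 0) \<and>
     (AE \<omega> in M. continuous_on {0..T} (\<lambda>t. W t \<omega>)) \<and>
     (\<forall>s t. 0 \<le> s \<and> s < t \<and> t \<le> T \<longrightarrow>
        distributed M lborel (\<lambda>\<omega>. W t \<omega> - W s \<omega>) (\<lambda>x. ennreal (normal_density 0 (sqrt (t - s)) x))) \<and>
     (\<forall>(n::nat) (u::nat \<Rightarrow> real). 0 \<le> u 0 \<and> (\<forall>i<n. u i \<le> u (Suc i)) \<and> u n \<le> T \<longrightarrow>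
        prob_space.indep_vars M (\<lambda>_. borel) (\<lambda>i \<omega>. W (u (Suc i)) \<omega> - W (u i) \<omega>) {..<n})"

definition indep_processes ::
    "'a measure \<Rightarrow> real \<Rightarrow> (real \<Rightarrow> 'a \<Rightarrow> real) \<Rightarrow> (real \<Rightarrow> 'a \<Rightarrow> real) \<Rightarrow> bool" where
  "indep_processes M T W B \<longleftrightarrow>
     prob_space.indep_var M
       (\<Pi>\<^sub>M t\<in>{0..T}. borel) (\<lambda>\<omega>. \<lambda>t\<in>{0..T}. W t \<omega>)
       (\<Pi>\<^sub>M t\<in>{0..T}. borel) (\<lambda>\<omega>. \<lambda>t\<in>{0..T}. B t \<omega>)"

text \<open>
  Solution of \<open>dY = \<nu> dW + \<kappa> (\<theta> - Y) dt\<close>, \<open>Y 0 = y0\<close> on \<open>[0,T]\<close>. The diffusion coefficient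
  is constant and \<open>W 0 = 0\<close> a.s., so the stochastic integral is \<open>\<nu> W\<close>. The equation has a unique
  continuous solution for each continuous path of \<open>W\<close>, which makes \<open>Y\<close> adapted to the completed
  filtration of \<open>W\<close>; adaptedness is therefore not a separate requirement.
\<close>

definition ou_solution ::
    "'a measure \<Rightarrow> real \<Rightarrow> real \<Rightarrow> real \<Rightarrow> real \<Rightarrow> real \<Rightarrow>
     (real \<Rightarrow> 'a \<Rightarrow> real) \<Rightarrow> (real \<Rightarrow> 'a \<Rightarrow> real) \<Rightarrow> bool" where
  "ou_solution M T \<nu> \<kappa> \<theta> y0 W Y \<longleftrightarrow>
     (\<forall>t\<in>{0..T}. Y t \<in> borel_measurable M) \<and>
     (AE \<omega> in M. continuous_on {0..T} (\<lambda>t. Y t \<omega>) \<and>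
        (\<forall>t\<in>{0..T}. Y t \<omega> = y0 + \<nu> * W t \<omega> +
           (LBINT s=ereal 0..ereal t. \<kappa> * (\<theta> - Y s \<omega>))))"


definition psi :: "(real \<Rightarrow> real) \<Rightarrow> real \<Rightarrow> real" where
  "psi f y = (f y)\<^sup>2"

definition psi_inf :: "(real \<Rightarrow> real) \<Rightarrow> real" where
  "psi_inf f = (INF y. psi f y)"

text \<open>The interval integral is oriented, so the formula also covers \<open>y < 0\<close>.\<close>

definition F_prim :: "real \<Rightarrow> (real \<Rightarrow> real) \<Rightarrow> real \<Rightarrow> real" where
  "F_prim \<nu> f y = 1 / \<nu> * (LBINT z=ereal 0..ereal y. f z)"

definition h_drift ::
    "real \<Rightarrow> real \<Rightarrow> real \<Rightarrow> real \<Rightarrow> real \<Rightarrow> (real \<Rightarrow> real) \<Rightarrow> real \<Rightarrow> real" where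
  "h_drift r \<rho> \<nu> \<kappa> \<theta> f y =
     r - 1 / 2 * (f y)\<^sup>2 - \<rho> * (\<kappa> * (\<theta> - y) / \<nu> * f y + \<nu> / 2 * deriv f y)"

definition ou_generator :: "real \<Rightarrow> real \<Rightarrow> real \<Rightarrow> (real \<Rightarrow> real) \<Rightarrow> real \<Rightarrow> real" where
  "ou_generator \<nu> \<kappa> \<theta> g y = \<kappa> * (\<theta> - y) * deriv g y + \<nu>\<^sup>2 / 2 * deriv (deriv g) y"


definition step :: "real \<Rightarrow> nat \<Rightarrow> real" where
  "step T N = T / real N"

definition grid :: "real \<Rightarrow> nat \<Rightarrow> nat \<Rightarrow> real" where
  "grid T N k = real k * step T N"

definition mean_psi ::
    "real \<Rightarrow> (real \<Rightarrow> real) \<Rightarrow> (real \<Rightarrow> 'a \<Rightarrow> real) \<Rightarrow> nat \<Rightarrow> nat \<Rightarrow> 'a \<Rightarrow> real" where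
  "mean_psi T f Y N l \<omega> =
     1 / step T N * (LBINT s=ereal (grid T N l)..ereal (grid T N (Suc l)). psi f (Y s \<omega>))"

text \<open>The process \<open>X~\<close> at the grid point with index \<open>k\<close>.\<close>

definition X_tilde ::
    "real \<Rightarrow> real \<Rightarrow> real \<Rightarrow> real \<Rightarrow> real \<Rightarrow> real \<Rightarrow> real \<Rightarrow> (real \<Rightarrow> real) \<Rightarrow>
     (real \<Rightarrow> 'a \<Rightarrow> real) \<Rightarrow> (real \<Rightarrow> 'a \<Rightarrow> real) \<Rightarrow> nat \<Rightarrow> nat \<Rightarrow> 'a \<Rightarrow> real" where
  "X_tilde T r \<rho> s0 \<nu> \<kappa> \<theta> f B Y N k \<omega> =
     ln s0 + \<rho> * (F_prim \<nu> f (Y (grid T N k) \<omega>) - F_prim \<nu> f (Y (grid T N 0) \<omega>))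
     + (LBINT s=ereal 0..ereal (grid T N k). h_drift r \<rho> \<nu> \<kappa> \<theta> f (Y s \<omega>))
     + sqrt (1 - \<rho>\<^sup>2) * (\<Sum>l<k. sqrt (mean_psi T f Y N l \<omega>)
         * (B (grid T N (Suc l)) \<omega> - B (grid T N l) \<omega>))"

text \<open>The WeakTraj-1 scheme driven by the exact values of \<open>Y\<close>.\<close>

primrec X_scheme ::
    "real \<Rightarrow> real \<Rightarrow> real \<Rightarrow> real \<Rightarrow> real \<Rightarrow> real \<Rightarrow> real \<Rightarrow> (real \<Rightarrow> real) \<Rightarrow>
     (real \<Rightarrow> 'a \<Rightarrow> real) \<Rightarrow> (real \<Rightarrow> 'a \<Rightarrow> real) \<Rightarrow> (real \<Rightarrow> 'a \<Rightarrow> real) \<Rightarrow> nat \<Rightarrow> nat \<Rightarrow>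
     'a \<Rightarrow> real" where
  "X_scheme T r \<rho> s0 \<nu> \<kappa> \<theta> f W B Y N 0 \<omega> = ln s0"
| "X_scheme T r \<rho> s0 \<nu> \<kappa> \<theta> f W B Y N (Suc k) \<omega> =
     X_scheme T r \<rho> s0 \<nu> \<kappa> \<theta> f W B Y N k \<omega>
     + \<rho> * (F_prim \<nu> f (Y (grid T N (Suc k)) \<omega>) - F_prim \<nu> f (Y (grid T N k) \<omega>))
     + step T N * h_drift r \<rho> \<nu> \<kappa> \<theta> f (Y (grid T N k) \<omega>)
     + sqrt (1 - \<rho>\<^sup>2)
       * sqrt (max (psi f (Y (grid T N k) \<omega>)
             + \<nu> * deriv (psi f) (Y (grid T N k) \<omega>) / step T N
               * (LBINT s=ereal (grid T N k)..ereal (grid T N (Suc k)).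
                    W s \<omega> - W (grid T N k) \<omega>))
           (psi_inf f))
       * (B (grid T N (Suc k)) \<omega> - B (grid T N k) \<omega>)"

end

theory Submission
  imports Defs
begin

text \<open>
  The error splits into a part that depends on \<open>Y\<close> only (\<open>AE_error_decomposition\<close>): the error of the
  left-point rule for the integral of \<open>h (Y s)\<close>, and a sum of increments of \<open>B\<close> whose weights are differences
  of volatilities. Both rest on one second order Taylor expansion. For \<open>g = h\<close> and \<open>g = \<psi>\<close>, the
  difference \<open>g (Y s) - g (Y a)\<close> equals \<open>\<nu> * g' (Y a) * (W s - W a)\<close> up to a remainder of order \<open>s - a\<close> in all
  \<open>L\<^sup>q\<close> (\<open>remainder_moments\<close>): the squared increment of \<open>Y\<close> and its drift part have that order, and the
  derivatives of \<open>g\<close> at \<open>Y\<close> have all moments because their growth exponent \<open>1 + c2\<close> is below \<open>2\<close> while \<open>Y\<close>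
  is Gaussian (\<open>Y_growth_moments\<close>).

  For the drift, the remainders sum to \<open>O(1 / N)\<close>. The linear terms are only of order \<open>N powr (- 3/2)\<close> each, but
  \<open>\<nu> * g' (Y a)\<close> belongs to the past of the time \<open>a\<close> and the mean of \<open>W s - W a\<close> over the next step is orthogonal to
  it, so their partial sums form a martingale, and its maximum is \<open>O(1 / N)\<close>. The bound
  \<open>martingale_max_moment\<close> is a discrete inequality that follows from the binomial expansion, a Gronwall
  argument and a pathwise form of Doob's inequality.

  For the volatility, the scheme contains exactly the linear term, so the mean \<open>v\<close> of \<open>\<psi> (Y s)\<close>
  over a step differs from its approximation \<open>v'\<close> by a remainder only, and the cut-off can only reduce
  this error. Given \<open>W\<close>, the sum over the increments of \<open>B\<close> is a Gaussian martingale with variance \<open>\<Sum> (sqrt v - sqrt v')\<^sup>2 * step\<close>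
  (\<open>independent_weights_max\<close>), and \<open>\<bar>sqrt v - sqrt v'\<bar> \<le> \<bar>v - v'\<bar> / sqrt v\<close>. The moment condition on \<open>1 / \<psi>\<close> with
  exponent \<open>p * (1 + \<epsilon>)\<close> pays for the division, by Young's inequality, since \<open>v - v'\<close> has moments of every order
  (\<open>weight_sum_moment\<close>). A positive lower bound of \<open>\<psi>\<close> implies the moment condition, so the two
  alternative assumptions are treated together.
\<close>

section \<open>Time averages along a path\<close>

text \<open>The mean of a path over \<open>[a, b]\<close> is encoded as the limit of equidistant sample means, which
  equals \<open>1 / (b - a)\<close> times the integral on continuous paths. As a limit of finite combinations of
  values it is a measurable functional of an arbitrary process, whereas the Lebesgue integral need not
  be when only almost every path is continuous. The choice \<open>a = b\<close> gives the value at \<open>a\<close>.\<close>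

definition path_mean :: "real \<Rightarrow> real \<Rightarrow> (real \<Rightarrow> real) \<Rightarrow> real" where
  "path_mean a b x = lim (\<lambda>n. (\<Sum>i<n. x (a + (b - a) * real i / real n)) / real n)"

lemma sample_point_in:
  fixes a b :: real
  assumes "a \<le> b" "i < n"
  shows "a + (b - a) * real i / real n \<in> {a..b}"
proof -
  have "(b - a) * real i / real n \<le> (b - a) * 1"
    using assms by (simp add: divide_le_eq mult_left_mono)
  then show ?thesis using assms by simp
qed

lemma path_mean_cong:
  assumes "a \<le> b" "\<And>s. s \<in> {a..b} \<Longrightarrow> x s = y s"
  shows "path_mean a b x = path_mean a b y"
proof -
  have "(\<Sum>i<n. x (a + (b - a) * real i / real n)) = (\<Sum>i<n. y (a + (b - a) * real i / real n))" for n
    using assms sample_point_in[OF assms(1)] by (intro sum.cong) auto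
  then show ?thesis by (simp add: path_mean_def)
qed

lemma path_mean_measurable:
  assumes "a \<le> b" "\<And>s. s \<in> {a..b} \<Longrightarrow> (\<lambda>\<omega>. X \<omega> s) \<in> borel_measurable M"
  shows "(\<lambda>\<omega>. path_mean a b (X \<omega>)) \<in> borel_measurable M"
proof -
  have "(\<lambda>\<omega>. (\<Sum>i<n. X \<omega> (a + (b - a) * real i / real n)) / real n) \<in> borel_measurable M" for n
    using sample_point_in[OF assms(1)] assms(2)
    by (intro borel_measurable_divide borel_measurable_sum) auto
  then show ?thesis
    unfolding path_mean_def by (rule borel_measurable_lim_metric)
qed

text \<open>The bound is carried along the partition points, so that the induction adds the error of one
  cell of length \<open>(b - a) / n\<close>, on which \<open>x\<close> oscillates by at most \<open>e\<close>.\<close>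

lemma riemann_sum_error:
  fixes x :: "real \<Rightarrow> real"
  assumes cont: "continuous_on {a..b} x" and ab: "a \<le> b" and n: "n > 0"
    and osc: "\<And>s t. s \<in> {a..b} \<Longrightarrow> t \<in> {a..b} \<Longrightarrow> \<bar>s - t\<bar> \<le> (b - a) / real n \<Longrightarrow> \<bar>x s - x t\<bar> \<le> e"
    and k: "k \<le> n"
  shows "\<bar>integral {a..a + (b - a) * real k / real n} x
      - (b - a) / real n * (\<Sum>i<k. x (a + (b - a) * real i / real n))\<bar> \<le> e * ((b - a) / real n * real k)"
  using k
proof (induction k)
  case 0
  then show ?case by simp
next
  case (Suc k)
  define u where "u i = a + (b - a) * real i / real n" for i :: nat
  define h where "h = (b - a) / real n"
  have h0: "0 \<le> h" using ab by (simp add: h_def)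
  have uS: "u (Suc k) = u k + h"
    by (simp add: u_def h_def field_simps add_divide_distrib[symmetric])
  have uk: "u k \<in> {a..b}" unfolding u_def using sample_point_in[OF ab] Suc.prems by auto
  have "(b - a) * real (Suc k) / real n \<le> (b - a) * 1"
    using Suc.prems ab n by (simp add: divide_le_eq mult_left_mono del: of_nat_Suc)
  then have uSk: "u (Suc k) \<le> b" unfolding u_def by simp
  have int: "x integrable_on {a..u (Suc k)}"
    using uSk by (intro integrable_continuous_real continuous_on_subset[OF cont]) auto
  have int': "x integrable_on {u k..u (Suc k)}"
    using uSk uk by (intro integrable_continuous_real continuous_on_subset[OF cont]) auto
  have split: "integral {a..u (Suc k)} x = integral {a..u k} x + integral {u k..u (Suc k)} x"
    using Henstock_Kurzweil_Integration.integral_combine[of a "u k" "u (Suc k)" x] uk uS h0 int by auto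
  have "norm (integral (cbox (u k) (u (Suc k))) (\<lambda>s. x s - x (u k))) \<le> e * measure lborel (cbox (u k) (u (Suc k)))"
  proof (rule integrable_bound)
    show "0 \<le> e"
      using osc[of a a] ab by simp
    show "(\<lambda>s. x s - x (u k)) integrable_on cbox (u k) (u (Suc k))"
      using int' by (auto intro: integrable_diff)
    show "norm (x s - x (u k)) \<le> e" if "s \<in> cbox (u k) (u (Suc k))" for s
      using that uk uSk uS unfolding real_norm_def by (intro osc) (auto simp: h_def)
  qed
  then have "\<bar>integral {u k..u (Suc k)} x - h * x (u k)\<bar> \<le> e * h"
    using int' uS h0 Henstock_Kurzweil_Integration.integral_diff[OF int', of "\<lambda>_. x (u k)"]
    by (simp add: integrable_const_ivl)
  moreover have "\<bar>integral {a..u k} x - h * (\<Sum>i<k. x (u i))\<bar> \<le> e * (h * real k)"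
    using Suc unfolding u_def h_def by simp
  ultimately have "\<bar>integral {a..u (Suc k)} x - h * (\<Sum>i<Suc k. x (u i))\<bar> \<le> e * h + e * (h * real k)"
    unfolding split by (simp add: algebra_simps)
  also have "\<dots> = e * (h * real (Suc k))" by (simp add: algebra_simps)
  finally show ?case unfolding u_def h_def .
qed

lemma riemann_sums_tendsto:
  fixes x :: "real \<Rightarrow> real"
  assumes cont: "continuous_on {a..b} x" and ab: "a < b"
  shows "(\<lambda>n. (\<Sum>i<n. x (a + (b - a) * real i / real n)) / real n) \<longlonglongrightarrow> integral {a..b} x / (b - a)"
proof (rule LIMSEQ_I)
  fix e :: real assume e: "e > 0"
  have "uniformly_continuous_on {a..b} x"
    using cont by (intro compact_uniformly_continuous) auto
  then obtain d where d: "d > 0" "\<And>s t. s \<in> {a..b} \<Longrightarrow> t \<in> {a..b} \<Longrightarrow> dist t s < d \<Longrightarrow> dist (x t) (x s) < e / 2"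
    using e unfolding uniformly_continuous_on_def by (metis half_gt_zero)
  obtain m where m: "real m > (b - a) / d" using reals_Archimedean2 by blast
  have "norm ((\<Sum>i<n. x (a + (b - a) * real i / real n)) / real n - integral {a..b} x / (b - a)) < e"
    if n: "n \<ge> max m 1" for n
  proof -
    have n0: "n > 0" using n by simp
    have "(b - a) / d < real n" using m n by linarith
    then have "(b - a) / real n < d" using d(1) n0 by (simp add: field_simps)
    then have "\<bar>integral {a..a + (b - a) * real n / real n} x
      - (b - a) / real n * (\<Sum>i<n. x (a + (b - a) * real i / real n))\<bar> \<le> e / 2 * ((b - a) / real n * real n)"
      using d(2) ab by (intro riemann_sum_error[OF cont _ n0]) (force simp: dist_real_def abs_minus_commute)+
    then have "\<bar>integral {a..b} x - (b - a) / real n * (\<Sum>i<n. x (a + (b - a) * real i / real n))\<bar> \<le> e / 2 * (b - a)"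
      using n0 by simp
    then have "\<bar>integral {a..b} x - (b - a) / real n * (\<Sum>i<n. x (a + (b - a) * real i / real n))\<bar> / (b - a) \<le> e / 2"
      using ab by (simp add: divide_le_eq)
    moreover have "\<bar>integral {a..b} x - (b - a) / real n * (\<Sum>i<n. x (a + (b - a) * real i / real n))\<bar> / (b - a)
        = \<bar>(\<Sum>i<n. x (a + (b - a) * real i / real n)) / real n - integral {a..b} x / (b - a)\<bar>"
    proof -
      have "(integral {a..b} x - (b - a) / real n * (\<Sum>i<n. x (a + (b - a) * real i / real n))) / (b - a)
        = - ((\<Sum>i<n. x (a + (b - a) * real i / real n)) / real n - integral {a..b} x / (b - a))"
        using ab n0 by (simp add: divide_simps)
      from arg_cong[OF this, of abs] show ?thesis
        using ab by (simp only: abs_divide abs_minus_cancel abs_of_pos diff_gt_0_iff_gt)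
    qed
    ultimately show ?thesis using e unfolding real_norm_def by linarith
  qed
  then show "\<exists>no. \<forall>n\<ge>no. norm ((\<Sum>i<n. x (a + (b - a) * real i / real n)) / real n - integral {a..b} x / (b - a)) < e"
    by blast
qed

lemma path_mean_tendsto:
  fixes x :: "real \<Rightarrow> real"
  assumes "continuous_on {a..b} x" "a \<le> b"
  shows "(\<lambda>n. (\<Sum>i<n. x (a + (b - a) * real i / real n)) / real n) \<longlonglongrightarrow> path_mean a b x"
proof (cases "a = b")
  case True
  have "(\<lambda>n. (\<Sum>i<n. x (a + (b - a) * real i / real n)) / real n) \<longlonglongrightarrow> x a"
    by (rule tendsto_eventually) (rule eventually_sequentiallyI[of 1], simp add: True)
  from this limI[OF this] show ?thesis unfolding path_mean_def by simp
next
  case False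
  then have "a < b" using assms by simp
  from riemann_sums_tendsto[OF assms(1) this] limI[OF riemann_sums_tendsto[OF assms(1) this]]
  show ?thesis unfolding path_mean_def by simp
qed

lemma path_mean_integral:
  fixes x :: "real \<Rightarrow> real"
  assumes "continuous_on {a..b} x" "a \<le> b"
  shows "(b - a) * path_mean a b x = integral {a..b} x"
proof (cases "a = b")
  case False
  then have "a < b" using assms by simp
  with LIMSEQ_unique[OF path_mean_tendsto[OF assms] riemann_sums_tendsto[OF assms(1) this]]
  show ?thesis by simp
qed simp

lemma path_mean_LBINT:
  fixes x :: "real \<Rightarrow> real"
  assumes "continuous_on {a..b} x" "a \<le> b"
  shows "(LBINT s=ereal a..ereal b. x s) = (b - a) * path_mean a b x"
  using assms
  by (simp add: path_mean_integral interval_integral_eq_integral borel_integrable_atLeastAtMost')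

lemma sample_mean_in:
  fixes x :: "real \<Rightarrow> real"
  assumes "convex C" "a \<le> b" "\<And>s. s \<in> {a..b} \<Longrightarrow> x s \<in> C" "n > 0"
  shows "(\<Sum>i<n. x (a + (b - a) * real i / real n)) / real n \<in> C"
proof -
  have "(\<Sum>i\<in>{..<n}. (1 / real n) *\<^sub>R x (a + (b - a) * real i / real n)) \<in> C"
    using assms sample_point_in[OF assms(2)] by (intro convex_sum) auto
  then show ?thesis by (simp add: sum_divide_distrib)
qed

text \<open>The range of a continuous path over a compact interval is a compact interval, so it contains
  the sample means and their limit.\<close>

lemma path_mean_in:
  fixes x :: "real \<Rightarrow> real"
  assumes cont: "continuous_on {a..b} x" and ab: "a \<le> b" and C: "\<And>s. s \<in> {a..b} \<Longrightarrow> x s \<in> C"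
  shows "path_mean a b x \<in> C"
proof -
  have "connected (x ` {a..b})" "compact (x ` {a..b})"
    using cont by (auto intro: connected_continuous_image compact_continuous_image)
  then have cv: "convex (x ` {a..b})" and cl: "closed (x ` {a..b})"
    by (simp_all add: compact_imp_closed is_interval_connected_1[symmetric] is_interval_convex_1)
  have "path_mean a b x \<in> x ` {a..b}"
  proof (rule Lim_in_closed_set[OF cl _ _ path_mean_tendsto[OF cont ab]])
    show "\<forall>\<^sub>F n in sequentially. (\<Sum>i<n. x (a + (b - a) * real i / real n)) / real n \<in> x ` {a..b}"
      using sample_mean_in[OF cv ab] by (intro eventually_sequentiallyI[of 1]) auto
  qed simp
  then show ?thesis using C by auto
qed

lemma path_mean_mono_abs:
  fixes x y :: "real \<Rightarrow> real"
  assumes "continuous_on {a..b} x" "continuous_on {a..b} y" "a \<le> b" "\<And>s. s \<in> {a..b} \<Longrightarrow> \<bar>x s\<bar> \<le> y s"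
  shows "\<bar>path_mean a b x\<bar> \<le> path_mean a b y"
proof (rule LIMSEQ_le[OF tendsto_rabs[OF path_mean_tendsto[OF assms(1,3)]] path_mean_tendsto[OF assms(2,3)]])
  have "\<bar>(\<Sum>i<n. x (a + (b - a) * real i / real n)) / real n\<bar>
     \<le> (\<Sum>i<n. y (a + (b - a) * real i / real n)) / real n" for n
    using assms(4) sample_point_in[OF assms(3)]
    by (auto intro!: divide_right_mono order_trans[OF sum_abs] sum_mono)
  then show "\<exists>N. \<forall>n\<ge>N. \<bar>(\<Sum>i<n. x (a + (b - a) * real i / real n)) / real n\<bar>
     \<le> (\<Sum>i<n. y (a + (b - a) * real i / real n)) / real n" by blast
qed

lemma path_mean_diff:
  fixes x y :: "real \<Rightarrow> real"
  assumes "continuous_on {a..b} x" "continuous_on {a..b} y" "a \<le> b"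
  shows "path_mean a b (\<lambda>s. x s - y s) = path_mean a b x - path_mean a b y"
proof -
  have "(\<lambda>n. (\<Sum>i<n. x (a + (b - a) * real i / real n) - y (a + (b - a) * real i / real n)) / real n)
    \<longlonglongrightarrow> path_mean a b x - path_mean a b y"
    using tendsto_diff[OF path_mean_tendsto[OF assms(1,3)] path_mean_tendsto[OF assms(2,3)]]
    by (simp add: sum_subtractf diff_divide_distrib)
  then show ?thesis unfolding path_mean_def[of a b "\<lambda>s. x s - y s"] by (rule limI)
qed

lemma path_mean_cmult:
  fixes x :: "real \<Rightarrow> real"
  assumes "continuous_on {a..b} x" "a \<le> b"
  shows "path_mean a b (\<lambda>s. c * x s) = c * path_mean a b x"
proof -
  have "(\<lambda>n. (\<Sum>i<n. c * x (a + (b - a) * real i / real n)) / real n) \<longlonglongrightarrow> c * path_mean a b x"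
    using tendsto_mult_left[OF path_mean_tendsto[OF assms], of c]
    by (simp add: sum_distrib_left)
  then show ?thesis unfolding path_mean_def[of a b "\<lambda>s. c * x s"] by (rule limI)
qed

lemma path_mean_const: "path_mean a b (\<lambda>s. c) = c"
proof -
  have "(\<lambda>n. (\<Sum>i<n. c) / real n) \<longlonglongrightarrow> c"
    by (rule tendsto_eventually) (rule eventually_sequentiallyI[of 1], auto)
  then show ?thesis unfolding path_mean_def by (rule limI)
qed

section \<open>Second order Taylor estimate\<close>

lemma taylor2_bound:
  fixes g g' g'' :: "real \<Rightarrow> real"
  assumes g: "\<And>y. (g has_real_derivative g' y) (at y)"
    and g': "\<And>y. (g' has_real_derivative g'' y) (at y)"
    and K: "\<And>y. y \<in> closed_segment a b \<Longrightarrow> \<bar>g'' y\<bar> \<le> K"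
  shows "\<bar>g b - g a - g' a * (b - a)\<bar> \<le> K * (b - a)\<^sup>2"
proof -
  have lip: "\<bar>g' y - g' a\<bar> \<le> K * \<bar>y - a\<bar>" if "y \<in> closed_segment a b" for y
  proof -
    have "norm (g' y - g' a) \<le> K * norm (y - a)"
    proof (rule field_differentiable_bound[of "closed_segment a y" g' g''])
      show "\<And>z. z \<in> closed_segment a y \<Longrightarrow> (g' has_field_derivative g'' z) (at z within closed_segment a y)"
        using g' has_field_derivative_at_within by blast
      have "closed_segment a y \<subseteq> closed_segment a b"
        using that by (simp add: subset_closed_segment)
      then show "\<And>z. z \<in> closed_segment a y \<Longrightarrow> norm (g'' z) \<le> K" using K by auto
    qed auto
    then show ?thesis by simp
  qed
  have K0: "0 \<le> K" using K[of a] abs_ge_zero[of "g'' a"] by (auto intro: order_trans)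
  have "norm ((g b - g' a * b) - (g a - g' a * a)) \<le> (K * \<bar>b - a\<bar>) * norm (b - a)"
  proof (rule field_differentiable_bound[of "closed_segment a b" "\<lambda>y. g y - g' a * y" "\<lambda>y. g' y - g' a"])
    show "((\<lambda>y. g y - g' a * y) has_field_derivative g' z - g' a) (at z within closed_segment a b)" for z
      by (rule has_field_derivative_at_within) (auto intro!: derivative_eq_intros g)
    show "norm (g' z - g' a) \<le> K * \<bar>b - a\<bar>" if "z \<in> closed_segment a b" for z
    proof -
      have "\<bar>z - a\<bar> \<le> \<bar>b - a\<bar>" using that by (auto simp: closed_segment_eq_real_ivl split: if_splits)
      then show ?thesis using lip[OF that] K0 by (auto intro: order_trans mult_left_mono)
    qed
  qed auto
  then show ?thesis by (simp add: algebra_simps power2_eq_square abs_mult)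
qed

section \<open>Explicit solution of the Ornstein-Uhlenbeck equation\<close>

text \<open>Kept as an explicit functional of the driving path, with the integral written as a path mean:
  this shows that the value at time \<open>t\<close> depends measurably on the driving path up to \<open>t\<close>, which the
  filtration argument and the conditioning argument both need.\<close>

definition ou_path :: "real \<Rightarrow> real \<Rightarrow> real \<Rightarrow> real \<Rightarrow> (real \<Rightarrow> real) \<Rightarrow> real \<Rightarrow> real" where
  "ou_path \<nu> \<kappa> \<theta> y0 w t = y0 + \<nu> * w t
     - \<kappa> * exp (- (\<kappa> * t)) * (t * path_mean 0 t (\<lambda>s. exp (\<kappa> * s) * (y0 - \<theta> + \<nu> * w s)))"

lemma ou_path_cong:
  assumes "0 \<le> t" "\<And>s. s \<in> {0..t} \<Longrightarrow> v s = w s"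
  shows "ou_path \<nu> \<kappa> \<theta> y0 v t = ou_path \<nu> \<kappa> \<theta> y0 w t"
proof -
  have "path_mean 0 t (\<lambda>s. exp (\<kappa> * s) * (y0 - \<theta> + \<nu> * v s))
    = path_mean 0 t (\<lambda>s. exp (\<kappa> * s) * (y0 - \<theta> + \<nu> * w s))"
    using assms by (intro path_mean_cong) auto
  then show ?thesis using assms by (simp add: ou_path_def)
qed

lemma ou_path_measurable:
  assumes "0 \<le> t" "\<And>s. s \<in> {0..t} \<Longrightarrow> (\<lambda>\<omega>. w \<omega> s) \<in> borel_measurable M"
  shows "(\<lambda>\<omega>. ou_path \<nu> \<kappa> \<theta> y0 (w \<omega>) t) \<in> borel_measurable M"
proof -
  have [measurable]: "(\<lambda>\<omega>. path_mean 0 t (\<lambda>s. exp (\<kappa> * s) * (y0 - \<theta> + \<nu> * w \<omega> s))) \<in> borel_measurable M"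
    using assms by (intro path_mean_measurable) auto
  have [measurable]: "(\<lambda>\<omega>. w \<omega> t) \<in> borel_measurable M" using assms by auto
  show ?thesis unfolding ou_path_def by measurable
qed

text \<open>With \<open>J(t) = \<integral>\<^sub>0\<^sup>t (y - \<theta>)\<close>, the equation reads \<open>J' = y0 - \<theta> + \<nu> w - \<kappa> J\<close>. This is linear in
  \<open>J\<close>, and the integrating factor \<open>exp (\<kappa> t)\<close> solves it.\<close>

lemma ou_solution_explicit:
  fixes y w :: "real \<Rightarrow> real"
  assumes cy: "continuous_on {0..T} y" and cw: "continuous_on {0..T} w"
    and eq: "\<And>t. t \<in> {0..T} \<Longrightarrow> y t = y0 + \<nu> * w t + (LBINT s=ereal 0..ereal t. \<kappa> * (\<theta> - y s))"
    and t: "t \<in> {0..T}"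
  shows "y t = ou_path \<nu> \<kappa> \<theta> y0 w t"
proof -
  define J where "J u = integral {0..u} (\<lambda>s. y s - \<theta>)" for u
  define z where "z s = exp (\<kappa> * s) * (y0 - \<theta> + \<nu> * w s)" for s
  have yJ: "y u = y0 + \<nu> * w u - \<kappa> * J u" if "u \<in> {0..T}" for u
  proof -
    have c: "continuous_on {0..u} y" using that by (auto intro: continuous_on_subset[OF cy])
    then have "(LBINT s=ereal 0..ereal u. \<kappa> * (\<theta> - y s)) = integral {0..u} (\<lambda>s. \<kappa> * (\<theta> - y s))"
      using that by (intro interval_integral_eq_integral borel_integrable_atLeastAtMost' continuous_intros) auto
    also have "\<dots> = integral {0..u} (\<lambda>s. - \<kappa> * (y s - \<theta>))"
      by (intro integral_cong) (auto simp: algebra_simps)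
    also have "\<dots> = - \<kappa> * J u" unfolding J_def by (rule integral_mult_right)
    finally show ?thesis using eq[OF that] by simp
  qed
  have d: "((\<lambda>u. exp (\<kappa> * u) * J u) has_real_derivative z u) (at u within {0..T})" if u: "u \<in> {0..T}" for u
  proof -
    have "(J has_real_derivative y u - \<theta>) (at u within {0..T})"
      unfolding J_def using u by (intro integral_has_real_derivative) (auto intro!: continuous_intros cy)
    then have "((\<lambda>u. exp (\<kappa> * u) * J u) has_real_derivative
        exp (\<kappa> * u) * (y u - \<theta>) + \<kappa> * exp (\<kappa> * u) * J u) (at u within {0..T})"
      by (auto intro!: derivative_eq_intros)
    then show ?thesis unfolding z_def yJ[OF u] by (simp add: algebra_simps)
  qed
  have "(z has_integral exp (\<kappa> * t) * J t - exp (\<kappa> * 0) * J 0) {0..t}"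
  proof (intro fundamental_theorem_of_calculus)
    show "0 \<le> t" using t by simp
    fix u assume u: "u \<in> {0..t}"
    with t have "u \<in> {0..T}" "{0..t} \<subseteq> {0..T}" by auto
    with d[of u] show "((\<lambda>u. exp (\<kappa> * u) * J u) has_vector_derivative z u) (at u within {0..t})"
      unfolding has_real_derivative_iff_has_vector_derivative[symmetric] by (blast intro: DERIV_subset)
  qed
  then have "integral {0..t} z = exp (\<kappa> * t) * J t" by (auto simp: J_def dest: integral_unique)
  moreover have "integral {0..t} z = t * path_mean 0 t z"
  proof -
    have "continuous_on {0..t} z" unfolding z_def
      using t by (intro continuous_intros continuous_on_subset[OF cw]) auto
    from path_mean_integral[OF this] t show ?thesis by simp
  qed
  ultimately have "J t = exp (- (\<kappa> * t)) * (t * path_mean 0 t z)"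
    by (simp add: exp_minus field_simps)
  then show ?thesis using yJ[OF t] unfolding ou_path_def z_def by simp
qed

section \<open>Families with uniformly bounded moments\<close>

text \<open>All estimates below are uniform in the step number and in the grid point. Treating the indexed
  family as one object turns them into closure rules: sums, products and time averages of such
  families are again such families.\<close>

definition unif_moments :: "'a measure \<Rightarrow> 'i set \<Rightarrow> ('i \<Rightarrow> 'a \<Rightarrow> real) \<Rightarrow> bool" where
  "unif_moments M I X \<longleftrightarrow> (\<forall>i\<in>I. X i \<in> borel_measurable M) \<and>
     (\<forall>n. \<exists>C. \<forall>i\<in>I. (\<integral>\<^sup>+\<omega>. ennreal (\<bar>X i \<omega>\<bar> ^ n) \<partial>M) \<le> ennreal C)"

abbreviation all_moments :: "'a measure \<Rightarrow> ('a \<Rightarrow> real) \<Rightarrow> bool" where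
  "all_moments M X \<equiv> unif_moments M UNIV (\<lambda>_::unit. X)"

lemma unif_moments_measurable: "unif_moments M I X \<Longrightarrow> i \<in> I \<Longrightarrow> X i \<in> borel_measurable M"
  by (simp add: unif_moments_def)

lemma unif_momentsE:
  assumes "unif_moments M I X"
  obtains C where "C \<ge> 0" "\<And>i. i \<in> I \<Longrightarrow> (\<integral>\<^sup>+\<omega>. ennreal (\<bar>X i \<omega>\<bar> ^ n) \<partial>M) \<le> ennreal C"
proof -
  from assms obtain C where C: "\<And>i. i \<in> I \<Longrightarrow> (\<integral>\<^sup>+\<omega>. ennreal (\<bar>X i \<omega>\<bar> ^ n) \<partial>M) \<le> ennreal C"
    unfolding unif_moments_def by blast
  show ?thesis
  proof (rule that[of "max C 0"])
    show "(\<integral>\<^sup>+\<omega>. ennreal (\<bar>X i \<omega>\<bar> ^ n) \<partial>M) \<le> ennreal (max C 0)" if "i \<in> I" for i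
      using C[OF that] by (rule order_trans) (simp add: ennreal_leI)
  qed simp
qed

lemma unif_moments_reindex:
  assumes "unif_moments M I X" "\<And>j. j \<in> J \<Longrightarrow> g j \<in> I"
  shows "unif_moments M J (\<lambda>j. X (g j))"
  using assms unfolding unif_moments_def by fast

lemma unif_moments_single: "unif_moments M I X \<Longrightarrow> i \<in> I \<Longrightarrow> all_moments M (X i)"
  by (rule unif_moments_reindex) auto

lemma unif_moments_dominated:
  assumes Y: "unif_moments M I Y" and X: "\<And>i. i \<in> I \<Longrightarrow> X i \<in> borel_measurable M"
    and le: "\<And>i. i \<in> I \<Longrightarrow> AE \<omega> in M. \<bar>X i \<omega>\<bar> \<le> \<bar>Y i \<omega>\<bar>"
  shows "unif_moments M I X"
  unfolding unif_moments_def
proof (intro conjI allI ballI)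
  fix n
  from Y obtain C where C: "\<And>i. i \<in> I \<Longrightarrow> (\<integral>\<^sup>+\<omega>. ennreal (\<bar>Y i \<omega>\<bar> ^ n) \<partial>M) \<le> ennreal C"
    unfolding unif_moments_def by blast
  have "(\<integral>\<^sup>+\<omega>. ennreal (\<bar>X i \<omega>\<bar> ^ n) \<partial>M) \<le> ennreal C" if i: "i \<in> I" for i
  proof -
    have "(\<integral>\<^sup>+\<omega>. ennreal (\<bar>X i \<omega>\<bar> ^ n) \<partial>M) \<le> (\<integral>\<^sup>+\<omega>. ennreal (\<bar>Y i \<omega>\<bar> ^ n) \<partial>M)"
      using le[OF i] by (intro nn_integral_mono_AE) (auto elim!: eventually_mono intro!: ennreal_leI power_mono)
    with C[OF i] show ?thesis by simp
  qed
  then show "\<exists>C. \<forall>i\<in>I. (\<integral>\<^sup>+\<omega>. ennreal (\<bar>X i \<omega>\<bar> ^ n) \<partial>M) \<le> ennreal C" by blast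
qed (use X in auto)

lemma unif_moments_abs: "unif_moments M I X \<Longrightarrow> unif_moments M I (\<lambda>i \<omega>. \<bar>X i \<omega>\<bar>)"
  by (rule unif_moments_dominated) (auto intro!: borel_measurable_abs unif_moments_measurable)

lemma unif_moments_power:
  assumes "unif_moments M I X"
  shows "unif_moments M I (\<lambda>i \<omega>. X i \<omega> ^ k)"
  using assms unfolding unif_moments_def
  by (auto simp: power_abs[symmetric] power_mult[symmetric])

lemma abs_add_power_le:
  fixes x y :: real
  shows "\<bar>x + y\<bar> ^ n \<le> 2 ^ n * (\<bar>x\<bar> ^ n + \<bar>y\<bar> ^ n)"
proof -
  have "\<bar>x + y\<bar> ^ n \<le> (2 * max \<bar>x\<bar> \<bar>y\<bar>) ^ n" by (intro power_mono) auto
  also have "\<dots> = 2 ^ n * max \<bar>x\<bar> \<bar>y\<bar> ^ n" by (simp add: power_mult_distrib)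
  also have "max \<bar>x\<bar> \<bar>y\<bar> ^ n \<le> \<bar>x\<bar> ^ n + \<bar>y\<bar> ^ n" by (auto simp: max_def)
  finally show ?thesis by simp
qed

lemma unif_moments_add:
  assumes X: "unif_moments M I X" and Y: "unif_moments M I Y"
  shows "unif_moments M I (\<lambda>i \<omega>. X i \<omega> + Y i \<omega>)"
  unfolding unif_moments_def
proof (intro conjI allI ballI)
  fix n
  obtain C where C: "C \<ge> 0" "\<And>i. i \<in> I \<Longrightarrow> (\<integral>\<^sup>+\<omega>. ennreal (\<bar>X i \<omega>\<bar> ^ n) \<partial>M) \<le> ennreal C"
    using unif_momentsE[OF X] by blast
  obtain D where D: "D \<ge> 0" "\<And>i. i \<in> I \<Longrightarrow> (\<integral>\<^sup>+\<omega>. ennreal (\<bar>Y i \<omega>\<bar> ^ n) \<partial>M) \<le> ennreal D"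
    using unif_momentsE[OF Y] by blast
  have "(\<integral>\<^sup>+\<omega>. ennreal (\<bar>X i \<omega> + Y i \<omega>\<bar> ^ n) \<partial>M) \<le> ennreal (2 ^ n * (C + D))" if i: "i \<in> I" for i
  proof -
    note [measurable] = X[THEN unif_moments_measurable, OF i] Y[THEN unif_moments_measurable, OF i]
    have "(\<integral>\<^sup>+\<omega>. ennreal (\<bar>X i \<omega> + Y i \<omega>\<bar> ^ n) \<partial>M)
      \<le> (\<integral>\<^sup>+\<omega>. ennreal (2 ^ n) * (ennreal (\<bar>X i \<omega>\<bar> ^ n) + ennreal (\<bar>Y i \<omega>\<bar> ^ n)) \<partial>M)"
      by (intro nn_integral_mono)
        (simp add: abs_add_power_le ennreal_plus[symmetric] ennreal_mult'[symmetric] ennreal_leI del: ennreal_plus)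
    also have "\<dots> = ennreal (2 ^ n) * ((\<integral>\<^sup>+\<omega>. ennreal (\<bar>X i \<omega>\<bar> ^ n) \<partial>M) + (\<integral>\<^sup>+\<omega>. ennreal (\<bar>Y i \<omega>\<bar> ^ n) \<partial>M))"
      by (simp add: nn_integral_cmult nn_integral_add)
    also have "\<dots> \<le> ennreal (2 ^ n) * (ennreal C + ennreal D)"
      using C(2)[OF i] D(2)[OF i] by (intro mult_left_mono add_mono) auto
    also have "\<dots> = ennreal (2 ^ n * (C + D))" using C D by (simp add: ennreal_mult')
    finally show ?thesis .
  qed
  then show "\<exists>C. \<forall>i\<in>I. (\<integral>\<^sup>+\<omega>. ennreal (\<bar>X i \<omega> + Y i \<omega>\<bar> ^ n) \<partial>M) \<le> ennreal C" by blast
qed (use unif_moments_measurable[OF X] unif_moments_measurable[OF Y] in auto)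

lemma unif_moments_mult:
  assumes X: "unif_moments M I X" and Y: "unif_moments M I Y"
  shows "unif_moments M I (\<lambda>i \<omega>. X i \<omega> * Y i \<omega>)"
proof (rule unif_moments_dominated)
  show "unif_moments M I (\<lambda>i \<omega>. X i \<omega> ^ 2 + Y i \<omega> ^ 2)"
    by (intro unif_moments_add unif_moments_power X Y)
  show "(\<lambda>\<omega>. X i \<omega> * Y i \<omega>) \<in> borel_measurable M" if "i \<in> I" for i
    using unif_moments_measurable[OF X that] unif_moments_measurable[OF Y that] by auto
  have "\<bar>x * y\<bar> \<le> \<bar>x\<^sup>2 + y\<^sup>2\<bar>" for x y :: real
  proof -
    have "0 \<le> (\<bar>x\<bar> - \<bar>y\<bar>)\<^sup>2" by simp
    then have "2 * (\<bar>x\<bar> * \<bar>y\<bar>) \<le> x\<^sup>2 + y\<^sup>2" by (simp add: power2_diff)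
    moreover have "0 \<le> \<bar>x\<bar> * \<bar>y\<bar>" by simp
    ultimately show ?thesis unfolding abs_mult by linarith
  qed
  then show "AE \<omega> in M. \<bar>X i \<omega> * Y i \<omega>\<bar> \<le> \<bar>(X i \<omega>)\<^sup>2 + (Y i \<omega>)\<^sup>2\<bar>" for i by simp
qed

lemma (in prob_space) unif_moments_const:
  assumes "\<And>i. i \<in> I \<Longrightarrow> \<bar>c i\<bar> \<le> K"
  shows "unif_moments M I (\<lambda>i \<omega>. c i)"
  unfolding unif_moments_def
proof (intro conjI allI ballI)
  fix n
  have "(\<integral>\<^sup>+\<omega>. ennreal (\<bar>c i\<bar> ^ n) \<partial>M) \<le> ennreal (K ^ n)" if "i \<in> I" for i
    using assms[OF that] by (simp add: emeasure_space_1 ennreal_leI power_mono)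
  then show "\<exists>C. \<forall>i\<in>I. (\<integral>\<^sup>+\<omega>. ennreal (\<bar>c i\<bar> ^ n) \<partial>M) \<le> ennreal C" by blast
qed auto

lemma (in prob_space) unif_moments_constant: "unif_moments M I (\<lambda>i \<omega>. c)"
  by (rule unif_moments_const[of _ _ "\<bar>c\<bar>"]) simp

lemma (in prob_space) unif_moments_cmult:
  assumes "unif_moments M I X" "\<And>i. i \<in> I \<Longrightarrow> \<bar>c i\<bar> \<le> K"
  shows "unif_moments M I (\<lambda>i \<omega>. c i * X i \<omega>)"
  by (intro unif_moments_mult assms(1) unif_moments_const[OF assms(2)])

text \<open>Every power is at most \<open>1\<close> plus its square, so it is enough to bound even powers, which are
  convex and free of absolute values.\<close>

lemma (in prob_space) unif_moments_even:
  assumes X: "\<And>i. i \<in> I \<Longrightarrow> X i \<in> borel_measurable M"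
    and C: "\<And>n. \<exists>C. \<forall>i\<in>I. (\<integral>\<^sup>+\<omega>. ennreal (X i \<omega> ^ (2 * n)) \<partial>M) \<le> ennreal C"
  shows "unif_moments M I X"
  unfolding unif_moments_def
proof (intro conjI allI ballI)
  fix n
  obtain C where C: "\<And>i. i \<in> I \<Longrightarrow> (\<integral>\<^sup>+\<omega>. ennreal (X i \<omega> ^ (2 * n)) \<partial>M) \<le> ennreal C"
    using C by blast
  have "(\<integral>\<^sup>+\<omega>. ennreal (\<bar>X i \<omega>\<bar> ^ n) \<partial>M) \<le> ennreal (1 + max C 0)" if i: "i \<in> I" for i
  proof -
    note [measurable] = X[OF i]
    have le: "x ^ n \<le> 1 + x ^ (2 * n)" if "x \<ge> 0" for x :: real
    proof -
      have "0 \<le> (x ^ n - 1)\<^sup>2" by simp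
      then have "2 * x ^ n \<le> 1 + x ^ (2 * n)"
        by (simp add: power2_diff power_mult[symmetric] mult.commute)
      moreover have "0 \<le> x ^ n" using that by simp
      ultimately show ?thesis by linarith
    qed
    have "(\<integral>\<^sup>+\<omega>. ennreal (\<bar>X i \<omega>\<bar> ^ n) \<partial>M) \<le> (\<integral>\<^sup>+\<omega>. 1 + ennreal (X i \<omega> ^ (2 * n)) \<partial>M)"
    proof (intro nn_integral_mono)
      fix \<omega>
      have "\<bar>X i \<omega>\<bar> ^ n \<le> 1 + X i \<omega> ^ (2 * n)" using le[of "\<bar>X i \<omega>\<bar>"] by (simp add: power_mult)
      then have "ennreal (\<bar>X i \<omega>\<bar> ^ n) \<le> ennreal (1 + X i \<omega> ^ (2 * n))" by (rule ennreal_leI)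
      also have "\<dots> = 1 + ennreal (X i \<omega> ^ (2 * n))" by (simp add: power_mult)
      finally show "ennreal (\<bar>X i \<omega>\<bar> ^ n) \<le> 1 + ennreal (X i \<omega> ^ (2 * n))" .
    qed
    also have "\<dots> = 1 + (\<integral>\<^sup>+\<omega>. ennreal (X i \<omega> ^ (2 * n)) \<partial>M)"
      by (simp add: nn_integral_add emeasure_space_1)
    also have "\<dots> \<le> 1 + ennreal (max C 0)"
      using C[OF i] by (intro add_left_mono) (auto intro: order_trans ennreal_leI)
    finally show ?thesis by simp
  qed
  then show "\<exists>C. \<forall>i\<in>I. (\<integral>\<^sup>+\<omega>. ennreal (\<bar>X i \<omega>\<bar> ^ n) \<partial>M) \<le> ennreal C" by blast
qed (use X in auto)

lemma unif_moments_integrable_power: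
  assumes X: "unif_moments M I X" and i: "i \<in> I"
  shows "integrable M (\<lambda>\<omega>. X i \<omega> ^ n)"
proof (rule integrableI_bounded)
  show "(\<lambda>\<omega>. X i \<omega> ^ n) \<in> borel_measurable M" using unif_moments_measurable[OF X i] by simp
  obtain C where "\<And>i. i \<in> I \<Longrightarrow> (\<integral>\<^sup>+\<omega>. ennreal (\<bar>X i \<omega>\<bar> ^ n) \<partial>M) \<le> ennreal C"
    using unif_momentsE[OF X] by blast
  from this[OF i] show "(\<integral>\<^sup>+\<omega>. ennreal (norm (X i \<omega> ^ n)) \<partial>M) < \<infinity>"
    by (simp add: power_abs order_le_less_trans)
qed

lemma unif_moments_integrable: "unif_moments M I X \<Longrightarrow> i \<in> I \<Longrightarrow> integrable M (X i)"
  using unif_moments_integrable_power[of M I X i 1] by simp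

lemma unif_moments_expectation:
  assumes X: "unif_moments M I X"
  obtains C where "C \<ge> 0" "\<And>i. i \<in> I \<Longrightarrow> (LINT \<omega>|M. \<bar>X i \<omega>\<bar> ^ n) \<le> C"
proof -
  obtain C where C: "C \<ge> 0" "\<And>i. i \<in> I \<Longrightarrow> (\<integral>\<^sup>+\<omega>. ennreal (\<bar>X i \<omega>\<bar> ^ n) \<partial>M) \<le> ennreal C"
    using unif_momentsE[OF X] by blast
  show ?thesis
  proof (rule that[OF C(1)])
    fix i assume i: "i \<in> I"
    have "ennreal (LINT \<omega>|M. \<bar>X i \<omega>\<bar> ^ n) = (\<integral>\<^sup>+\<omega>. ennreal (\<bar>X i \<omega>\<bar> ^ n) \<partial>M)"
      using unif_moments_integrable_power[OF unif_moments_abs[OF X] i]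
      by (intro nn_integral_eq_integral[symmetric]) auto
    with C(2)[OF i] have "ennreal (LINT \<omega>|M. \<bar>X i \<omega>\<bar> ^ n) \<le> ennreal C" by (simp only:)
    with C(1) show "(LINT \<omega>|M. \<bar>X i \<omega>\<bar> ^ n) \<le> C" by (simp add: ennreal_le_iff)
  qed
qed

lemma (in prob_space) all_moments_sum:
  assumes "\<And>l. l < k \<Longrightarrow> all_moments M (x l)"
  shows "all_moments M (\<lambda>\<omega>. \<Sum>l<(k::nat). x l \<omega>)"
  using assms
proof (induction k)
  case 0
  show ?case using unif_moments_const[of UNIV "\<lambda>_. 0" 0] by simp
next
  case (Suc k)
  then show ?case by (auto simp: lessThan_Suc add.commute[of "x k _"] intro!: unif_moments_add)
qed

subsection \<open>Moments of path means\<close>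

lemma nn_integral_mean_convex:
  fixes X :: "nat \<Rightarrow> 'a \<Rightarrow> real"
  assumes cv: "convex_on C \<phi>" and nn: "\<And>x. x \<in> C \<Longrightarrow> 0 \<le> \<phi> x"
    and bm: "\<phi> \<in> borel_measurable borel" and n: "n > 0"
    and X: "\<And>i. i < n \<Longrightarrow> X i \<in> borel_measurable M"
    and AE: "AE \<omega> in M. \<forall>i<n. X i \<omega> \<in> C"
    and K: "\<And>i. i < n \<Longrightarrow> (\<integral>\<^sup>+\<omega>. ennreal (\<phi> (X i \<omega>)) \<partial>M) \<le> K"
  shows "(\<integral>\<^sup>+\<omega>. ennreal (\<phi> ((\<Sum>i<n. X i \<omega>) / real n)) \<partial>M) \<le> K"
proof -
  have "AE \<omega> in M. ennreal (\<phi> ((\<Sum>i<n. X i \<omega>) / real n)) \<le> ennreal (1 / real n) * (\<Sum>i<n. ennreal (\<phi> (X i \<omega>)))"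
    using AE
  proof eventually_elim
    case (elim \<omega>)
    have "\<phi> (\<Sum>i<n. (1 / real n) *\<^sub>R X i \<omega>) \<le> (\<Sum>i<n. (1 / real n) * \<phi> (X i \<omega>))"
      using elim n by (intro convex_on_sum[OF _ _ cv]) auto
    then have "\<phi> ((\<Sum>i<n. X i \<omega>) / real n) \<le> (1 / real n) * (\<Sum>i<n. \<phi> (X i \<omega>))"
      by (simp add: sum_divide_distrib)
    then have "ennreal (\<phi> ((\<Sum>i<n. X i \<omega>) / real n)) \<le> ennreal ((1 / real n) * (\<Sum>i<n. \<phi> (X i \<omega>)))"
      by (rule ennreal_leI)
    also have "\<dots> = ennreal (1 / real n) * (\<Sum>i<n. ennreal (\<phi> (X i \<omega>)))"
      using elim nn by (subst ennreal_mult', simp, subst sum_ennreal) auto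
    finally show ?case .
  qed
  then have "(\<integral>\<^sup>+\<omega>. ennreal (\<phi> ((\<Sum>i<n. X i \<omega>) / real n)) \<partial>M)
      \<le> (\<integral>\<^sup>+\<omega>. ennreal (1 / real n) * (\<Sum>i<n. ennreal (\<phi> (X i \<omega>))) \<partial>M)"
    by (rule nn_integral_mono_AE)
  also have "\<dots> = ennreal (1 / real n) * (\<Sum>i<n. (\<integral>\<^sup>+\<omega>. ennreal (\<phi> (X i \<omega>)) \<partial>M))"
  proof -
    have m: "(\<lambda>\<omega>. ennreal (\<phi> (X i \<omega>))) \<in> borel_measurable M" if "i < n" for i
      using measurable_compose[OF X[OF that] bm] by simp
    then have "(\<integral>\<^sup>+\<omega>. (\<Sum>i<n. ennreal (\<phi> (X i \<omega>))) \<partial>M) = (\<Sum>i<n. (\<integral>\<^sup>+\<omega>. ennreal (\<phi> (X i \<omega>)) \<partial>M))"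
      by (intro nn_integral_sum) auto
    with m show ?thesis by (subst nn_integral_cmult) auto
  qed
  also have "\<dots> \<le> ennreal (1 / real n) * (\<Sum>i<n. K)"
    using K by (intro mult_left_mono sum_mono) auto
  also have "\<dots> = ennreal (1 / real n * real n) * K"
    by (subst ennreal_mult) (auto simp: mult.assoc ennreal_of_nat_eq_real_of_nat)
  also have "\<dots> = K" using n by simp
  finally show ?thesis .
qed

text \<open>Jensen's inequality for even powers bounds every sample mean by the worst of its terms.\<close>

lemma (in prob_space) unif_moments_sample_mean:
  assumes Z: "unif_moments M S Z" and u: "\<And>n i. i < n \<Longrightarrow> u n i \<in> S"
  shows "unif_moments M {1..} (\<lambda>n \<omega>. (\<Sum>i<n. Z (u n i) \<omega>) / real n)"
proof (rule unif_moments_even)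
  have m: "Z (u n i) \<in> borel_measurable M" if "i < n" for n i
    using unif_moments_measurable[OF Z] u that by auto
  then show "(\<lambda>\<omega>. (\<Sum>i<n. Z (u n i) \<omega>) / real n) \<in> borel_measurable M" for n
    by (intro borel_measurable_divide borel_measurable_sum) auto
  fix k
  obtain C where "\<And>i. i \<in> S \<Longrightarrow> (\<integral>\<^sup>+\<omega>. ennreal (\<bar>Z i \<omega>\<bar> ^ (2 * k)) \<partial>M) \<le> ennreal C"
    using unif_momentsE[OF Z] by blast
  then have C: "(\<integral>\<^sup>+\<omega>. ennreal (Z i \<omega> ^ (2 * k)) \<partial>M) \<le> ennreal C" if "i \<in> S" for i
    using that by (force simp: power_mult)
  have "(\<integral>\<^sup>+\<omega>. ennreal (((\<Sum>i<n. Z (u n i) \<omega>) / real n) ^ (2 * k)) \<partial>M) \<le> ennreal C" if n: "n \<in> {1..}" for n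
    using C u n m
    by (intro nn_integral_mean_convex[where C=UNIV and \<phi>="\<lambda>x. x ^ (2 * k)"])
      (auto intro: convex_power_even)
  then show "\<exists>C. \<forall>n\<in>{1..}. (\<integral>\<^sup>+\<omega>. ennreal (((\<Sum>i<n. Z (u n i) \<omega>) / real n) ^ (2 * k)) \<partial>M) \<le> ennreal C"
    by blast
qed

text \<open>Jensen's inequality holds for every sample mean, and Fatou's lemma passes it to the limit. Only
  finitely many times are used at once, so measurability at each fixed time is enough.\<close>

lemma nn_integral_path_mean_convex:
  fixes X :: "real \<Rightarrow> 'a \<Rightarrow> real"
  assumes cv: "convex_on C \<phi>" and ct: "continuous_on C \<phi>" and nn: "\<And>x. x \<in> C \<Longrightarrow> 0 \<le> \<phi> x"
    and bm: "\<phi> \<in> borel_measurable borel" and ab: "a \<le> b"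
    and X: "\<And>s. s \<in> {a..b} \<Longrightarrow> X s \<in> borel_measurable M"
    and AE: "AE \<omega> in M. continuous_on {a..b} (\<lambda>s. X s \<omega>) \<and> (\<forall>s\<in>{a..b}. X s \<omega> \<in> C)"
    and K: "\<And>s. s \<in> {a..b} \<Longrightarrow> (\<integral>\<^sup>+\<omega>. ennreal (\<phi> (X s \<omega>)) \<partial>M) \<le> K"
  shows "(\<integral>\<^sup>+\<omega>. ennreal (\<phi> (path_mean a b (\<lambda>s. X s \<omega>))) \<partial>M) \<le> K"
proof -
  define u where "u n i = a + (b - a) * real i / real n" for n i :: nat
  have u: "u n i \<in> {a..b}" if "i < n" for n i
    using sample_point_in[OF ab that] by (simp add: u_def)
  define A where "A n \<omega> = (\<Sum>i<n. X (u n i) \<omega>) / real n" for n \<omega>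
  have [measurable]: "X (u n i) \<in> borel_measurable M" if "i < n" for n i using X u[OF that] by blast
  have A[measurable]: "A n \<in> borel_measurable M" for n
    unfolding A_def by (intro borel_measurable_divide borel_measurable_sum) auto
  have conv: "convex C" using cv by (simp add: convex_on_def)
  have le: "(\<integral>\<^sup>+\<omega>. ennreal (\<phi> (A n \<omega>)) \<partial>M) \<le> K" if n: "n > 0" for n
    unfolding A_def
  proof (rule nn_integral_mean_convex[OF cv nn bm n])
    show "AE \<omega> in M. \<forall>i<n. X (u n i) \<omega> \<in> C" using AE by eventually_elim (use u in auto)
  qed (use u X K in auto)
  have "AE \<omega> in M. ennreal (\<phi> (path_mean a b (\<lambda>s. X s \<omega>))) = liminf (\<lambda>n. ennreal (\<phi> (A n \<omega>)))"
    using AE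
  proof eventually_elim
    case (elim \<omega>)
    have "(\<lambda>n. A n \<omega>) \<longlonglongrightarrow> path_mean a b (\<lambda>s. X s \<omega>)"
      using path_mean_tendsto[of a b "\<lambda>s. X s \<omega>"] elim ab unfolding A_def u_def by simp
    moreover have "path_mean a b (\<lambda>s. X s \<omega>) \<in> C"
      using elim ab by (intro path_mean_in) auto
    moreover have "\<forall>\<^sub>F n in sequentially. A n \<omega> \<in> C"
      using sample_mean_in[OF conv ab, of "\<lambda>s. X s \<omega>"] elim unfolding A_def u_def
      by (intro eventually_sequentiallyI[of 1]) auto
    ultimately have "(\<lambda>n. \<phi> (A n \<omega>)) \<longlonglongrightarrow> \<phi> (path_mean a b (\<lambda>s. X s \<omega>))"
      using continuous_on_tendsto_compose[OF ct] by blast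
    then have "(\<lambda>n. ennreal (\<phi> (A n \<omega>))) \<longlonglongrightarrow> ennreal (\<phi> (path_mean a b (\<lambda>s. X s \<omega>)))"
      by (rule tendsto_ennrealI)
    then show ?case by (intro lim_imp_Liminf[symmetric]) auto
  qed
  then have "(\<integral>\<^sup>+\<omega>. ennreal (\<phi> (path_mean a b (\<lambda>s. X s \<omega>))) \<partial>M) = (\<integral>\<^sup>+\<omega>. liminf (\<lambda>n. ennreal (\<phi> (A n \<omega>))) \<partial>M)"
    by (rule nn_integral_cong_AE)
  also have "\<dots> \<le> liminf (\<lambda>n. (\<integral>\<^sup>+\<omega>. ennreal (\<phi> (A n \<omega>)) \<partial>M))"
    using measurable_compose[OF A bm] by (intro nn_integral_liminf) auto
  also have "\<dots> \<le> liminf (\<lambda>n::nat. K)"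
    using le by (intro Liminf_mono eventually_sequentiallyI[of 1]) auto
  also have "\<dots> = K" by (simp add: Liminf_const)
  finally show ?thesis .
qed

lemma (in prob_space) unif_moments_path_mean:
  assumes X: "unif_moments M {(i, s). i \<in> I \<and> s \<in> {a i..b i}} (\<lambda>(i, s). X i s)"
    and ab: "\<And>i. i \<in> I \<Longrightarrow> a i \<le> b i"
    and AE: "\<And>i. i \<in> I \<Longrightarrow> AE \<omega> in M. continuous_on {a i..b i} (\<lambda>s. X i s \<omega>)"
  shows "unif_moments M I (\<lambda>i \<omega>. path_mean (a i) (b i) (\<lambda>s. X i s \<omega>))"
proof (rule unif_moments_even)
  have m: "X i s \<in> borel_measurable M" if "i \<in> I" "s \<in> {a i..b i}" for i s
    using unif_moments_measurable[OF X, of "(i, s)"] that by auto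
  show "(\<lambda>\<omega>. path_mean (a i) (b i) (\<lambda>s. X i s \<omega>)) \<in> borel_measurable M" if "i \<in> I" for i
    using path_mean_measurable[OF ab[OF that], of "\<lambda>\<omega> s. X i s \<omega>"] m[OF that] by auto
  fix n
  obtain C where "\<And>j. j \<in> {(i, s). i \<in> I \<and> s \<in> {a i..b i}} \<Longrightarrow>
      (\<integral>\<^sup>+\<omega>. ennreal (\<bar>(\<lambda>(i, s). X i s) j \<omega>\<bar> ^ (2 * n)) \<partial>M) \<le> ennreal C"
    using unif_momentsE[OF X] by blast
  then have C: "(\<integral>\<^sup>+\<omega>. ennreal (X i s \<omega> ^ (2 * n)) \<partial>M) \<le> ennreal C" if "i \<in> I" "s \<in> {a i..b i}" for i s
    using that by (force simp: power_mult)
  have "(\<integral>\<^sup>+\<omega>. ennreal (path_mean (a i) (b i) (\<lambda>s. X i s \<omega>) ^ (2 * n)) \<partial>M) \<le> ennreal C" if i: "i \<in> I" for i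
    using C[OF i] m[OF i] AE[OF i] ab[OF i]
    by (intro nn_integral_path_mean_convex[where C=UNIV and \<phi>="\<lambda>x. x ^ (2 * n)"])
      (auto intro: convex_power_even continuous_intros)
  then show "\<exists>C. \<forall>i\<in>I. (\<integral>\<^sup>+\<omega>. ennreal (path_mean (a i) (b i) (\<lambda>s. X i s \<omega>) ^ (2 * n)) \<partial>M) \<le> ennreal C"
    by blast
qed

subsection \<open>Scaled moments and limits of expectations\<close>

text \<open>Scaling replaces interpolation between moments: once a variable is measured in units of its
  natural size, a real moment is bounded by \<open>1\<close> plus a larger integer moment.\<close>

lemma (in prob_space) nn_integral_powr_le_power:
  assumes A: "A \<in> borel_measurable M" "\<And>\<omega>. 0 \<le> A \<omega>" and \<sigma>: "\<sigma> > 0" and r: "0 \<le> r" "r \<le> real q"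
    and E: "(\<integral>\<^sup>+\<omega>. ennreal ((A \<omega> / \<sigma>) ^ q) \<partial>M) \<le> ennreal K" and K: "0 \<le> K"
  shows "(\<integral>\<^sup>+\<omega>. ennreal (A \<omega> powr r) \<partial>M) \<le> ennreal ((1 + K) * \<sigma> powr r)"
proof -
  note [measurable] = A(1)
  have pt: "A \<omega> powr r \<le> \<sigma> powr r * (1 + (A \<omega> / \<sigma>) ^ q)" for \<omega>
  proof -
    define y where "y = A \<omega> / \<sigma>"
    have y0: "y \<ge> 0" using \<sigma> A(2) by (simp add: y_def)
    have "y powr r \<le> 1 + y ^ q"
    proof (cases "y \<le> 1")
      case True
      then have "y powr r \<le> 1" using y0 r by (simp add: powr_le1)
      then show ?thesis using y0 by (simp add: add_increasing2)
    next
      case False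
      then have "y powr r \<le> y powr (real q)" using r by (intro powr_mono) auto
      also have "\<dots> = y ^ q" using False by (simp add: powr_realpow)
      finally show ?thesis by simp
    qed
    moreover have "A \<omega> powr r = \<sigma> powr r * y powr r"
    proof -
      have "A \<omega> = \<sigma> * y" using \<sigma> by (simp add: y_def)
      then show ?thesis using y0 \<sigma> by (simp add: powr_mult)
    qed
    ultimately show ?thesis unfolding y_def by (simp add: mult_left_mono)
  qed
  have "(\<integral>\<^sup>+\<omega>. ennreal (A \<omega> powr r) \<partial>M) \<le> (\<integral>\<^sup>+\<omega>. ennreal (\<sigma> powr r) * (1 + ennreal ((A \<omega> / \<sigma>) ^ q)) \<partial>M)"
  proof (rule nn_integral_mono)
    fix \<omega>
    have "ennreal (A \<omega> powr r) \<le> ennreal (\<sigma> powr r * (1 + (A \<omega> / \<sigma>) ^ q))" using pt by (rule ennreal_leI)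
    also have "\<dots> = ennreal (\<sigma> powr r) * (1 + ennreal ((A \<omega> / \<sigma>) ^ q))"
      using \<sigma> A(2) by (simp add: ennreal_mult')
    finally show "ennreal (A \<omega> powr r) \<le> \<dots>" .
  qed
  also have "\<dots> = ennreal (\<sigma> powr r) * (1 + (\<integral>\<^sup>+\<omega>. ennreal ((A \<omega> / \<sigma>) ^ q) \<partial>M))"
    by (simp add: nn_integral_cmult nn_integral_add emeasure_space_1)
  also have "\<dots> \<le> ennreal (\<sigma> powr r) * (1 + ennreal K)"
    using E by (intro mult_left_mono add_left_mono) auto
  also have "\<dots> = ennreal ((1 + K) * \<sigma> powr r)"
    using K by (simp add: ennreal_mult' mult.commute)
  finally show ?thesis .
qed

text \<open>Almost sure convergence with bounded second moments is enough to pass to the limit in the mean: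
  at level \<open>L\<close>, \<open>\<bar>d\<bar> \<le> min \<bar>d\<bar> L + d\<^sup>2 / L\<close>, where the first term converges boundedly and the
  second is of order \<open>1 / L\<close> uniformly in \<open>n\<close>.\<close>

lemma (in prob_space) expectation_limit_zero:
  fixes X :: "'a \<Rightarrow> real" and Xn :: "nat \<Rightarrow> 'a \<Rightarrow> real"
  assumes lim: "AE \<omega> in M. (\<lambda>n. Xn n \<omega>) \<longlonglongrightarrow> X \<omega>"
    and X: "X \<in> borel_measurable M" "integrable M (\<lambda>\<omega>. X \<omega> ^ 2)"
    and Xn: "\<And>n. Xn n \<in> borel_measurable M" "\<And>n. integrable M (\<lambda>\<omega>. Xn n \<omega> ^ 2)"
    and K: "\<And>n. expectation (\<lambda>\<omega>. Xn n \<omega> ^ 2) \<le> K"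
    and zero: "\<And>n. expectation (Xn n) = 0"
  shows "expectation X = 0"
proof -
  have iX: "integrable M X" using square_integrable_imp_integrable[OF X] .
  have iXn: "integrable M (Xn n)" for n using square_integrable_imp_integrable[OF Xn(1) Xn(2)] .
  define D where "D = 2 * (expectation (\<lambda>\<omega>. X \<omega> ^ 2) + K)"
  have bound: "\<bar>expectation X\<bar> \<le> D / L" if L: "L > 0" for L :: real
  proof -
    define t where "t n \<omega> = min \<bar>X \<omega> - Xn n \<omega>\<bar> L" for n \<omega>
    have [measurable]: "t n \<in> borel_measurable M" for n unfolding t_def using X Xn by measurable
    have it: "integrable M (t n)" for n
      by (rule integrable_const_bound[of _ L]) (use L in \<open>auto simp: t_def\<close>)
    have "(\<lambda>n. expectation (t n)) \<longlonglongrightarrow> expectation (\<lambda>\<omega>. 0 :: real)"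
    proof (rule integral_dominated_convergence[where w="\<lambda>_. L"])
      show "AE \<omega> in M. (\<lambda>n. t n \<omega>) \<longlonglongrightarrow> 0"
        using lim
      proof eventually_elim
        case (elim \<omega>)
        have "(\<lambda>n. \<bar>X \<omega> - Xn n \<omega>\<bar>) \<longlonglongrightarrow> \<bar>X \<omega> - X \<omega>\<bar>"
          by (intro tendsto_intros elim)
        then have "(\<lambda>n. min \<bar>X \<omega> - Xn n \<omega>\<bar> L) \<longlonglongrightarrow> min \<bar>X \<omega> - X \<omega>\<bar> L"
          by (intro tendsto_min tendsto_const)
        then show ?case using L by (simp add: t_def min_def)
      qed
    qed (use L in \<open>auto simp: t_def\<close>)
    then have "(\<lambda>n. expectation (t n) + D / L) \<longlonglongrightarrow> 0 + D / L"
      by (intro tendsto_add tendsto_const) simp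
    moreover have "\<bar>expectation X\<bar> \<le> expectation (t n) + D / L" for n
    proof -
      have i2: "integrable M (\<lambda>\<omega>. 2 * (X \<omega> ^ 2 + Xn n \<omega> ^ 2) / L)"
        using X(2) Xn(2)[of n] by (intro Bochner_Integration.integrable_divide Bochner_Integration.integrable_mult_right Bochner_Integration.integrable_add)
      have pt: "\<bar>X \<omega> - Xn n \<omega>\<bar> \<le> t n \<omega> + 2 * (X \<omega> ^ 2 + Xn n \<omega> ^ 2) / L" for \<omega>
      proof (cases "\<bar>X \<omega> - Xn n \<omega>\<bar> \<le> L")
        case True
        then show ?thesis using L by (simp add: t_def)
      next
        case False
        then have "L * \<bar>X \<omega> - Xn n \<omega>\<bar> \<le> \<bar>X \<omega> - Xn n \<omega>\<bar> * \<bar>X \<omega> - Xn n \<omega>\<bar>"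
          using L by (intro mult_right_mono) auto
        also have "\<dots> = (X \<omega> - Xn n \<omega>)\<^sup>2" by (simp add: power2_eq_square)
        also have "\<dots> \<le> 2 * (X \<omega> ^ 2 + Xn n \<omega> ^ 2)"
          using zero_le_power2[of "X \<omega> + Xn n \<omega>"] by (simp add: power2_diff power2_sum)
        finally have "\<bar>X \<omega> - Xn n \<omega>\<bar> \<le> 2 * (X \<omega> ^ 2 + Xn n \<omega> ^ 2) / L"
          using L by (simp add: field_simps)
        then show ?thesis using L by (simp add: t_def min_def)
      qed
      have "\<bar>expectation X\<bar> = \<bar>expectation (\<lambda>\<omega>. X \<omega> - Xn n \<omega>)\<bar>"
        using iX iXn zero by simp
      also have "\<dots> \<le> expectation (\<lambda>\<omega>. \<bar>X \<omega> - Xn n \<omega>\<bar>)" by (rule integral_abs_bound)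
      also have "\<dots> \<le> expectation (\<lambda>\<omega>. t n \<omega> + 2 * (X \<omega> ^ 2 + Xn n \<omega> ^ 2) / L)"
        using iX iXn it i2 pt by (intro integral_mono Bochner_Integration.integrable_add Bochner_Integration.integrable_abs Bochner_Integration.integrable_diff)
      also have "\<dots> = expectation (t n) + 2 * (expectation (\<lambda>\<omega>. X \<omega> ^ 2) + expectation (\<lambda>\<omega>. Xn n \<omega> ^ 2)) / L"
        using it i2 X(2) Xn(2)[of n] by simp
      also have "\<dots> \<le> expectation (t n) + D / L"
        unfolding D_def using K[of n] L by (intro add_left_mono divide_right_mono) auto
      finally show ?thesis .
    qed
    ultimately have "\<bar>expectation X\<bar> \<le> 0 + D / L"
      by (intro LIMSEQ_le_const) auto
    then show ?thesis by simp
  qed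
  have "((\<lambda>L. D / L) \<longlongrightarrow> 0) at_top" by real_asymp
  moreover have "\<forall>\<^sub>F L in at_top. \<bar>expectation X\<bar> \<le> D / L"
    using eventually_gt_at_top[of "0::real"] by eventually_elim (rule bound)
  ultimately have "\<bar>expectation X\<bar> \<le> 0"
    by (intro tendsto_lowerbound) auto
  then show ?thesis by simp
qed

section \<open>A maximal inequality for martingales\<close>

definition running_max :: "(nat \<Rightarrow> real) \<Rightarrow> nat \<Rightarrow> real" where
  "running_max S n = (MAX j\<in>{..n}. \<bar>S j\<bar>)"

lemma running_max_0: "running_max S 0 = \<bar>S 0\<bar>"
  by (simp add: running_max_def)

lemma running_max_Suc: "running_max S (Suc n) = max (running_max S n) \<bar>S (Suc n)\<bar>"
  by (simp add: running_max_def atMost_Suc max.commute)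

lemma running_max_ge: "j \<le> n \<Longrightarrow> \<bar>S j\<bar> \<le> running_max S n"
  unfolding running_max_def by (intro Max_ge) auto

lemma running_max_scale:
  assumes "0 \<le> c"
  shows "running_max (\<lambda>k. c * S k) n = c * running_max S n"
  by (induction n) (use assms in \<open>auto simp: running_max_0 running_max_Suc abs_mult max_mult_distrib_left\<close>)

lemma running_max_nonneg: "0 \<le> running_max S n"
  using running_max_ge[of 0 n S] abs_ge_zero[of "S 0"] by linarith

lemma running_max_le:
  assumes "\<And>k. k \<le> n \<Longrightarrow> \<bar>S k\<bar> \<le> R"
  shows "running_max S n \<le> R"
  unfolding running_max_def using assms by (subst Max_le_iff) auto

lemma running_max_measurable:
  assumes "\<And>k. k \<le> n \<Longrightarrow> (\<lambda>\<omega>. S \<omega> k) \<in> borel_measurable M"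
  shows "(\<lambda>\<omega>. running_max (S \<omega>) n) \<in> borel_measurable M"
  unfolding running_max_def using assms by (intro borel_measurable_Max borel_measurable_abs) auto

text \<open>A deterministic form of Doob's maximal inequality. By Abel summation the right-hand side grows by
  at least \<open>(b ^ r - a ^ r) * \<bar>S (Suc n)\<bar>\<close> in each step, where \<open>a \<le> b\<close> are consecutive maxima; whenever
  the maximum moves, \<open>\<bar>S (Suc n)\<bar>\<close> equals \<open>b\<close>, and the left-hand side grows by no more. For a
  martingale the sum has expectation zero, which turns this into a moment bound.\<close>

lemma pathwise_doob:
  assumes "S 0 = 0" "r \<ge> 1"
  shows "running_max S n ^ Suc r / 2
    \<le> running_max S n ^ r * \<bar>S n\<bar> - (\<Sum>k<n. running_max S k ^ r * sgn (S k) * (S (Suc k) - S k))"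
proof (induction n)
  case 0
  then show ?case using assms by (simp add: running_max_0)
next
  case (Suc n)
  define a b where "a = running_max S n" and "b = running_max S (Suc n)"
  have a0: "0 \<le> a" by (simp add: a_def running_max_nonneg)
  have sg: "sgn (S n) * (S (Suc n) - S n) \<le> \<bar>S (Suc n)\<bar> - \<bar>S n\<bar>"
    by (auto simp: sgn_if)
  have *: "b ^ Suc r / 2 - a ^ Suc r / 2 \<le> (b ^ r - a ^ r) * \<bar>S (Suc n)\<bar>"
  proof (cases "b = a")
    case False
    then have b: "b = \<bar>S (Suc n)\<bar>" and ab: "a \<le> b"
      unfolding a_def b_def running_max_Suc by (auto simp: max_def split: if_splits)
    obtain r' where r': "r = Suc r'" using assms(2) by (cases r) auto
    have "2 * (a * b) \<le> a\<^sup>2 + b\<^sup>2" using zero_le_power2[of "a - b"] by (simp add: power2_diff)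
    then have "a ^ r' * (2 * (a * b)) \<le> a ^ r' * (a\<^sup>2 + b\<^sup>2)"
      using a0 by (intro mult_left_mono) auto
    also have "\<dots> \<le> a ^ r' * a\<^sup>2 + b ^ r' * b\<^sup>2"
      using a0 ab by (auto simp: distrib_left intro!: mult_right_mono power_mono)
    finally have "2 * (a ^ r * b) \<le> a ^ Suc r + b ^ Suc r"
      unfolding r' by (simp add: power2_eq_square algebra_simps)
    then show ?thesis unfolding b[symmetric] by (simp add: algebra_simps)
  qed simp
  have "a ^ r * (sgn (S n) * (S (Suc n) - S n)) \<le> a ^ r * (\<bar>S (Suc n)\<bar> - \<bar>S n\<bar>)"
    using sg a0 by (intro mult_left_mono) auto
  then have "a ^ r * sgn (S n) * (S (Suc n) - S n) \<le> a ^ r * \<bar>S (Suc n)\<bar> - a ^ r * \<bar>S n\<bar>"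
    by (simp add: algebra_simps)
  moreover have "(\<Sum>k<Suc n. running_max S k ^ r * sgn (S k) * (S (Suc k) - S k))
    = (\<Sum>k<n. running_max S k ^ r * sgn (S k) * (S (Suc k) - S k)) + a ^ r * sgn (S n) * (S (Suc n) - S n)"
    by (simp add: a_def)
  moreover have "(b ^ r - a ^ r) * \<bar>S (Suc n)\<bar> = b ^ r * \<bar>S (Suc n)\<bar> - a ^ r * \<bar>S (Suc n)\<bar>"
    by (rule left_diff_distrib)
  ultimately show ?case
    using * Suc unfolding a_def[symmetric] b_def[symmetric] by linarith
qed

lemma mixed_power_le:
  fixes s x :: real
  assumes "2 \<le> k" "k \<le> q"
  shows "\<bar>x\<bar> ^ k * \<bar>s\<bar> ^ (q - k) \<le> \<bar>s\<bar> ^ (q - 2) * x\<^sup>2 + \<bar>x\<bar> ^ q"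
proof (cases "\<bar>x\<bar> \<le> \<bar>s\<bar>")
  case True
  have "\<bar>x\<bar> ^ k * \<bar>s\<bar> ^ (q - k) = \<bar>x\<bar> ^ 2 * (\<bar>x\<bar> ^ (k - 2) * \<bar>s\<bar> ^ (q - k))"
    using power_add[of "\<bar>x\<bar>" 2 "k - 2"] assms by (simp only: le_add_diff_inverse mult.assoc)
  also have "\<dots> \<le> \<bar>x\<bar> ^ 2 * (\<bar>s\<bar> ^ (k - 2) * \<bar>s\<bar> ^ (q - k))"
    using True by (intro mult_left_mono mult_right_mono power_mono) auto
  also have "\<bar>s\<bar> ^ (k - 2) * \<bar>s\<bar> ^ (q - k) = \<bar>s\<bar> ^ (q - 2)"
    using assms by (simp add: power_add[symmetric])
  finally show ?thesis by (simp add: mult.commute add_increasing2)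
next
  case False
  have "\<bar>x\<bar> ^ k * \<bar>s\<bar> ^ (q - k) \<le> \<bar>x\<bar> ^ k * \<bar>x\<bar> ^ (q - k)"
    using False by (intro mult_left_mono power_mono) auto
  also have "\<dots> = \<bar>x\<bar> ^ q" using assms by (simp add: power_add[symmetric])
  finally show ?thesis by (simp add: add_increasing)
qed

text \<open>The term linear in \<open>x\<close> is kept exactly because it is orthogonal for a martingale increment; each
  of the higher binomial terms lies between the quadratic and the pure power of \<open>x\<close>.\<close>

lemma power_add_expansion_le:
  fixes s x :: real
  assumes q: "even q" "q \<ge> 2"
  shows "(s + x) ^ q \<le> s ^ q + real q * s ^ (q - 1) * x + 2 ^ q * (s ^ (q - 2) * x\<^sup>2 + x ^ q)"
proof -
  define t where "t k = real (q choose k) * x ^ k * s ^ (q - k)" for k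
  have abs: "\<bar>s\<bar> ^ (q - 2) = s ^ (q - 2)" "\<bar>x\<bar> ^ q = x ^ q" using q by (auto simp: power_even_abs)
  define D where "D = s ^ (q - 2) * x\<^sup>2 + x ^ q"
  have D: "0 \<le> D" unfolding D_def abs[symmetric] by simp
  have "(s + x) ^ q = (\<Sum>k\<le>q. t k)"
    by (simp add: t_def binomial_ring add.commute[of s x])
  also have "{..q} = insert 0 (insert 1 {2..q})" using q by auto
  also have "sum t \<dots> = t 0 + t 1 + (\<Sum>k\<in>{2..q}. t k)" by simp
  also have "(\<Sum>k\<in>{2..q}. t k) \<le> (\<Sum>k\<in>{2..q}. real (q choose k) * D)"
  proof (rule sum_mono)
    fix k assume k: "k \<in> {2..q}"
    have "t k \<le> \<bar>t k\<bar>" by simp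
    also have "\<dots> = real (q choose k) * (\<bar>x\<bar> ^ k * \<bar>s\<bar> ^ (q - k))"
      by (simp add: t_def abs_mult power_abs)
    also have "\<dots> \<le> real (q choose k) * D"
      using mixed_power_le[of k q x s] k unfolding abs D_def by (intro mult_left_mono) auto
    finally show "t k \<le> real (q choose k) * D" .
  qed
  also have "\<dots> \<le> (\<Sum>k\<le>q. real (q choose k) * D)"
    using D by (intro sum_mono2) auto
  also have "\<dots> = 2 ^ q * D"
    using choose_row_sum[of q] by (simp add: sum_distrib_right[symmetric] flip: of_nat_sum)
  finally show ?thesis by (simp add: t_def D_def algebra_simps)
qed

text \<open>A substitute for the Burkholder-Davis-Gundy inequality. The weights \<open>b\<close> distribute the total
  variance, normalised to at most one, over the increments \<open>x = sqrt b * z\<close>. Orthogonality removes the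
  linear term from \<open>E (S + x) ^ q\<close>, and the rest is at most \<open>b (E S ^ q + E z ^ q)\<close> up to a constant,
  so a discrete Gronwall argument bounds \<open>E S ^ q\<close> independently of the number of steps. The pathwise
  inequality above then transfers the bound to the running maximum. The martingale property
  enters as orthogonality to the variables that are measurable with respect to the past.\<close>

lemma (in prob_space) martingale_max_moment:
  fixes x z :: "nat \<Rightarrow> 'a \<Rightarrow> real" and b :: "nat \<Rightarrow> real" and F :: "nat \<Rightarrow> 'a measure"
  assumes F: "\<And>k. k \<le> n \<Longrightarrow> subalgebra M (F k)" "\<And>k. k < n \<Longrightarrow> subalgebra (F (Suc k)) (F k)"
    and xF: "\<And>k. k < n \<Longrightarrow> x k \<in> borel_measurable (F (Suc k))"
    and xm: "\<And>k. k < n \<Longrightarrow> all_moments M (x k)" and zm: "\<And>k. k < n \<Longrightarrow> all_moments M (z k)"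
    and orth: "\<And>k \<zeta>. k < n \<Longrightarrow> \<zeta> \<in> borel_measurable (F k) \<Longrightarrow> all_moments M \<zeta> \<Longrightarrow>
        (LINT \<omega>|M. \<zeta> \<omega> * x k \<omega>) = 0"
    and q: "even q" "q \<ge> 2"
    and b: "\<And>k. k < n \<Longrightarrow> 0 \<le> b k" "(\<Sum>k<n. b k) \<le> 1"
    and xz: "\<And>k \<omega>. k < n \<Longrightarrow> x k \<omega> = sqrt (b k) * z k \<omega>"
    and K: "\<And>k. k < n \<Longrightarrow> (LINT \<omega>|M. z k \<omega> ^ q) \<le> K" "0 \<le> K"
  shows "(\<integral>\<^sup>+\<omega>. ennreal (running_max (\<lambda>k. \<Sum>l<k. x l \<omega>) n ^ q) \<partial>M) \<le> ennreal (4 ^ q * (2 * K * exp (2 ^ q)))"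
proof -
  define S where "S k \<omega> = (\<Sum>l<k. x l \<omega>)" for k \<omega>
  define A where "A k \<omega> = running_max (\<lambda>k. S k \<omega>) k" for k \<omega>
  have S0: "S 0 \<omega> = 0" and SSuc: "S (Suc k) \<omega> = S k \<omega> + x k \<omega>" for k \<omega> by (simp_all add: S_def)
  have SF: "S k \<in> borel_measurable (F k)" if "k \<le> n" for k
    using that
  proof (induction k)
    case 0
    have "S 0 = (\<lambda>_. 0)" by (simp add: S_def fun_eq_iff)
    then show ?case by simp
  next
    case (Suc k)
    then have [measurable]: "S k \<in> borel_measurable (F (Suc k))"
      using measurable_from_subalg[OF F(2)[of k]] by auto
    have [measurable]: "x k \<in> borel_measurable (F (Suc k))" using xF Suc by auto
    show ?case using SSuc[of k] by (subst measurable_cong[where g="\<lambda>\<omega>. S k \<omega> + x k \<omega>"]) auto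
  qed
  have AF: "A k \<in> borel_measurable (F k)" if "k \<le> n" for k
    using that
  proof (induction k)
    case 0
    have "A 0 = (\<lambda>_. 0)" by (simp add: A_def running_max_0 S0 fun_eq_iff)
    then show ?case by simp
  next
    case (Suc k)
    then have [measurable]: "A k \<in> borel_measurable (F (Suc k))"
      using measurable_from_subalg[OF F(2)[of k]] by auto
    have [measurable]: "S (Suc k) \<in> borel_measurable (F (Suc k))" using SF Suc by auto
    have "A (Suc k) \<omega> = max (A k \<omega>) \<bar>S (Suc k) \<omega>\<bar>" for \<omega> by (simp add: A_def running_max_Suc)
    then show ?case by (subst measurable_cong[where g="\<lambda>\<omega>. max (A k \<omega>) \<bar>S (Suc k) \<omega>\<bar>"]) auto
  qed
  have SM: "all_moments M (S k)" if "k \<le> n" for k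
    unfolding S_def using that xm by (intro all_moments_sum) auto
  have AM: "all_moments M (A k)" if "k \<le> n" for k
  proof (rule unif_moments_dominated)
    show "all_moments M (\<lambda>\<omega>. \<Sum>j<Suc k. \<bar>S j \<omega>\<bar>)"
      using that by (intro all_moments_sum unif_moments_abs SM) auto
    show "A k \<in> borel_measurable M" using measurable_from_subalg[OF F(1)[OF that] AF[OF that]] .
    have "\<bar>A k \<omega>\<bar> \<le> \<bar>\<Sum>j<Suc k. \<bar>S j \<omega>\<bar>\<bar>" for \<omega>
    proof -
      have "A k \<omega> \<in> (\<lambda>j. \<bar>S j \<omega>\<bar>) ` {..k}" unfolding A_def running_max_def by (intro Max_in) auto
      then obtain j where j: "j < Suc k" "A k \<omega> = \<bar>S j \<omega>\<bar>" by (auto simp: less_Suc_eq_le)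
      have "\<bar>S j \<omega>\<bar> \<le> (\<Sum>j<Suc k. \<bar>S j \<omega>\<bar>)"
        using j(1) by (intro member_le_sum[where f="\<lambda>j. \<bar>S j \<omega>\<bar>"]) auto
      then show ?thesis using j(2) by simp
    qed
    then show "AE \<omega> in M. \<bar>A k \<omega>\<bar> \<le> \<bar>\<Sum>j<Suc k. \<bar>S j \<omega>\<bar>\<bar>" by simp
  qed
  note int = unif_moments_integrable[where I="UNIV :: unit set", OF _ UNIV_I]
    and intp = unif_moments_integrable_power[where I="UNIV :: unit set", OF _ UNIV_I]
  note mul = unif_moments_mult[where I="UNIV :: unit set"] and pow = unif_moments_power[where I="UNIV :: unit set"]

  define c :: real where "c = 2 ^ q"
  have c0: "c > 0" by (simp add: c_def)
  have growth: "(LINT \<omega>|M. S (Suc k) \<omega> ^ q) \<le> (1 + c * b k) * (LINT \<omega>|M. S k \<omega> ^ q) + 2 * c * K * b k" if k: "k < n" for k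
  proof -
    have b1: "b k \<le> 1"
    proof -
      have "b k \<le> (\<Sum>k<n. b k)" using k b(1) by (intro member_le_sum) auto
      then show ?thesis using b(2) by simp
    qed
    have pt: "S (Suc k) \<omega> ^ q \<le> (1 + c * b k) * S k \<omega> ^ q + real q * S k \<omega> ^ (q - 1) * x k \<omega> + 2 * c * b k * z k \<omega> ^ q" for \<omega>
    proof -
      have x2: "(x k \<omega>)\<^sup>2 = b k * (z k \<omega>)\<^sup>2" using b(1)[OF k] by (simp add: xz[OF k] power_mult_distrib)
      obtain m where m: "q = 2 * m" using q(1) by (auto elim: evenE)
      have "x k \<omega> ^ q = b k ^ m * z k \<omega> ^ q" unfolding m power_mult x2 power_mult_distrib by simp
      also have "\<dots> \<le> b k * z k \<omega> ^ q"
        using b1 b(1)[OF k] q m power_decreasing[of 1 m "b k"] by (intro mult_right_mono) auto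
      finally have xq: "x k \<omega> ^ q \<le> b k * z k \<omega> ^ q" .
      have nn: "0 \<le> S k \<omega> ^ q" "0 \<le> z k \<omega> ^ q" using q by (auto intro: zero_le_even_power)
      have "S k \<omega> ^ (q - 2) * (z k \<omega>)\<^sup>2 \<le> S k \<omega> ^ q + z k \<omega> ^ q"
      proof (cases "\<bar>z k \<omega>\<bar> \<le> \<bar>S k \<omega>\<bar>")
        case True
        then have "(z k \<omega>)\<^sup>2 \<le> (S k \<omega>)\<^sup>2" using abs_le_square_iff by blast
        then have "S k \<omega> ^ (q - 2) * (z k \<omega>)\<^sup>2 \<le> S k \<omega> ^ (q - 2) * (S k \<omega>)\<^sup>2"
          using q by (intro mult_left_mono zero_le_even_power) auto
        also have "\<dots> = S k \<omega> ^ q"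
          using power_add[of "S k \<omega>" "q - 2" 2] q by (simp only: le_add_diff_inverse2)
        finally show ?thesis using nn by linarith
      next
        case False
        then have "\<bar>S k \<omega>\<bar> ^ (q - 2) \<le> \<bar>z k \<omega>\<bar> ^ (q - 2)" by (intro power_mono) auto
        then have "S k \<omega> ^ (q - 2) \<le> z k \<omega> ^ (q - 2)" using q by (simp add: power_even_abs)
        then have "S k \<omega> ^ (q - 2) * (z k \<omega>)\<^sup>2 \<le> z k \<omega> ^ (q - 2) * (z k \<omega>)\<^sup>2"
          by (intro mult_right_mono) auto
        also have "\<dots> = z k \<omega> ^ q"
          using power_add[of "z k \<omega>" "q - 2" 2] q by (simp only: le_add_diff_inverse2)
        finally show ?thesis using nn by linarith
      qed
      then have "S k \<omega> ^ (q - 2) * (x k \<omega>)\<^sup>2 \<le> b k * (S k \<omega> ^ q + z k \<omega> ^ q)"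
        unfolding x2 using b(1)[OF k] by (simp add: mult.left_commute mult_left_mono)
      then have "c * (S k \<omega> ^ (q - 2) * (x k \<omega>)\<^sup>2 + x k \<omega> ^ q) \<le> c * (b k * (S k \<omega> ^ q + z k \<omega> ^ q) + b k * z k \<omega> ^ q)"
        using xq c0 by (intro mult_left_mono add_mono) auto
      with power_add_expansion_le[OF q, of "S k \<omega>" "x k \<omega>"] show ?thesis
        unfolding SSuc c_def[symmetric] by (simp add: algebra_simps)
    qed
    have i1: "integrable M (\<lambda>\<omega>. S k \<omega> ^ q)" and i2: "integrable M (\<lambda>\<omega>. z k \<omega> ^ q)"
      using k intp[OF SM[of k]] intp[OF zm] by auto
    have i3: "integrable M (\<lambda>\<omega>. real q * S k \<omega> ^ (q - 1) * x k \<omega>)"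
      using k int[OF mul[OF pow[OF SM[of k], of "q - 1"] xm[OF k]]] by (auto simp: mult.assoc)
    have 0: "(LINT \<omega>|M. real q * S k \<omega> ^ (q - 1) * x k \<omega>) = 0"
    proof -
      have [measurable]: "S k \<in> borel_measurable (F k)" using SF k by auto
      have "(LINT \<omega>|M. S k \<omega> ^ (q - 1) * x k \<omega>) = 0"
        using k by (intro orth pow SM) auto
      then show ?thesis by (simp add: mult.assoc)
    qed
    have "(LINT \<omega>|M. S (Suc k) \<omega> ^ q) \<le> (LINT \<omega>|M. (1 + c * b k) * S k \<omega> ^ q + real q * S k \<omega> ^ (q - 1) * x k \<omega> + 2 * c * b k * z k \<omega> ^ q)"
      using k pt i1 i2 i3 intp[OF SM[of "Suc k"]] by (intro integral_mono) auto
    also have "\<dots> = (1 + c * b k) * (LINT \<omega>|M. S k \<omega> ^ q) + 2 * c * b k * (LINT \<omega>|M. z k \<omega> ^ q)"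
      using i1 i2 i3 0 by simp
    also have "\<dots> \<le> (1 + c * b k) * (LINT \<omega>|M. S k \<omega> ^ q) + 2 * c * b k * K"
      using K(1)[OF k] b(1)[OF k] c0 by (intro add_left_mono mult_left_mono) auto
    finally show ?thesis by (simp add: mult_ac)
  qed
  have gronwall: "(LINT \<omega>|M. S k \<omega> ^ q) \<le> 2 * K * (exp (c * (\<Sum>l<k. b l)) - 1)" if "k \<le> n" for k
    using that
  proof (induction k)
    case 0
    then show ?case using q by (simp add: S0 zero_power)
  next
    case (Suc k)
    define E where "E = exp (c * (\<Sum>l<k. b l))"
    have k: "k < n" using Suc by simp
    have cb: "0 \<le> c * b k" using b(1)[OF k] c0 by simp
    have "(LINT \<omega>|M. S (Suc k) \<omega> ^ q) \<le> (1 + c * b k) * (LINT \<omega>|M. S k \<omega> ^ q) + 2 * c * K * b k"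
      by (rule growth[OF k])
    also have "\<dots> \<le> (1 + c * b k) * (2 * K * (E - 1)) + 2 * c * K * b k"
      using Suc cb by (intro add_right_mono mult_left_mono) (auto simp: E_def)
    also have "\<dots> = 2 * K * ((1 + c * b k) * E - 1)" by (simp add: algebra_simps)
    also have "\<dots> \<le> 2 * K * (exp (c * b k) * E - 1)"
      using K(2) exp_ge_add_one_self[of "c * b k"]
      by (intro mult_left_mono diff_right_mono mult_right_mono) (auto simp: E_def)
    also have "exp (c * b k) * E = exp (c * (\<Sum>l<Suc k. b l))"
      by (simp add: E_def distrib_left exp_add mult.commute)
    finally show ?case .
  qed
  have Sn: "(LINT \<omega>|M. S n \<omega> ^ q) \<le> 2 * K * exp c"
  proof -
    have "exp (c * (\<Sum>l<n. b l)) \<le> exp c" using b(2) c0 by simp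
    then have "2 * K * (exp (c * (\<Sum>l<n. b l)) - 1) \<le> 2 * K * exp c"
      using K(2) by (intro mult_left_mono) (linarith, simp)
    then show ?thesis using gronwall[of n] by simp
  qed

  obtain r where r: "q = Suc r" "r \<ge> 1" using q by (cases q) auto
  have doob: "A n \<omega> ^ q / 2 \<le> A n \<omega> ^ q / 4 + 4 ^ r * S n \<omega> ^ q - (\<Sum>k<n. A k \<omega> ^ r * sgn (S k \<omega>) * x k \<omega>)" for \<omega>
  proof -
    have "A n \<omega> ^ q / 2 \<le> A n \<omega> ^ r * \<bar>S n \<omega>\<bar> - (\<Sum>k<n. A k \<omega> ^ r * sgn (S k \<omega>) * (S (Suc k) \<omega> - S k \<omega>))"
      using pathwise_doob[of "\<lambda>k. S k \<omega>" r n] S0 r unfolding A_def by auto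
    also have "(\<Sum>k<n. A k \<omega> ^ r * sgn (S k \<omega>) * (S (Suc k) \<omega> - S k \<omega>)) = (\<Sum>k<n. A k \<omega> ^ r * sgn (S k \<omega>) * x k \<omega>)"
      by (simp add: SSuc)
    also have "A n \<omega> ^ r * \<bar>S n \<omega>\<bar> \<le> A n \<omega> ^ q / 4 + 4 ^ r * S n \<omega> ^ q"
    proof (cases "\<bar>S n \<omega>\<bar> \<le> A n \<omega> / 4")
      case True
      have "A n \<omega> ^ r * \<bar>S n \<omega>\<bar> \<le> A n \<omega> ^ r * (A n \<omega> / 4)"
        using True by (intro mult_left_mono) (auto simp: A_def running_max_nonneg)
      moreover have "0 \<le> 4 ^ r * S n \<omega> ^ q" using q by (auto intro: zero_le_even_power)
      moreover have "A n \<omega> ^ r * (A n \<omega> / 4) = A n \<omega> ^ q / 4" unfolding r(1) by simp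
      ultimately show ?thesis by linarith
    next
      case False
      have "A n \<omega> ^ r * \<bar>S n \<omega>\<bar> \<le> (4 * \<bar>S n \<omega>\<bar>) ^ r * \<bar>S n \<omega>\<bar>"
        using False by (intro mult_right_mono power_mono) (auto simp: A_def running_max_nonneg)
      also have "\<dots> = 4 ^ r * \<bar>S n \<omega>\<bar> ^ q" unfolding r(1) by (simp add: power_mult_distrib)
      also have "\<dots> = 4 ^ r * S n \<omega> ^ q" using q by (simp add: power_even_abs)
      finally have "A n \<omega> ^ r * \<bar>S n \<omega>\<bar> \<le> 4 ^ r * S n \<omega> ^ q" .
      moreover have "0 \<le> A n \<omega> ^ q" using q by (auto intro: zero_le_even_power)
      ultimately show ?thesis by linarith
    qed
    finally show ?thesis by simp
  qed
  have iA: "integrable M (\<lambda>\<omega>. A n \<omega> ^ q)" using intp[OF AM] by simp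
  have iS: "integrable M (\<lambda>\<omega>. S n \<omega> ^ q)" using intp[OF SM] by simp
  \<comment> \<open>The sign factor turns increments of \<open>S\<close> into lower bounds for increments of \<open>\<bar>S\<bar>\<close>.\<close>
  have sgm: "all_moments M (\<lambda>\<omega>. A k \<omega> ^ r * sgn (S k \<omega>))" and sgF: "(\<lambda>\<omega>. A k \<omega> ^ r * sgn (S k \<omega>)) \<in> borel_measurable (F k)" if k: "k < n" for k
  proof -
    have [measurable]: "S k \<in> borel_measurable (F k)" "A k \<in> borel_measurable (F k)" using SF AF k by auto
    show *: "(\<lambda>\<omega>. A k \<omega> ^ r * sgn (S k \<omega>)) \<in> borel_measurable (F k)" by measurable
    show "all_moments M (\<lambda>\<omega>. A k \<omega> ^ r * sgn (S k \<omega>))"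
    proof (rule unif_moments_dominated)
      show "all_moments M (\<lambda>\<omega>. A k \<omega> ^ r)" using k by (intro pow AM) auto
      show "(\<lambda>\<omega>. A k \<omega> ^ r * sgn (S k \<omega>)) \<in> borel_measurable M"
        using measurable_from_subalg[OF F(1) *] k by auto
      show "AE \<omega> in M. \<bar>A k \<omega> ^ r * sgn (S k \<omega>)\<bar> \<le> \<bar>A k \<omega> ^ r\<bar>"
        by (auto simp: abs_mult abs_sgn_eq)
    qed
  qed
  have isg: "integrable M (\<lambda>\<omega>. A k \<omega> ^ r * sgn (S k \<omega>) * x k \<omega>)" if "k < n" for k
    using int[OF mul[OF sgm[OF that] xm[OF that]]] by simp
  have iT: "integrable M (\<lambda>\<omega>. \<Sum>k<n. A k \<omega> ^ r * sgn (S k \<omega>) * x k \<omega>)"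
    using isg by (intro Bochner_Integration.integrable_sum) auto
  have "(LINT \<omega>|M. A n \<omega> ^ q / 2) \<le> (LINT \<omega>|M. A n \<omega> ^ q / 4 + 4 ^ r * S n \<omega> ^ q - (\<Sum>k<n. A k \<omega> ^ r * sgn (S k \<omega>) * x k \<omega>))"
    using iA iS iT doob by (intro integral_mono Bochner_Integration.integrable_diff Bochner_Integration.integrable_add) auto
  also have "\<dots> = (LINT \<omega>|M. A n \<omega> ^ q) / 4 + 4 ^ r * (LINT \<omega>|M. S n \<omega> ^ q) - (\<Sum>k<n. (LINT \<omega>|M. A k \<omega> ^ r * sgn (S k \<omega>) * x k \<omega>))"
    using iA iS iT isg by (simp add: Bochner_Integration.integral_sum)
  also have "(\<Sum>k<n. (LINT \<omega>|M. A k \<omega> ^ r * sgn (S k \<omega>) * x k \<omega>)) = 0"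
    using orth[OF _ sgF sgm] by (intro sum.neutral) auto
  finally have "(LINT \<omega>|M. A n \<omega> ^ q) \<le> 4 ^ q * (LINT \<omega>|M. S n \<omega> ^ q)"
    unfolding r(1) by simp
  also have "\<dots> \<le> 4 ^ q * (2 * K * exp c)" using Sn by simp
  finally have *: "(LINT \<omega>|M. A n \<omega> ^ q) \<le> 4 ^ q * (2 * K * exp c)" .
  have "(\<integral>\<^sup>+\<omega>. ennreal (A n \<omega> ^ q) \<partial>M) = ennreal (LINT \<omega>|M. A n \<omega> ^ q)"
    using iA q by (intro nn_integral_eq_integral) auto
  with * show ?thesis unfolding A_def S_def c_def by (simp add: ennreal_leI)
qed

section \<open>Brownian motion\<close>

text \<open>Under this restriction on \<open>l\<close> the exponential factor at most doubles the variance of the Gaussian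
  density, whose mass changes by the factor \<open>sqrt 2\<close>.\<close>

lemma (in prob_space) normal_exp_square:
  assumes D: "distributed M lborel X (\<lambda>x. ennreal (normal_density 0 \<sigma> x))" and \<sigma>: "\<sigma> > 0"
    and l: "l \<le> 1 / (4 * \<sigma>\<^sup>2)"
  shows "(\<integral>\<^sup>+\<omega>. ennreal (exp (l * (X \<omega>)\<^sup>2)) \<partial>M) \<le> ennreal (sqrt 2)"
proof -
  have "(\<integral>\<^sup>+\<omega>. ennreal (exp (l * (X \<omega>)\<^sup>2)) \<partial>M)
      = (\<integral>\<^sup>+x. ennreal (normal_density 0 \<sigma> x) * ennreal (exp (l * x\<^sup>2)) \<partial>lborel)"
    by (subst distributed_nn_integral[OF D, symmetric]) auto
  also have "\<dots> \<le> (\<integral>\<^sup>+x. ennreal (sqrt 2) * ennreal (normal_density 0 (sqrt 2 * \<sigma>) x) \<partial>lborel)"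
  proof (rule nn_integral_mono)
    fix x :: real
    have "- x\<^sup>2 / (2 * \<sigma>\<^sup>2) + l * x\<^sup>2 \<le> - x\<^sup>2 / (2 * \<sigma>\<^sup>2) + 1 / (4 * \<sigma>\<^sup>2) * x\<^sup>2"
      using l by (intro add_left_mono mult_right_mono) auto
    also have "\<dots> = - x\<^sup>2 / (2 * (sqrt 2 * \<sigma>)\<^sup>2)"
      using \<sigma> by (simp add: power_mult_distrib field_simps)
    finally have le: "exp (- x\<^sup>2 / (2 * \<sigma>\<^sup>2)) * exp (l * x\<^sup>2) \<le> exp (- x\<^sup>2 / (2 * (sqrt 2 * \<sigma>)\<^sup>2))"
      by (simp add: exp_add[symmetric])
    have "normal_density 0 \<sigma> x * exp (l * x\<^sup>2) \<le> sqrt 2 * normal_density 0 (sqrt 2 * \<sigma>) x"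
    proof -
      have s: "sqrt (2 * pi * (sqrt 2 * \<sigma>)\<^sup>2) = sqrt 2 * sqrt (2 * pi * \<sigma>\<^sup>2)"
        by (simp add: power_mult_distrib real_sqrt_mult)
      from mult_left_mono[OF le, of "1 / sqrt (2 * pi * \<sigma>\<^sup>2)"] show ?thesis
        unfolding normal_density_def s by simp
    qed
    then show "ennreal (normal_density 0 \<sigma> x) * ennreal (exp (l * x\<^sup>2))
        \<le> ennreal (sqrt 2) * ennreal (normal_density 0 (sqrt 2 * \<sigma>) x)"
      using \<sigma> by (subst (1 2) ennreal_mult[symmetric]) (auto intro: ennreal_leI)
  qed
  also have "\<dots> = ennreal (sqrt 2)"
  proof -
    have "(\<integral>\<^sup>+x. ennreal (normal_density 0 (sqrt 2 * \<sigma>) x) \<partial>lborel) = 1"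
      using \<sigma> by (subst nn_integral_eq_integral) auto
    then show ?thesis by (simp add: nn_integral_cmult)
  qed
  finally show ?thesis .
qed

locale brownian = prob_space +
  fixes T :: real and W :: "real \<Rightarrow> 'a \<Rightarrow> real"
  assumes T_pos: "T > 0" and brownian: "brownian_motion M T W"
begin

lemma W_measurable: "t \<in> {0..T} \<Longrightarrow> W t \<in> borel_measurable M"
  using brownian by (simp add: brownian_motion_def)

lemma W_increment_normal:
  "0 \<le> s \<Longrightarrow> s < t \<Longrightarrow> t \<le> T \<Longrightarrow>
    distributed M lborel (\<lambda>\<omega>. W t \<omega> - W s \<omega>) (\<lambda>x. ennreal (normal_density 0 (sqrt (t - s)) x))"
  using brownian by (simp add: brownian_motion_def)

lemma W_increment_exp_square:
  assumes "0 \<le> s" "s \<le> t" "t \<le> T" "l * (t - s) \<le> 1 / 4"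
  shows "(\<integral>\<^sup>+\<omega>. ennreal (exp (l * (W t \<omega> - W s \<omega>)\<^sup>2)) \<partial>M) \<le> ennreal (sqrt 2)"
proof (cases "s = t")
  case True
  have "(1::real) \<le> sqrt 2" by simp
  then have "ennreal 1 \<le> ennreal (sqrt 2)" by (rule ennreal_leI)
  with True show ?thesis by (simp add: emeasure_space_1)
next
  case False
  then show ?thesis using assms
    by (intro normal_exp_square[OF W_increment_normal]) (auto simp: field_simps)
qed

text \<open>Expanding the exponential, the moments of a normalised increment are dominated by one
  Gaussian integral that does not depend on the length of the increment. For \<open>s = t\<close> the quotient
  is \<open>0\<close>.\<close>

lemma W_increment_moments:
  "unif_moments M {(s, t). 0 \<le> s \<and> s \<le> t \<and> t \<le> T} (\<lambda>(s, t) \<omega>. (W t \<omega> - W s \<omega>) / sqrt (t - s))"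
proof (rule unif_moments_even)
  fix n
  have "(\<integral>\<^sup>+\<omega>. ennreal (((W t \<omega> - W s \<omega>) / sqrt (t - s)) ^ (2 * n)) \<partial>M) \<le> ennreal (4 ^ n * fact n * sqrt 2)"
    if st: "0 \<le> s" "s \<le> t" "t \<le> T" for s t
  proof -
    have [measurable]: "W t \<in> borel_measurable M" "W s \<in> borel_measurable M" using W_measurable st by auto
    define Z where "Z \<omega> = (W t \<omega> - W s \<omega>) / sqrt (t - s)" for \<omega>
    have pt: "Z \<omega> ^ (2 * n) \<le> 4 ^ n * fact n * exp ((Z \<omega>)\<^sup>2 / 4)" for \<omega>
    proof -
      have "((Z \<omega>)\<^sup>2 / 4) ^ n / fact n \<le> exp ((Z \<omega>)\<^sup>2 / 4)"
      proof -
        have "(\<Sum>k\<in>{n}. ((Z \<omega>)\<^sup>2 / 4) ^ k /\<^sub>R fact k) \<le> (\<Sum>k. ((Z \<omega>)\<^sup>2 / 4) ^ k /\<^sub>R fact k)"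
          by (rule sum_le_suminf[OF summable_exp_generic]) auto
        also have "\<dots> = exp ((Z \<omega>)\<^sup>2 / 4)" by (simp only: exp_def)
        finally have "inverse (fact n) * ((Z \<omega>)\<^sup>2 / 4) ^ n \<le> exp ((Z \<omega>)\<^sup>2 / 4)"
          by (simp only: sum.insert finite.emptyI empty_iff sum.empty add_0_right real_scaleR_def not_False_eq_True)
        then show ?thesis by (simp only: divide_inverse mult.commute)
      qed
      then have "((Z \<omega>)\<^sup>2 / 4) ^ n \<le> fact n * exp ((Z \<omega>)\<^sup>2 / 4)"
        by (simp add: pos_divide_le_eq mult.commute)
      then have "4 ^ n * ((Z \<omega>)\<^sup>2 / 4) ^ n \<le> 4 ^ n * (fact n * exp ((Z \<omega>)\<^sup>2 / 4))"
        by (intro mult_left_mono) auto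
      moreover have "4 ^ n * ((Z \<omega>)\<^sup>2 / 4) ^ n = Z \<omega> ^ (2 * n)"
        by (simp only: power_mult_distrib[symmetric] power_mult) simp
      ultimately show ?thesis by (simp only: mult.assoc)
    qed
    have "1 / (4 * x) * x \<le> 1 / 4" for x :: real by (cases "x = 0") auto
    note l = this[of "t - s"]
    have "(\<integral>\<^sup>+\<omega>. ennreal (Z \<omega> ^ (2 * n)) \<partial>M) \<le> (\<integral>\<^sup>+\<omega>. ennreal (4 ^ n * fact n) * ennreal (exp ((Z \<omega>)\<^sup>2 / 4)) \<partial>M)"
      using pt by (intro nn_integral_mono) (auto simp: ennreal_mult'[symmetric] intro!: ennreal_leI)
    also have "\<dots> = ennreal (4 ^ n * fact n) * (\<integral>\<^sup>+\<omega>. ennreal (exp ((Z \<omega>)\<^sup>2 / 4)) \<partial>M)"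
      unfolding Z_def by (intro nn_integral_cmult) measurable
    also have "(\<lambda>\<omega>. ennreal (exp ((Z \<omega>)\<^sup>2 / 4))) = (\<lambda>\<omega>. ennreal (exp (1 / (4 * (t - s)) * (W t \<omega> - W s \<omega>)\<^sup>2)))"
      using st by (simp add: Z_def power_divide mult.commute)
    also have "ennreal (4 ^ n * fact n) * (\<integral>\<^sup>+\<omega>. ennreal (exp (1 / (4 * (t - s)) * (W t \<omega> - W s \<omega>)\<^sup>2)) \<partial>M)
        \<le> ennreal (4 ^ n * fact n) * ennreal (sqrt 2)"
      using st by (intro mult_left_mono W_increment_exp_square l) auto
    also have "\<dots> = ennreal (4 ^ n * fact n * sqrt 2)" by (simp add: ennreal_mult')
    finally show ?thesis unfolding Z_def .
  qed
  then show "\<exists>C. \<forall>i\<in>{(s, t). 0 \<le> s \<and> s \<le> t \<and> t \<le> T}.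
      (\<integral>\<^sup>+\<omega>. ennreal ((case i of (s, t) \<Rightarrow> \<lambda>\<omega>. (W t \<omega> - W s \<omega>) / sqrt (t - s)) \<omega> ^ (2 * n)) \<partial>M) \<le> ennreal C"
    by (intro exI[of _ "4 ^ n * fact n * sqrt 2"]) auto
qed (auto intro!: borel_measurable_divide borel_measurable_diff W_measurable)

lemma W_increment_diff_moments:
  "unif_moments M {(s, t). 0 \<le> s \<and> s \<le> t \<and> t \<le> T} (\<lambda>(s, t) \<omega>. W t \<omega> - W s \<omega>)"
proof -
  have "unif_moments M {(s, t). 0 \<le> s \<and> s \<le> t \<and> t \<le> T}
      (\<lambda>i \<omega>. (case i of (s, t) \<Rightarrow> sqrt (t - s)) * (case i of (s, t) \<Rightarrow> \<lambda>\<omega>. (W t \<omega> - W s \<omega>) / sqrt (t - s)) \<omega>)"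
    by (rule unif_moments_cmult[OF W_increment_moments, of _ "sqrt T"]) auto
  then show ?thesis
  proof (rule unif_moments_dominated)
    fix i assume "i \<in> {(s, t). 0 \<le> s \<and> s \<le> t \<and> t \<le> T}"
    then obtain s t where i: "i = (s, t)" "0 \<le> s" "s \<le> t" "t \<le> T" by auto
    show "(case i of (s, t) \<Rightarrow> \<lambda>\<omega>. W t \<omega> - W s \<omega>) \<in> borel_measurable M"
      using i by (auto intro!: borel_measurable_diff W_measurable)
    show "AE \<omega> in M. \<bar>(case i of (s, t) \<Rightarrow> \<lambda>\<omega>. W t \<omega> - W s \<omega>) \<omega>\<bar>
       \<le> \<bar>(case i of (s, t) \<Rightarrow> sqrt (t - s)) * (case i of (s, t) \<Rightarrow> \<lambda>\<omega>. (W t \<omega> - W s \<omega>) / sqrt (t - s)) \<omega>\<bar>"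
      using i by auto
  qed
qed

lemma W_increment_mean:
  assumes "0 \<le> s" "s \<le> t" "t \<le> T"
  shows "expectation (\<lambda>\<omega>. W t \<omega> - W s \<omega>) = 0"
proof (cases "s = t")
  case False
  then show ?thesis using assms
    by (intro normal_distributed_expectation[OF _ W_increment_normal]) auto
qed simp

subsection \<open>The past and the increments after it\<close>

text \<open>Since \<open>W 0 = 0\<close> holds almost surely only, the past is generated by \<open>W u - W 0\<close>, which is
  a sum of increments at every sample point.\<close>

definition past :: "real \<Rightarrow> 'a measure" where
  "past a = sigma (space M) (\<Union>u\<in>{0..a}. {(\<lambda>\<omega>. W u \<omega> - W 0 \<omega>) -` A \<inter> space M | A. A \<in> sets borel})"

lemma space_past: "space (past a) = space M"
  by (simp add: past_def space_measure_of_conv)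

lemma sets_past:
  "sets (past a) = sigma_sets (space M) (\<Union>u\<in>{0..a}. {(\<lambda>\<omega>. W u \<omega> - W 0 \<omega>) -` A \<inter> space M | A. A \<in> sets borel})"
  unfolding past_def by (intro sets_measure_of) auto

lemma subalgebra_past: "a \<le> T \<Longrightarrow> subalgebra M (past a)"
  unfolding subalgebra_def space_past sets_past
proof (intro conjI sets.sigma_sets_subset refl UN_least)
  fix u assume "a \<le> T" "u \<in> {0..a}"
  then have [measurable]: "W u \<in> borel_measurable M" "W 0 \<in> borel_measurable M"
    using W_measurable by auto
  show "{(\<lambda>\<omega>. W u \<omega> - W 0 \<omega>) -` A \<inter> space M |A. A \<in> sets borel} \<subseteq> events"
    by (auto intro!: measurable_sets)
qed

lemma subalgebra_past_mono: "a \<le> b \<Longrightarrow> subalgebra (past b) (past a)"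
  unfolding subalgebra_def space_past sets_past by (intro conjI sigma_sets_mono' UN_mono) auto

lemma past_measurable: "u \<in> {0..a} \<Longrightarrow> (\<lambda>\<omega>. W u \<omega> - W 0 \<omega>) \<in> borel_measurable (past a)"
  by (intro measurableI) (auto simp: space_past sets_past intro!: sigma_sets.Basic UN_I[of u])

text \<open>The finitely many times in \<open>J\<close>, completed by \<open>0\<close>, \<open>a\<close> and \<open>s\<close>, are sorted into one partition. An
  event in terms of the values at \<open>J\<close> is determined by the increments other than the last, which is
  the increment from \<open>a\<close> to \<open>s\<close>.\<close>

lemma finite_past_indep:
  assumes J: "finite J" "J \<subseteq> {0..a}" and as: "0 \<le> a" "a \<le> s" "s \<le> T"
    and A: "A \<in> sigma_sets (space M) (\<Union>u\<in>J. {(\<lambda>\<omega>. W u \<omega> - W 0 \<omega>) -` A \<inter> space M | A. A \<in> sets borel})"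
    and B: "B \<in> sets borel"
  shows "A \<in> events" "prob (A \<inter> ((\<lambda>\<omega>. W s \<omega> - W a \<omega>) -` B \<inter> space M))
     = prob A * prob ((\<lambda>\<omega>. W s \<omega> - W a \<omega>) -` B \<inter> space M)"
proof -
  define xs where "xs = sorted_list_of_set (insert 0 (insert a J))"
  define n where "n = length xs"
  define u where "u i = (if i < n then xs ! i else s)" for i
  define \<xi> where "\<xi> i \<omega> = W (u (Suc i)) \<omega> - W (u i) \<omega>" for i \<omega>
  have fin: "finite (insert 0 (insert a J))" using J by auto
  have set: "set xs = insert 0 (insert a J)" and sorted: "sorted xs"
    unfolding xs_def using fin by (auto simp del: sorted_list_of_set_insert_remove)
  have nth: "\<exists>i<n. xs ! i = v" if "v \<in> insert 0 (insert a J)" for v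
    using that unfolding set[symmetric] n_def by (simp add: in_set_conv_nth)
  have n0: "n > 0" using set by (auto simp: n_def)
  have range: "xs ! i \<in> {0..a}" if "i < n" for i
  proof -
    have "xs ! i \<in> set xs" using that by (simp add: n_def)
    then show ?thesis using set J as by auto
  qed
  have u0: "u 0 = 0"
  proof -
    obtain i where i: "i < n" "xs ! i = 0" using nth[of 0] by auto
    then have "xs ! 0 \<le> 0" using sorted_nth_mono[OF sorted, of 0 i] by (simp add: n_def)
    then show ?thesis using range[OF n0] n0 by (simp add: u_def)
  qed
  have ulast: "u (n - 1) = a"
  proof -
    obtain i where i: "i < n" "xs ! i = a" using nth[of a] by auto
    then have "a \<le> xs ! (n - 1)" using sorted_nth_mono[OF sorted, of i "n - 1"] by (simp add: n_def)
    then show ?thesis using range[of "n - 1"] n0 by (simp add: u_def)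
  qed
  have mono: "u i \<le> u (Suc i)" if "i < n" for i
    using range[OF that] that as sorted_nth_mono[OF sorted, of i "Suc i"] by (auto simp: u_def n_def)
  have ind: "indep_vars (\<lambda>_. borel) \<xi> {..<n}"
  proof -
    have "0 \<le> u 0 \<and> (\<forall>i<n. u i \<le> u (Suc i)) \<and> u n \<le> T" using u0 mono as by (simp add: u_def)
    with brownian show ?thesis unfolding brownian_motion_def \<xi>_def by blast
  qed
  define R where "R \<omega> = restrict (\<lambda>i. \<xi> i \<omega>) {..<n-1}" for \<omega>
  define R' where "R' \<omega> = restrict (\<lambda>i. \<xi> i \<omega>) {n-1}" for \<omega>
  have iv: "indep_var (PiM {..<n-1} (\<lambda>_. borel)) R (PiM {n-1} (\<lambda>_. borel)) R'"
    unfolding R_def R'_def using n0 by (intro indep_var_restrict[OF ind]) auto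
  have R': "R' \<omega> (n - 1) = W s \<omega> - W a \<omega>" for \<omega>
    using ulast n0 by (simp add: R'_def \<xi>_def u_def)
  have Rm: "R \<in> measurable M (PiM {..<n-1} (\<lambda>_. borel))" by (rule indep_var_rv1[OF iv])
  define N where "N = vimage_algebra (space M) R (PiM {..<n-1} (\<lambda>_. borel :: real measure))"
  have RN: "R \<in> measurable N (PiM {..<n-1} (\<lambda>_. borel))"
    unfolding N_def using measurable_space[OF Rm] by (intro measurable_vimage_algebra1) auto
  have Vm: "(\<lambda>\<omega>. W v \<omega> - W 0 \<omega>) \<in> borel_measurable N" if "v \<in> J" for v
  proof -
    obtain i where i: "i < n" "xs ! i = v" using nth[of v] \<open>v \<in> J\<close> by blast
    have tele: "k < n \<Longrightarrow> (\<Sum>j<k. \<xi> j \<omega>) = W (u k) \<omega> - W 0 \<omega>" for k \<omega>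
      by (induction k) (auto simp: \<xi>_def u0)
    have "(\<lambda>\<omega>. W v \<omega> - W 0 \<omega>) = (\<lambda>\<omega>. \<Sum>j<i. R \<omega> j)"
    proof
      fix \<omega>
      have "W v \<omega> - W 0 \<omega> = (\<Sum>j<i. \<xi> j \<omega>)" using tele[OF i(1)] i by (simp add: u_def)
      also have "\<dots> = (\<Sum>j<i. R \<omega> j)" using i(1) by (intro sum.cong) (auto simp: R_def)
      finally show "W v \<omega> - W 0 \<omega> = (\<Sum>j<i. R \<omega> j)" .
    qed
    moreover have "(\<lambda>\<omega>. R \<omega> j) \<in> borel_measurable N" if "j < i" for j
      using measurable_compose[OF RN measurable_component_singleton[of j]] that i(1) by simp
    ultimately show ?thesis by simp
  qed
  have spN: "space N = space M" by (simp add: N_def)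
  have "A \<in> sets N"
  proof -
    have "(\<Union>u\<in>J. {(\<lambda>\<omega>. W u \<omega> - W 0 \<omega>) -` A \<inter> space M | A. A \<in> sets borel}) \<subseteq> sets N"
      using measurable_sets[OF Vm] spN by auto
    from sets.sigma_sets_subset[OF this] show ?thesis using A spN by auto
  qed
  then obtain A' where A': "A' \<in> sets (PiM {..<n-1} (\<lambda>_. borel))" "A = R -` A' \<inter> space M"
    unfolding N_def using measurable_space[OF Rm] by (subst (asm) sets_vimage_algebra2) auto
  show "A \<in> events" unfolding A'(2) using measurable_sets[OF Rm A'(1)] .
  show "prob (A \<inter> ((\<lambda>\<omega>. W s \<omega> - W a \<omega>) -` B \<inter> space M))
     = prob A * prob ((\<lambda>\<omega>. W s \<omega> - W a \<omega>) -` B \<inter> space M)"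
  proof -
    define B' where "B' = (\<lambda>f. f (n - 1)) -` B \<inter> space (PiM {n-1} (\<lambda>_. borel :: real measure))"
    have B': "B' \<in> sets (PiM {n-1} (\<lambda>_. borel))"
      unfolding B'_def using B by (intro measurable_sets[OF measurable_component_singleton]) auto
    have eqB: "R' -` B' \<inter> space M = (\<lambda>\<omega>. W s \<omega> - W a \<omega>) -` B \<inter> space M"
      using measurable_space[OF indep_var_rv2[OF iv]] by (auto simp: B'_def R'[simplified])
    have "A \<inter> (R' -` B' \<inter> space M) = (\<lambda>\<omega>. (R \<omega>, R' \<omega>)) -` (A' \<times> B') \<inter> space M"
      unfolding A'(2) by auto
    then show ?thesis using indep_varD[OF iv A'(1) B'] A'(2) eqB by simp
  qed
qed

text \<open>The events that depend on finitely many times form an intersection stable generator of the past,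
  and independence extends from a generator to the generated \<open>\<sigma>\<close>-algebra.\<close>

lemma past_indep_increment:
  assumes as: "0 \<le> a" "a \<le> s" "s \<le> T" and \<zeta>: "\<zeta> \<in> borel_measurable (past a)"
  shows "indep_var borel \<zeta> borel (\<lambda>\<omega>. W s \<omega> - W a \<omega>)"
proof -
  define gen where "gen J = (\<Union>u\<in>J. {(\<lambda>\<omega>. W u \<omega> - W 0 \<omega>) -` A \<inter> space M | A. A \<in> sets borel})" for J
  define \<G> where "\<G> = (\<Union>J\<in>{J. finite J \<and> J \<subseteq> {0..a}}. sigma_sets (space M) (gen J))"
  define \<H> where "\<H> = {(\<lambda>\<omega>. W s \<omega> - W a \<omega>) -` B \<inter> space M | B. B \<in> sets borel}"
  have [measurable]: "W s \<in> borel_measurable M" "W a \<in> borel_measurable M" using as W_measurable by auto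
  have "indep_set \<G> \<H>"
  proof (rule indep_setI)
    show "\<G> \<subseteq> events"
      using finite_past_indep(1)[OF _ _ as, of _ _ UNIV] by (auto simp: \<G>_def gen_def)
    show "\<H> \<subseteq> events" by (auto simp: \<H>_def intro!: measurable_sets)
    show "prob (A \<inter> B) = prob A * prob B" if "A \<in> \<G>" "B \<in> \<H>" for A B
      using that finite_past_indep(2)[OF _ _ as] by (auto simp: \<G>_def \<H>_def gen_def)
  qed
  moreover have "Int_stable \<G>"
  proof (rule Int_stableI)
    fix A B assume "A \<in> \<G>" "B \<in> \<G>"
    then obtain J1 J2 where J: "finite J1" "J1 \<subseteq> {0..a}" "A \<in> sigma_sets (space M) (gen J1)"
      "finite J2" "J2 \<subseteq> {0..a}" "B \<in> sigma_sets (space M) (gen J2)" by (auto simp: \<G>_def)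
    have g: "gen (J1 \<union> J2) \<subseteq> Pow (space M)" by (auto simp: gen_def)
    have "A \<in> sigma_sets (space M) (gen (J1 \<union> J2))" "B \<in> sigma_sets (space M) (gen (J1 \<union> J2))"
      using J(3,6) sigma_sets_mono'[of "gen J1" "gen (J1 \<union> J2)"] sigma_sets_mono'[of "gen J2" "gen (J1 \<union> J2)"]
      by (auto simp: gen_def)
    then have "A \<inter> B \<in> sigma_sets (space M) (gen (J1 \<union> J2))"
      using sets.Int[of A "sigma (space M) (gen (J1 \<union> J2))" B] g by (simp add: sets_measure_of)
    then show "A \<inter> B \<in> \<G>" using J by (auto simp: \<G>_def)
  qed
  moreover have "Int_stable \<H>"
  proof (rule Int_stableI)
    fix A B assume "A \<in> \<H>" "B \<in> \<H>"
    then obtain A' B' where "A' \<in> sets borel" "B' \<in> sets borel" "A = (\<lambda>\<omega>. W s \<omega> - W a \<omega>) -` A' \<inter> space M"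
      "B = (\<lambda>\<omega>. W s \<omega> - W a \<omega>) -` B' \<inter> space M" unfolding \<H>_def by blast
    then show "A \<inter> B \<in> \<H>" unfolding \<H>_def by (intro CollectI exI[of _ "A' \<inter> B'"]) auto
  qed
  ultimately have ind: "indep_set (sigma_sets (space M) \<G>) (sigma_sets (space M) \<H>)"
    by (rule indep_set_sigma_sets)
  have sub: "sets (past a) \<subseteq> sigma_sets (space M) \<G>"
    unfolding sets_past
  proof (rule sigma_sets_mono, rule UN_least)
    fix u assume "u \<in> {0..a}"
    then have "{u} \<in> {J. finite J \<and> J \<subseteq> {0..a}}" by simp
    then have "sigma_sets (space M) (gen {u}) \<subseteq> \<G>" unfolding \<G>_def by (rule UN_upper)
    then have "gen {u} \<subseteq> \<G>" using sigma_sets_superset_generator by blast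
    then show "{(\<lambda>\<omega>. W u \<omega> - W 0 \<omega>) -` A \<inter> space M |A. A \<in> sets borel} \<subseteq> sigma_sets (space M) \<G>"
      unfolding gen_def by (auto intro: sigma_sets.Basic)
  qed
  have "sigma_sets (space M) {\<zeta> -` A \<inter> space M |A. A \<in> sets borel} \<subseteq> sets (past a)"
    using sets.sigma_sets_subset[of "{\<zeta> -` A \<inter> space M |A. A \<in> sets borel}" "past a"] measurable_sets[OF \<zeta>]
    by (auto simp: space_past)
  with sub have "indep_set (sigma_sets (space M) {\<zeta> -` A \<inter> space M |A. A \<in> sets borel}) (sigma_sets (space M) \<H>)"
    using ind unfolding indep_set_def by (intro indep_sets_mono_sets[OF ind[unfolded indep_set_def]]) (auto split: bool.split)
  moreover have "\<zeta> \<in> borel_measurable M"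
    using measurable_from_subalg[OF subalgebra_past \<zeta>] as by simp
  ultimately show ?thesis unfolding indep_var_eq \<H>_def by auto
qed

lemma past_orthogonal_increment:
  assumes "0 \<le> a" "a \<le> s" "s \<le> T" and \<zeta>: "\<zeta> \<in> borel_measurable (past a)" "integrable M \<zeta>"
  shows "expectation (\<lambda>\<omega>. \<zeta> \<omega> * (W s \<omega> - W a \<omega>)) = 0"
proof -
  have "integrable M (\<lambda>\<omega>. W s \<omega> - W a \<omega>)"
    using unif_moments_integrable[OF W_increment_diff_moments, of "(a, s)"] assms by auto
  then show ?thesis
    using indep_var_lebesgue_integral[OF past_indep_increment[OF assms(1-4)] \<zeta>(2)] W_increment_mean[OF assms(1-3)]
    by simp
qed

text \<open>For sample means this is linearity; the limit is justified by bounded second moments.\<close>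

lemma past_orthogonal_path_mean:
  assumes ab: "0 \<le> a" "a \<le> b" "b \<le> T" and \<zeta>: "\<zeta> \<in> borel_measurable (past a)" "all_moments M \<zeta>"
  shows "expectation (\<lambda>\<omega>. \<zeta> \<omega> * path_mean a b (\<lambda>s. W s \<omega> - W a \<omega>)) = 0"
proof -
  define u where "u n i = a + (b - a) * real i / real n" for n i :: nat
  have u: "u n i \<in> {a..b}" if "i < n" for n i
    using sample_point_in[OF ab(2) that] by (simp add: u_def)
  define Z where "Z s \<omega> = W s \<omega> - W a \<omega>" for s \<omega>
  have Z: "unif_moments M {a..b} Z"
    using unif_moments_reindex[OF W_increment_diff_moments, of "{a..b}" "\<lambda>s. (a, s)"] ab by (auto simp: Z_def[abs_def])
  have AE: "AE \<omega> in M. continuous_on {a..b} (\<lambda>s. Z s \<omega>)"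
  proof -
    have "AE \<omega> in M. continuous_on {0..T} (\<lambda>t. W t \<omega>)" using brownian by (simp add: brownian_motion_def)
    then show ?thesis
    proof eventually_elim
      case (elim \<omega>)
      then have "continuous_on {a..b} (\<lambda>t. W t \<omega>)" using ab by (elim continuous_on_subset) auto
      then show ?case unfolding Z_def by (intro continuous_intros)
    qed
  qed
  define Xn where "Xn n \<omega> = \<zeta> \<omega> * ((\<Sum>i<Suc n. Z (u (Suc n) i) \<omega>) / real (Suc n))" for n \<omega>
  have Xn: "unif_moments M UNIV Xn"
  proof -
    have "unif_moments M {1..} (\<lambda>n \<omega>. (\<Sum>i<n. Z (u n i) \<omega>) / real n)"
      using u by (intro unif_moments_sample_mean[OF Z]) auto
    from unif_moments_reindex[OF this, of UNIV Suc]
    have "unif_moments M UNIV (\<lambda>n \<omega>. (\<Sum>i<Suc n. Z (u (Suc n) i) \<omega>) / real (Suc n))" by simp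
    moreover have "unif_moments M (UNIV :: nat set) (\<lambda>n. \<zeta>)" using unif_moments_reindex[OF \<zeta>(2)] by auto
    ultimately show ?thesis unfolding Xn_def by (intro unif_moments_mult)
  qed
  define X where "X \<omega> = \<zeta> \<omega> * path_mean a b (\<lambda>s. Z s \<omega>)" for \<omega>
  have X: "all_moments M X"
    unfolding X_def
  proof (rule unif_moments_mult[OF \<zeta>(2)], rule unif_moments_path_mean)
    show "unif_moments M {(i :: unit, s). i \<in> UNIV \<and> s \<in> {a..b}} (\<lambda>(i, s). Z s)"
      using unif_moments_reindex[OF Z, of "{(i, s). i \<in> UNIV \<and> s \<in> {a..b}}" snd] by (auto simp: case_prod_beta')
  qed (use ab AE in auto)
  obtain K where K: "\<And>n. expectation (\<lambda>\<omega>. \<bar>Xn n \<omega>\<bar> ^ 2) \<le> K"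
    using unif_moments_expectation[OF Xn] by (metis UNIV_I)
  have "expectation X = 0"
  proof (rule expectation_limit_zero[of Xn X K])
    show "AE \<omega> in M. (\<lambda>n. Xn n \<omega>) \<longlonglongrightarrow> X \<omega>"
      using AE
    proof eventually_elim
      case (elim \<omega>)
      show ?case
        unfolding Xn_def X_def u_def
        by (rule tendsto_mult_left[OF LIMSEQ_Suc[OF path_mean_tendsto[OF elim ab(2)]]])
    qed
    show "expectation (\<lambda>\<omega>. Xn n \<omega> ^ 2) \<le> K" for n using K[of n] by simp
    show "expectation (Xn n) = 0" for n
    proof -
      have i: "integrable M (\<lambda>\<omega>. \<zeta> \<omega> * Z (u (Suc n) i) \<omega>)" if "i < Suc n" for i
      proof -
        have "all_moments M (Z (u (Suc n) i))" using unif_moments_single[OF Z u[OF that]] .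
        from unif_moments_integrable[OF unif_moments_mult[OF \<zeta>(2) this]] show ?thesis by simp
      qed
      have eq: "Xn n = (\<lambda>\<omega>. (\<Sum>i<Suc n. \<zeta> \<omega> * Z (u (Suc n) i) \<omega>) / real (Suc n))"
        unfolding Xn_def by (simp add: sum_distrib_left del: sum.lessThan_Suc)
      have "expectation (Xn n) = (\<Sum>i<Suc n. expectation (\<lambda>\<omega>. \<zeta> \<omega> * Z (u (Suc n) i) \<omega>)) / real (Suc n)"
        unfolding eq using i by (simp add: Bochner_Integration.integral_sum del: sum.lessThan_Suc of_nat_Suc)
      also have "(\<Sum>i<Suc n. expectation (\<lambda>\<omega>. \<zeta> \<omega> * Z (u (Suc n) i) \<omega>)) = 0"
      proof (intro sum.neutral ballI)
        fix i assume "i \<in> {..<Suc n}"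
        then have "u (Suc n) i \<in> {a..b}" using u by auto
        then show "expectation (\<lambda>\<omega>. \<zeta> \<omega> * Z (u (Suc n) i) \<omega>) = 0"
          unfolding Z_def using ab \<zeta>(1) unif_moments_integrable[OF \<zeta>(2)]
          by (intro past_orthogonal_increment) auto
      qed
      finally show ?thesis by simp
    qed
    show "X \<in> borel_measurable M" using unif_moments_measurable[OF X] by auto
    show "integrable M (\<lambda>\<omega>. X \<omega> ^ 2)" using unif_moments_integrable_power[OF X] by auto
    show "Xn n \<in> borel_measurable M" for n using unif_moments_measurable[OF Xn] by auto
    show "integrable M (\<lambda>\<omega>. Xn n \<omega> ^ 2)" for n using unif_moments_integrable_power[OF Xn] by auto
  qed
  then show ?thesis unfolding X_def Z_def .
qed

subsection \<open>Weighted sums of the increments over a grid\<close>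

lemma grid_facts:
  assumes "N \<ge> 1"
  shows "0 < step T N" "grid T N (Suc k) - grid T N k = step T N" "grid T N k \<le> grid T N (Suc k)"
    "0 \<le> grid T N k" "k \<le> N \<Longrightarrow> grid T N k \<le> T"
proof -
  show s: "0 < step T N" using assms T_pos by (simp add: step_def)
  show "grid T N (Suc k) - grid T N k = step T N" by (simp add: grid_def algebra_simps)
  show "grid T N k \<le> grid T N (Suc k)" "0 \<le> grid T N k" using s by (auto simp: grid_def)
  assume "k \<le> N"
  then have "real k * (T / real N) \<le> real N * (T / real N)"
    using T_pos by (intro mult_right_mono) auto
  then show "grid T N k \<le> T" using assms by (simp add: grid_def step_def)
qed

text \<open>With deterministic weights the sum is a martingale whose total variance is the sum on the
  right-hand side. Dividing by its square root normalises the total variance to one, and the \<open>p\<close>-th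
  power of the variance reappears by scaling back.\<close>

lemma weighted_increments_max:
  assumes p: "p \<ge> 1"
  shows "\<exists>C\<ge>0. \<forall>N\<ge>1. \<forall>a::nat \<Rightarrow> real.
    (\<integral>\<^sup>+\<omega>. ennreal (running_max (\<lambda>k. \<Sum>l<k. a l * (W (grid T N (Suc l)) \<omega> - W (grid T N l) \<omega>)) N powr (2 * p)) \<partial>M)
      \<le> ennreal (C * (\<Sum>l<N. (a l)\<^sup>2 * step T N) powr p)"
proof -
  define m where "m = nat \<lceil>p\<rceil>"
  have m: "p \<le> real m" "m \<ge> 1" using p by (auto simp: m_def) linarith
  define q where "q = 2 * m"
  obtain K where K: "K \<ge> 0" "\<And>i. i \<in> {(s, t). 0 \<le> s \<and> s \<le> t \<and> t \<le> T} \<Longrightarrow>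
     (LINT \<omega>|M. \<bar>(case i of (s, t) \<Rightarrow> \<lambda>\<omega>. (W t \<omega> - W s \<omega>) / sqrt (t - s)) \<omega>\<bar> ^ q) \<le> K"
    using unif_moments_expectation[OF W_increment_moments] by blast
  define C where "C = 1 + 4 ^ q * (2 * K * exp (2 ^ q))"
  have C0: "C \<ge> 0" using K by (simp add: C_def)
  have "(\<integral>\<^sup>+\<omega>. ennreal (running_max (\<lambda>k. \<Sum>l<k. a l * (W (grid T N (Suc l)) \<omega> - W (grid T N l) \<omega>)) N powr (2 * p)) \<partial>M)
      \<le> ennreal (C * (\<Sum>l<N. (a l)\<^sup>2 * step T N) powr p)" if N: "N \<ge> 1" for N and a :: "nat \<Rightarrow> real"
  proof -
    note g = grid_facts[OF N]
    define \<delta> where "\<delta> = step T N"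
    have \<delta>: "\<delta> > 0" using g by (simp add: \<delta>_def)
    define V where "V = (\<Sum>l<N. (a l)\<^sup>2 * \<delta>)"
    define \<Delta> where "\<Delta> l \<omega> = W (grid T N (Suc l)) \<omega> - W (grid T N l) \<omega>" for l \<omega>
    define A where "A \<omega> = running_max (\<lambda>k. \<Sum>l<k. a l * \<Delta> l \<omega>) N" for \<omega>
    have V0: "V \<ge> 0" using \<delta> unfolding V_def by (intro sum_nonneg) auto
    have "(\<integral>\<^sup>+\<omega>. ennreal (A \<omega> powr (2 * p)) \<partial>M) \<le> ennreal (C * V powr p)"
    proof (cases "V = 0")
      case True
      then have "a l = 0" if "l < N" for l
        using that \<delta> unfolding V_def by (subst (asm) sum_nonneg_eq_0_iff) auto
      then have "A \<omega> = 0" for \<omega>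
      proof -
        have "A \<omega> \<in> (\<lambda>j. \<bar>\<Sum>l<j. a l * \<Delta> l \<omega>\<bar>) ` {..N}" unfolding A_def running_max_def by (intro Max_in) auto
        then obtain j where "j \<le> N" "A \<omega> = \<bar>\<Sum>l<j. a l * \<Delta> l \<omega>\<bar>" by auto
        then show ?thesis using \<open>\<And>l. l < N \<Longrightarrow> a l = 0\<close> by simp
      qed
      then show ?thesis by simp
    next
      case False
      then have V: "V > 0" using V0 by simp
      define b where "b l = (a l)\<^sup>2 * \<delta> / V" for l
      define x where "x l \<omega> = a l / sqrt V * \<Delta> l \<omega>" for l \<omega>
      define z where "z l \<omega> = sgn (a l) * (\<Delta> l \<omega> / sqrt \<delta>)" for l \<omega>
      have zm: "all_moments M (\<lambda>\<omega>. \<Delta> l \<omega> / sqrt \<delta>)" if "l < N" for l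
      proof -
        have "(grid T N l, grid T N (Suc l)) \<in> {(s, t). 0 \<le> s \<and> s \<le> t \<and> t \<le> T}" using that g by auto
        from unif_moments_single[OF W_increment_moments this] show ?thesis by (simp add: \<Delta>_def \<delta>_def g)
      qed
      have zm': "all_moments M (z l)" if "l < N" for l
        unfolding z_def using zm[OF that] by (intro unif_moments_cmult[where K=1]) (auto simp: abs_sgn_eq)
      have xz: "x l \<omega> = sqrt (b l) * z l \<omega>" for l \<omega>
      proof -
        have "sqrt (b l) = \<bar>a l\<bar> * sqrt \<delta> / sqrt V" by (simp add: b_def real_sqrt_mult real_sqrt_divide)
        then show ?thesis using \<delta> by (simp add: x_def z_def mult.assoc[symmetric] abs_mult_sgn[symmetric])
      qed
      have "(\<integral>\<^sup>+\<omega>. ennreal (running_max (\<lambda>k. \<Sum>l<k. x l \<omega>) N ^ q) \<partial>M) \<le> ennreal (4 ^ q * (2 * K * exp (2 ^ q)))"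
      proof (rule martingale_max_moment[where F="\<lambda>k. past (grid T N k)" and b=b and z=z])
        show "subalgebra M (past (grid T N k))" if "k \<le> N" for k using that g by (intro subalgebra_past) auto
        show "subalgebra (past (grid T N (Suc k))) (past (grid T N k))" for k
          using g by (intro subalgebra_past_mono) auto
        show "x k \<in> borel_measurable (past (grid T N (Suc k)))" for k
        proof -
          have "(\<lambda>\<omega>. W (grid T N (Suc k)) \<omega> - W 0 \<omega>) \<in> borel_measurable (past (grid T N (Suc k)))"
            "(\<lambda>\<omega>. W (grid T N k) \<omega> - W 0 \<omega>) \<in> borel_measurable (past (grid T N (Suc k)))"
            using g by (auto intro!: past_measurable)
          then have "(\<lambda>\<omega>. (W (grid T N (Suc k)) \<omega> - W 0 \<omega>) - (W (grid T N k) \<omega> - W 0 \<omega>)) \<in> borel_measurable (past (grid T N (Suc k)))"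
            by (rule borel_measurable_diff)
          then have "\<Delta> k \<in> borel_measurable (past (grid T N (Suc k)))" by (simp add: \<Delta>_def[abs_def])
          then show ?thesis unfolding x_def by measurable
        qed
        show zk: "all_moments M (z k)" if "k < N" for k by (rule zm'[OF that])
        show "all_moments M (x k)" if "k < N" for k
        proof -
          have "x k = (\<lambda>\<omega>. sqrt (b k) * z k \<omega>)" using xz by auto
          then show ?thesis using unif_moments_cmult[OF zm'[OF that], of "\<lambda>_. sqrt (b k)" "\<bar>sqrt (b k)\<bar>"] by simp
        qed
        show "expectation (\<lambda>\<omega>. \<zeta> \<omega> * x k \<omega>) = 0"
          if "k < N" "\<zeta> \<in> borel_measurable (past (grid T N k))" "all_moments M \<zeta>" for k \<zeta>
        proof -
          have "expectation (\<lambda>\<omega>. \<zeta> \<omega> * \<Delta> k \<omega>) = 0"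
            unfolding \<Delta>_def using that g unif_moments_integrable[OF that(3)]
            by (intro past_orthogonal_increment) auto
          then have "expectation (\<lambda>\<omega>. a k / sqrt V * (\<zeta> \<omega> * \<Delta> k \<omega>)) = 0"
            by (simp only: integral_mult_right_zero)
          then show ?thesis unfolding x_def by (simp add: mult.left_commute mult.assoc)
        qed
        show "even q" "q \<ge> 2" using m by (auto simp: q_def)
        show "0 \<le> b k" for k using \<delta> V by (simp add: b_def)
        show "(\<Sum>k<N. b k) \<le> 1" using V by (simp add: b_def sum_divide_distrib[symmetric] V_def[symmetric])
        show "x k \<omega> = sqrt (b k) * z k \<omega>" for k \<omega> by (rule xz)
        show "0 \<le> K" by (rule K(1))
        show "(LINT \<omega>|M. z k \<omega> ^ q) \<le> K" if "k < N" for k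
        proof -
          have i: "integrable M (\<lambda>\<omega>. \<bar>\<Delta> k \<omega> / sqrt \<delta>\<bar> ^ q)"
            using unif_moments_integrable_power[OF unif_moments_abs[OF zm[OF that]]] by auto
          have "(LINT \<omega>|M. z k \<omega> ^ q) \<le> (LINT \<omega>|M. \<bar>\<Delta> k \<omega> / sqrt \<delta>\<bar> ^ q)"
          proof (rule integral_mono[OF _ i])
            show "integrable M (\<lambda>\<omega>. z k \<omega> ^ q)" using unif_moments_integrable_power[OF zm'[OF that]] by auto
            have "\<bar>z k \<omega>\<bar> \<le> \<bar>\<Delta> k \<omega> / sqrt \<delta>\<bar>" for \<omega>
              unfolding z_def by (simp only: abs_mult abs_sgn_eq) auto
            then have "\<bar>z k \<omega>\<bar> ^ q \<le> \<bar>\<Delta> k \<omega> / sqrt \<delta>\<bar> ^ q" for \<omega> by (intro power_mono) auto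
            moreover have "z k \<omega> ^ q = \<bar>z k \<omega>\<bar> ^ q" for \<omega> unfolding q_def by (simp add: power_even_abs)
            ultimately show "z k \<omega> ^ q \<le> \<bar>\<Delta> k \<omega> / sqrt \<delta>\<bar> ^ q" for \<omega> by simp
          qed
          also have "\<dots> \<le> K" using K(2)[of "(grid T N k, grid T N (Suc k))"] that g by (simp add: \<Delta>_def \<delta>_def)
          finally show ?thesis .
        qed
      qed
      moreover have "running_max (\<lambda>k. \<Sum>l<k. x l \<omega>) N = A \<omega> / sqrt V" for \<omega>
      proof -
        have "(\<lambda>k. \<Sum>l<k. x l \<omega>) = (\<lambda>k. (1 / sqrt V) * (\<Sum>l<k. a l * \<Delta> l \<omega>))"
          by (simp add: x_def sum_distrib_left)
        then show ?thesis using running_max_scale[of "1 / sqrt V" "\<lambda>k. \<Sum>l<k. a l * \<Delta> l \<omega>" N] V by (simp add: A_def)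
      qed
      ultimately have E: "(\<integral>\<^sup>+\<omega>. ennreal ((A \<omega> / sqrt V) ^ q) \<partial>M) \<le> ennreal (4 ^ q * (2 * K * exp (2 ^ q)))" by simp
      have W: "W (grid T N k) \<in> borel_measurable M" if "k \<le> N" for k using that g by (intro W_measurable) auto
      then have "(\<lambda>\<omega>. \<Sum>l<k. a l * \<Delta> l \<omega>) \<in> borel_measurable M" if "k \<le> N" for k
        unfolding \<Delta>_def using that by (intro borel_measurable_sum borel_measurable_times borel_measurable_diff) auto
      then have Am: "A \<in> borel_measurable M"
        unfolding A_def running_max_def by (intro borel_measurable_Max borel_measurable_abs) auto
      have "(\<integral>\<^sup>+\<omega>. ennreal (A \<omega> powr (2 * p)) \<partial>M) \<le> ennreal (C * sqrt V powr (2 * p))"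
        unfolding C_def
      proof (rule nn_integral_powr_le_power[OF Am _ _ _ _ E])
        show "0 \<le> A \<omega>" for \<omega> by (simp add: A_def running_max_nonneg)
      qed (use V p m K(1) in \<open>auto simp: q_def\<close>)
      moreover have "sqrt V powr (2 * p) = V powr p" using V by (simp add: powr_half_sqrt[symmetric] powr_powr)
      ultimately show ?thesis by simp
    qed
    then show ?thesis unfolding A_def \<Delta>_def V_def \<delta>_def .
  qed
  then show ?thesis using C0 by blast
qed

end

section \<open>The Ornstein-Uhlenbeck process\<close>

subsection \<open>Sub-Gaussian exponential growth\<close>

text \<open>One constant serves as factor and as rate, so that the class is visibly closed under sums and
  products. For \<open>\<beta> < 2\<close> measurable functions of this class are integrable against every Gaussian law, to all powers.\<close>

definition exp_growth :: "real \<Rightarrow> (real \<Rightarrow> real) \<Rightarrow> bool" where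
  "exp_growth \<beta> g \<longleftrightarrow> (\<exists>K>0. \<forall>y. \<bar>g y\<bar> \<le> K * exp (K * \<bar>y\<bar> powr \<beta>))"

lemma exp_growthI:
  assumes "\<And>y. \<bar>g y\<bar> \<le> K * exp (L * \<bar>y\<bar> powr \<beta>)"
  shows "exp_growth \<beta> g"
  unfolding exp_growth_def
proof (intro exI[of _ "max 1 (max K L)"] conjI allI)
  fix y
  define m where "m = max 1 (max K L)"
  have "\<bar>g y\<bar> \<le> K * exp (L * \<bar>y\<bar> powr \<beta>)" by (rule assms)
  also have "\<dots> \<le> m * exp (L * \<bar>y\<bar> powr \<beta>)" by (intro mult_right_mono) (auto simp: m_def)
  also have "\<dots> \<le> m * exp (m * \<bar>y\<bar> powr \<beta>)"
    unfolding exp_le_cancel_iff by (intro mult_left_mono) (auto simp: m_def intro!: mult_right_mono)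
  finally show "\<bar>g y\<bar> \<le> max 1 (max K L) * exp (max 1 (max K L) * \<bar>y\<bar> powr \<beta>)" unfolding m_def .
qed auto

lemma exp_growth_mono:
  assumes "exp_growth \<beta> g" "\<And>y. \<bar>h y\<bar> \<le> \<bar>g y\<bar>"
  shows "exp_growth \<beta> h"
  using assms unfolding exp_growth_def by (meson order_trans)

lemma exp_growth_const: "exp_growth \<beta> (\<lambda>y. c)"
  by (rule exp_growthI[of _ "\<bar>c\<bar>" 0]) auto

lemma exp_growth_id:
  assumes "\<beta> \<ge> 1"
  shows "exp_growth \<beta> (\<lambda>y. y)"
proof (rule exp_growthI[of _ 1 1])
  fix y :: real
  have "\<bar>y\<bar> \<le> 1 + \<bar>y\<bar> powr \<beta>"
  proof (cases "\<bar>y\<bar> \<le> 1")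
    case False
    then have "\<bar>y\<bar> powr 1 \<le> \<bar>y\<bar> powr \<beta>" using assms by (intro powr_mono) auto
    then show ?thesis using False by simp
  qed (simp add: add_increasing2)
  also have "\<dots> \<le> exp (\<bar>y\<bar> powr \<beta>)" by simp
  finally show "\<bar>y\<bar> \<le> 1 * exp (1 * \<bar>y\<bar> powr \<beta>)" by simp
qed

lemma exp_growth_mult:
  assumes "exp_growth \<beta> g" "exp_growth \<beta> h"
  shows "exp_growth \<beta> (\<lambda>y. g y * h y)"
proof -
  obtain K where K: "K > 0" "\<And>y. \<bar>g y\<bar> \<le> K * exp (K * \<bar>y\<bar> powr \<beta>)"
    using assms unfolding exp_growth_def by blast
  obtain L where L: "L > 0" "\<And>y. \<bar>h y\<bar> \<le> L * exp (L * \<bar>y\<bar> powr \<beta>)"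
    using assms unfolding exp_growth_def by blast
  have "\<bar>g y * h y\<bar> \<le> (K * L) * exp ((K + L) * \<bar>y\<bar> powr \<beta>)" for y
  proof -
    have "\<bar>g y * h y\<bar> \<le> (K * exp (K * \<bar>y\<bar> powr \<beta>)) * (L * exp (L * \<bar>y\<bar> powr \<beta>))"
      unfolding abs_mult using K L by (intro mult_mono) auto
    also have "\<dots> = (K * L) * (exp (K * \<bar>y\<bar> powr \<beta>) * exp (L * \<bar>y\<bar> powr \<beta>))" by simp
    also have "exp (K * \<bar>y\<bar> powr \<beta>) * exp (L * \<bar>y\<bar> powr \<beta>) = exp ((K + L) * \<bar>y\<bar> powr \<beta>)"
      by (simp add: exp_add[symmetric] distrib_right)
    finally show ?thesis .
  qed
  then show ?thesis by (rule exp_growthI)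
qed

lemma exp_growth_add:
  assumes "exp_growth \<beta> g" "exp_growth \<beta> h"
  shows "exp_growth \<beta> (\<lambda>y. g y + h y)"
proof -
  obtain K where K: "K > 0" "\<And>y. \<bar>g y\<bar> \<le> K * exp (K * \<bar>y\<bar> powr \<beta>)"
    using assms unfolding exp_growth_def by blast
  obtain L where L: "L > 0" "\<And>y. \<bar>h y\<bar> \<le> L * exp (L * \<bar>y\<bar> powr \<beta>)"
    using assms unfolding exp_growth_def by blast
  have "\<bar>g y + h y\<bar> \<le> (K + L) * exp ((K + L) * \<bar>y\<bar> powr \<beta>)" for y
  proof -
    have "K * exp (K * \<bar>y\<bar> powr \<beta>) \<le> K * exp ((K + L) * \<bar>y\<bar> powr \<beta>)"
      "L * exp (L * \<bar>y\<bar> powr \<beta>) \<le> L * exp ((K + L) * \<bar>y\<bar> powr \<beta>)"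
      using K L by (auto intro!: mult_right_mono)
    then show ?thesis using K(2)[of y] L(2)[of y] unfolding distrib_right[of K L] by linarith
  qed
  then show ?thesis by (rule exp_growthI)
qed

lemma powr_le_square:
  fixes \<beta> K \<eta> :: real
  assumes "0 \<le> \<beta>" "\<beta> < 2" "K > 0" "\<eta> > 0"
  shows "\<exists>C. \<forall>y::real. K * \<bar>y\<bar> powr \<beta> \<le> \<eta> * y\<^sup>2 + C"
proof (intro exI allI)
  fix y :: real
  define x0 where "x0 = (K / \<eta>) powr (1 / (2 - \<beta>))"
  show "K * \<bar>y\<bar> powr \<beta> \<le> \<eta> * y\<^sup>2 + K * x0 powr \<beta>"
  proof (cases "\<bar>y\<bar> \<le> x0")
    case True
    then have "\<bar>y\<bar> powr \<beta> \<le> x0 powr \<beta>" using assms by (intro powr_mono2) auto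
    then have "K * \<bar>y\<bar> powr \<beta> \<le> K * x0 powr \<beta>" using assms by simp
    moreover have "0 \<le> \<eta> * y\<^sup>2" using assms by simp
    ultimately show ?thesis by linarith
  next
    case False
    have x0: "0 < x0" using assms by (simp add: x0_def)
    have "K / \<eta> = x0 powr (2 - \<beta>)" using assms by (simp add: x0_def powr_powr)
    also have "\<dots> \<le> \<bar>y\<bar> powr (2 - \<beta>)" using False assms x0 by (intro powr_mono2) auto
    finally have "K \<le> \<eta> * \<bar>y\<bar> powr (2 - \<beta>)" using assms by (simp add: field_simps)
    then have "K * \<bar>y\<bar> powr \<beta> \<le> \<eta> * \<bar>y\<bar> powr (2 - \<beta>) * \<bar>y\<bar> powr \<beta>" by (rule mult_right_mono) simp
    also have "\<dots> = \<eta> * \<bar>y\<bar> powr 2" by (simp add: mult.assoc powr_add[symmetric])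
    also have "\<dots> = \<eta> * y\<^sup>2" using False x0 by (simp add: powr_numeral)
    finally show ?thesis using assms by (simp add: add_increasing2)
  qed
qed

lemma convex_exp_square:
  fixes c :: real
  assumes "c \<ge> 0"
  shows "convex_on UNIV (\<lambda>x. exp (c * x\<^sup>2))"
proof (rule convex_onI)
  fix t x y :: real
  assume t: "0 < t" "t < 1"
  have "((1 - t) *\<^sub>R x + t *\<^sub>R y)\<^sup>2 \<le> (1 - t) * x\<^sup>2 + t * y\<^sup>2"
    using convex_onD[OF convex_power2, of t x y] t by simp
  then have "c * ((1 - t) *\<^sub>R x + t *\<^sub>R y)\<^sup>2 \<le> c * ((1 - t) * x\<^sup>2 + t * y\<^sup>2)"
    using assms by (rule mult_left_mono)
  then have "exp (c * ((1 - t) *\<^sub>R x + t *\<^sub>R y)\<^sup>2) \<le> exp ((1 - t) *\<^sub>R (c * x\<^sup>2) + t *\<^sub>R (c * y\<^sup>2))"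
    by (simp add: algebra_simps)
  also have "\<dots> \<le> (1 - t) * exp (c * x\<^sup>2) + t * exp (c * y\<^sup>2)"
    using convex_onD[OF exp_convex, of t "c * x\<^sup>2" "c * y\<^sup>2"] t by simp
  finally show "exp (c * ((1 - t) *\<^sub>R x + t *\<^sub>R y)\<^sup>2) \<le> (1 - t) * exp (c * x\<^sup>2) + t * exp (c * y\<^sup>2)" .
qed simp

subsection \<open>Moments\<close>

locale ou_process = brownian +
  fixes \<nu> \<kappa> \<theta> y0 :: real and Y :: "real \<Rightarrow> 'a \<Rightarrow> real"
  assumes \<nu>_pos: "\<nu> > 0" and ou: "ou_solution M T \<nu> \<kappa> \<theta> y0 W Y"
begin

text \<open>A version of \<open>Y\<close> that is adapted for every outcome; \<open>Y\<close> itself coincides with it only almost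
  surely, hence is adapted only up to null sets.\<close>

definition Y_past :: "real \<Rightarrow> 'a \<Rightarrow> real" where
  "Y_past t \<omega> = ou_path \<nu> \<kappa> \<theta> y0 (\<lambda>s. W s \<omega> - W 0 \<omega>) t"

lemma Y_measurable: "t \<in> {0..T} \<Longrightarrow> Y t \<in> borel_measurable M"
  using ou by (simp add: ou_solution_def)

lemma Y_past_measurable_past:
  assumes "0 \<le> t" "t \<le> a"
  shows "Y_past t \<in> borel_measurable (past a)"
proof -
  have "(\<lambda>\<omega>. W s \<omega> - W 0 \<omega>) \<in> borel_measurable (past a)" if "s \<in> {0..t}" for s
    using that assms by (intro past_measurable) auto
  from ou_path_measurable[OF assms(1) this] show ?thesis unfolding Y_past_def[abs_def] .
qed

lemma Y_past_measurable: "t \<in> {0..T} \<Longrightarrow> Y_past t \<in> borel_measurable M"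
  using measurable_from_subalg[OF subalgebra_past[of T] Y_past_measurable_past[of t T]] by auto

lemma AE_paths:
  "AE \<omega> in M. W 0 \<omega> = 0 \<and> continuous_on {0..T} (\<lambda>t. W t \<omega>) \<and> continuous_on {0..T} (\<lambda>t. Y t \<omega>) \<and>
     (\<forall>t\<in>{0..T}. Y t \<omega> = Y_past t \<omega>) \<and>
     (\<forall>t\<in>{0..T}. Y t \<omega> = y0 + \<nu> * W t \<omega> + (LBINT s=ereal 0..ereal t. \<kappa> * (\<theta> - Y s \<omega>)))"
proof -
  have W: "AE \<omega> in M. W 0 \<omega> = 0" "AE \<omega> in M. continuous_on {0..T} (\<lambda>t. W t \<omega>)"
    using brownian by (simp_all add: brownian_motion_def)
  have Y: "AE \<omega> in M. continuous_on {0..T} (\<lambda>t. Y t \<omega>) \<and>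
        (\<forall>t\<in>{0..T}. Y t \<omega> = y0 + \<nu> * W t \<omega> + (LBINT s=ereal 0..ereal t. \<kappa> * (\<theta> - Y s \<omega>)))"
    using ou by (simp add: ou_solution_def)
  from W Y show ?thesis
  proof eventually_elim
    case (elim \<omega>)
    have "Y t \<omega> = Y_past t \<omega>" if "t \<in> {0..T}" for t
    proof -
      have "Y t \<omega> = ou_path \<nu> \<kappa> \<theta> y0 (\<lambda>s. W s \<omega>) t"
        using elim by (intro ou_solution_explicit[OF _ _ _ that]) auto
      then show ?thesis using elim by (simp add: Y_past_def)
    qed
    then show ?case using elim by blast
  qed
qed

text \<open>The explicit solution bounds \<open>\<bar>Y t\<bar>\<close> by a constant, a multiple of \<open>\<bar>W t - W 0\<bar>\<close> and a multiple of a
  time average \<open>G\<close> of Gaussian variables. The function \<open>x \<mapsto> exp (c x\<^sup>2)\<close> is convex, so the average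
  inherits the exponential moment of its terms.\<close>

lemma Y_exp_square_moment:
  "\<exists>\<eta>>0. \<exists>C. \<forall>t\<in>{0..T}. (\<integral>\<^sup>+\<omega>. ennreal (exp (\<eta> * (Y t \<omega>)\<^sup>2)) \<partial>M) \<le> ennreal C"
proof -
  define D where "D = exp (\<bar>\<kappa>\<bar> * T)"
  define L where "L = \<bar>\<kappa>\<bar> * D * T"
  \<comment> \<open>The rate \<open>\<eta>\<close> is small enough for both Gaussian exponents that occur below.\<close>
  define q where "q = 4 * T * (6 * \<nu>\<^sup>2 + 12 * L\<^sup>2 * D\<^sup>2 * \<nu>\<^sup>2 + 1)"
  define \<eta> where "\<eta> = 1 / q"
  define E where "E = exp (12 * \<eta> * L\<^sup>2 * D\<^sup>2 * (y0 - \<theta>)\<^sup>2)"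
  have D1: "D \<ge> 1" using T_pos by (simp add: D_def)
  have L0: "L \<ge> 0" using T_pos D1 by (simp add: L_def)
  have q0: "q > 0" unfolding q_def using T_pos by (intro mult_pos_pos add_nonneg_pos) auto
  have \<eta>: "\<eta> > 0" using q0 by (simp add: \<eta>_def)
  have \<eta>q: "\<eta> * q = 1" using q0 by (simp add: \<eta>_def)
  have e1: "6 * \<eta> * \<nu>\<^sup>2 * T \<le> 1 / 4" and e2: "12 * \<eta> * L\<^sup>2 * D\<^sup>2 * \<nu>\<^sup>2 * T \<le> 1 / 4"
  proof -
    have "4 * (6 * \<eta> * \<nu>\<^sup>2 * T) + 4 * (12 * \<eta> * L\<^sup>2 * D\<^sup>2 * \<nu>\<^sup>2 * T) + 4 * \<eta> * T = 1"
      using \<eta>q by (simp add: q_def algebra_simps)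
    moreover have "0 \<le> 6 * \<eta> * \<nu>\<^sup>2 * T" "0 \<le> 12 * \<eta> * L\<^sup>2 * D\<^sup>2 * \<nu>\<^sup>2 * T" "0 \<le> 4 * \<eta> * T"
      using \<eta> T_pos by auto
    ultimately show "6 * \<eta> * \<nu>\<^sup>2 * T \<le> 1 / 4" "12 * \<eta> * L\<^sup>2 * D\<^sup>2 * \<nu>\<^sup>2 * T \<le> 1 / 4" by linarith+
  qed
  have expW: "(\<integral>\<^sup>+\<omega>. ennreal (exp (l * (W s \<omega> - W 0 \<omega>)\<^sup>2)) \<partial>M) \<le> ennreal (sqrt 2)"
    if "s \<in> {0..T}" "l * T \<le> 1 / 4" "0 \<le> l" for s l
  proof (rule W_increment_exp_square)
    have "l * (s - 0) \<le> l * T" using that by (intro mult_left_mono) auto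
    then show "l * (s - 0) \<le> 1 / 4" using that by simp
  qed (use that in auto)
  define z where "z s \<omega> = exp (\<kappa> * s) * (y0 - \<theta> + \<nu> * (W s \<omega> - W 0 \<omega>))" for s \<omega>
  define G where "G t \<omega> = path_mean 0 t (\<lambda>s. z s \<omega>)" for t \<omega>
  have zM: "z s \<in> borel_measurable M" if "s \<in> {0..T}" for s
    unfolding z_def using W_measurable[OF that] W_measurable[of 0] that by simp
  have GM: "G t \<in> borel_measurable M" if "t \<in> {0..T}" for t
    unfolding G_def using that zM by (intro path_mean_measurable) auto
  have expz: "(\<integral>\<^sup>+\<omega>. ennreal (exp (6 * \<eta> * L\<^sup>2 * (z s \<omega>)\<^sup>2)) \<partial>M) \<le> ennreal (E * sqrt 2)" if s: "s \<in> {0..T}" for s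
  proof -
    have "exp (6 * \<eta> * L\<^sup>2 * (z s \<omega>)\<^sup>2) \<le> E * exp (12 * \<eta> * L\<^sup>2 * D\<^sup>2 * \<nu>\<^sup>2 * (W s \<omega> - W 0 \<omega>)\<^sup>2)" for \<omega>
    proof -
      define v where "v = W s \<omega> - W 0 \<omega>"
      have "\<kappa> * s \<le> \<bar>\<kappa>\<bar> * T" using s by (intro mult_mono) auto
      then have "exp (\<kappa> * s) \<le> D" by (simp add: D_def)
      then have "(exp (\<kappa> * s))\<^sup>2 \<le> D\<^sup>2" by (intro power_mono) auto
      moreover have "(y0 - \<theta> + \<nu> * v)\<^sup>2 \<le> 2 * (y0 - \<theta>)\<^sup>2 + 2 * \<nu>\<^sup>2 * v\<^sup>2"
        using zero_le_power2[of "y0 - \<theta> - \<nu> * v"]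
        by (simp add: power2_sum power2_diff[of _ "\<nu> * v"] power_mult_distrib)
      ultimately have "(z s \<omega>)\<^sup>2 \<le> D\<^sup>2 * (2 * (y0 - \<theta>)\<^sup>2 + 2 * \<nu>\<^sup>2 * v\<^sup>2)"
        unfolding z_def v_def[symmetric] power_mult_distrib by (intro mult_mono) auto
      then have "6 * \<eta> * L\<^sup>2 * (z s \<omega>)\<^sup>2 \<le> 6 * \<eta> * L\<^sup>2 * (D\<^sup>2 * (2 * (y0 - \<theta>)\<^sup>2 + 2 * \<nu>\<^sup>2 * v\<^sup>2))"
        using \<eta> by (intro mult_left_mono) auto
      also have "\<dots> = 12 * \<eta> * L\<^sup>2 * D\<^sup>2 * (y0 - \<theta>)\<^sup>2 + 12 * \<eta> * L\<^sup>2 * D\<^sup>2 * \<nu>\<^sup>2 * v\<^sup>2"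
        by (simp add: algebra_simps)
      finally show ?thesis unfolding E_def v_def[symmetric] exp_add[symmetric] exp_le_cancel_iff .
    qed
    then have "(\<integral>\<^sup>+\<omega>. ennreal (exp (6 * \<eta> * L\<^sup>2 * (z s \<omega>)\<^sup>2)) \<partial>M)
        \<le> (\<integral>\<^sup>+\<omega>. ennreal E * ennreal (exp (12 * \<eta> * L\<^sup>2 * D\<^sup>2 * \<nu>\<^sup>2 * (W s \<omega> - W 0 \<omega>)\<^sup>2)) \<partial>M)"
      by (intro nn_integral_mono) (auto simp: ennreal_mult'[symmetric] E_def intro!: ennreal_leI)
    also have "\<dots> = ennreal E * (\<integral>\<^sup>+\<omega>. ennreal (exp (12 * \<eta> * L\<^sup>2 * D\<^sup>2 * \<nu>\<^sup>2 * (W s \<omega> - W 0 \<omega>)\<^sup>2)) \<partial>M)"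
      using W_measurable[OF s] W_measurable[of 0] s by (intro nn_integral_cmult) auto
    also have "\<dots> \<le> ennreal E * ennreal (sqrt 2)"
      using s e2 \<eta> by (intro mult_left_mono expW) auto
    also have "\<dots> = ennreal (E * sqrt 2)" by (simp add: ennreal_mult' E_def)
    finally show ?thesis .
  qed
  have expG: "(\<integral>\<^sup>+\<omega>. ennreal (exp (6 * \<eta> * L\<^sup>2 * (G t \<omega>)\<^sup>2)) \<partial>M) \<le> ennreal (E * sqrt 2)" if t: "t \<in> {0..T}" for t
    unfolding G_def
  proof (rule nn_integral_path_mean_convex[where C=UNIV and \<phi>="\<lambda>x. exp (6 * \<eta> * L\<^sup>2 * x\<^sup>2)"])
    show "convex_on UNIV (\<lambda>x. exp (6 * \<eta> * L\<^sup>2 * x\<^sup>2))" using \<eta> by (intro convex_exp_square) auto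
    show "AE \<omega> in M. continuous_on {0..t} (\<lambda>s. z s \<omega>) \<and> (\<forall>s\<in>{0..t}. z s \<omega> \<in> UNIV)"
      using AE_paths
    proof eventually_elim
      case (elim \<omega>)
      then have "continuous_on {0..t} (\<lambda>t. W t \<omega>)" using t by (elim conjE continuous_on_subset) auto
      then show ?case unfolding z_def by (auto intro!: continuous_intros)
    qed
  qed (use t zM expz in \<open>auto intro!: continuous_intros\<close>)
  define C where "C = exp (3 * \<eta> * y0\<^sup>2) * (sqrt 2 + E * sqrt 2)"
  have "(\<integral>\<^sup>+\<omega>. ennreal (exp (\<eta> * (Y t \<omega>)\<^sup>2)) \<partial>M) \<le> ennreal C" if t: "t \<in> {0..T}" for t
  proof -
    have [measurable]: "W t \<in> borel_measurable M" "W 0 \<in> borel_measurable M" "G t \<in> borel_measurable M"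
      using t W_measurable GM by auto
    have "AE \<omega> in M. exp (\<eta> * (Y t \<omega>)\<^sup>2)
      \<le> exp (3 * \<eta> * y0\<^sup>2) * (exp (6 * \<eta> * \<nu>\<^sup>2 * (W t \<omega> - W 0 \<omega>)\<^sup>2) + exp (6 * \<eta> * L\<^sup>2 * (G t \<omega>)\<^sup>2))"
      using AE_paths
    proof eventually_elim
      case (elim \<omega>)
      define v where "v = W t \<omega> - W 0 \<omega>"
      define g where "g = \<kappa> * exp (- (\<kappa> * t)) * (t * G t \<omega>)"
      have Yt: "Y t \<omega> = y0 + \<nu> * v - g" using elim t by (simp add: Y_past_def ou_path_def G_def z_def v_def g_def)
      have "(y0 + \<nu> * v - g)\<^sup>2 \<le> 3 * y0\<^sup>2 + 3 * \<nu>\<^sup>2 * v\<^sup>2 + 3 * g\<^sup>2"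
        using zero_le_power2[of "y0 - \<nu> * v"] zero_le_power2[of "y0 + g"] zero_le_power2[of "\<nu> * v + g"]
        by (simp add: power2_eq_square algebra_simps)
      moreover have "g\<^sup>2 \<le> L\<^sup>2 * (G t \<omega>)\<^sup>2"
      proof -
        have "- (\<kappa> * t) \<le> \<bar>\<kappa>\<bar> * T"
          using t by (simp only: mult_minus_left[symmetric], intro mult_mono) auto
        then have "exp (- (\<kappa> * t)) \<le> D" by (simp add: D_def)
        then have "\<bar>\<kappa>\<bar> * exp (- (\<kappa> * t)) * t \<le> \<bar>\<kappa>\<bar> * D * T" using t D1 by (intro mult_mono) auto
        then have "\<bar>\<kappa>\<bar> * exp (- (\<kappa> * t)) * t * \<bar>G t \<omega>\<bar> \<le> L * \<bar>G t \<omega>\<bar>"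
          unfolding L_def by (rule mult_right_mono) simp
        moreover have "\<bar>g\<bar> = \<bar>\<kappa>\<bar> * exp (- (\<kappa> * t)) * t * \<bar>G t \<omega>\<bar>" using t by (simp add: g_def abs_mult)
        ultimately have "\<bar>g\<bar> \<le> \<bar>L * G t \<omega>\<bar>" using L0 by (simp add: abs_mult)
        then show ?thesis using abs_le_square_iff[of g "L * G t \<omega>"] by (simp add: power_mult_distrib)
      qed
      ultimately have "(y0 + \<nu> * v - g)\<^sup>2 \<le> 3 * y0\<^sup>2 + 3 * \<nu>\<^sup>2 * v\<^sup>2 + 3 * (L\<^sup>2 * (G t \<omega>)\<^sup>2)" by linarith
      with Yt have "(Y t \<omega>)\<^sup>2 \<le> 3 * y0\<^sup>2 + 3 * \<nu>\<^sup>2 * v\<^sup>2 + 3 * (L\<^sup>2 * (G t \<omega>)\<^sup>2)" by simp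
      then have "\<eta> * (Y t \<omega>)\<^sup>2 \<le> \<eta> * (3 * y0\<^sup>2 + 3 * \<nu>\<^sup>2 * v\<^sup>2 + 3 * (L\<^sup>2 * (G t \<omega>)\<^sup>2))"
        using \<eta> by (intro mult_left_mono) auto
      also have "\<dots> = 3 * \<eta> * y0\<^sup>2 + (3 * \<eta> * \<nu>\<^sup>2 * v\<^sup>2 + 3 * \<eta> * L\<^sup>2 * (G t \<omega>)\<^sup>2)" by (simp add: algebra_simps)
      finally have "exp (\<eta> * (Y t \<omega>)\<^sup>2) \<le> exp (3 * \<eta> * y0\<^sup>2) * exp (3 * \<eta> * \<nu>\<^sup>2 * v\<^sup>2 + 3 * \<eta> * L\<^sup>2 * (G t \<omega>)\<^sup>2)"
        by (simp add: exp_add[symmetric])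
      moreover have "exp (a + b) \<le> exp (2 * a) + exp (2 * b)" for a b :: real
      proof (cases "a \<le> b")
        case True
        then have "exp (a + b) \<le> exp (2 * b)" by simp
        then show ?thesis by (simp add: add_increasing)
      next
        case False
        then have "exp (a + b) \<le> exp (2 * a)" by simp
        then show ?thesis by (simp add: add_increasing2)
      qed
      from mult_left_mono[OF this[of "3 * \<eta> * \<nu>\<^sup>2 * v\<^sup>2" "3 * \<eta> * L\<^sup>2 * (G t \<omega>)\<^sup>2"], of "exp (3 * \<eta> * y0\<^sup>2)"]
      have "exp (3 * \<eta> * y0\<^sup>2) * exp (3 * \<eta> * \<nu>\<^sup>2 * v\<^sup>2 + 3 * \<eta> * L\<^sup>2 * (G t \<omega>)\<^sup>2)
        \<le> exp (3 * \<eta> * y0\<^sup>2) * (exp (6 * \<eta> * \<nu>\<^sup>2 * v\<^sup>2) + exp (6 * \<eta> * L\<^sup>2 * (G t \<omega>)\<^sup>2))"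
        by (simp add: mult.assoc[symmetric])
      ultimately show ?case unfolding v_def by linarith
    qed
    then have "(\<integral>\<^sup>+\<omega>. ennreal (exp (\<eta> * (Y t \<omega>)\<^sup>2)) \<partial>M)
      \<le> (\<integral>\<^sup>+\<omega>. ennreal (exp (3 * \<eta> * y0\<^sup>2)) * (ennreal (exp (6 * \<eta> * \<nu>\<^sup>2 * (W t \<omega> - W 0 \<omega>)\<^sup>2)) + ennreal (exp (6 * \<eta> * L\<^sup>2 * (G t \<omega>)\<^sup>2))) \<partial>M)"
      by (intro nn_integral_mono_AE) (auto elim!: eventually_mono intro!: ennreal_leI
        simp: ennreal_mult'[symmetric] ennreal_plus[symmetric] simp del: ennreal_plus)
    also have "\<dots> = ennreal (exp (3 * \<eta> * y0\<^sup>2)) * ((\<integral>\<^sup>+\<omega>. ennreal (exp (6 * \<eta> * \<nu>\<^sup>2 * (W t \<omega> - W 0 \<omega>)\<^sup>2)) \<partial>M)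
        + (\<integral>\<^sup>+\<omega>. ennreal (exp (6 * \<eta> * L\<^sup>2 * (G t \<omega>)\<^sup>2)) \<partial>M))"
      by (simp add: nn_integral_cmult nn_integral_add)
    also have "\<dots> \<le> ennreal (exp (3 * \<eta> * y0\<^sup>2)) * (ennreal (sqrt 2) + ennreal (E * sqrt 2))"
      using t e1 \<eta> by (intro mult_left_mono add_mono expW expG) auto
    also have "\<dots> = ennreal C" by (simp add: C_def ennreal_mult' E_def)
    finally show ?thesis .
  qed
  with \<eta> show ?thesis by blast
qed

lemma Y_growth_moments:
  assumes \<beta>: "0 \<le> \<beta>" "\<beta> < 2" and g: "exp_growth \<beta> g" "g \<in> borel_measurable borel"
  shows "unif_moments M {0..T} (\<lambda>t \<omega>. g (Y t \<omega>))"
proof -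
  obtain \<eta> C where \<eta>: "\<eta> > 0" "\<And>t. t \<in> {0..T} \<Longrightarrow> (\<integral>\<^sup>+\<omega>. ennreal (exp (\<eta> * (Y t \<omega>)\<^sup>2)) \<partial>M) \<le> ennreal C"
    using Y_exp_square_moment by blast
  obtain K where K: "K > 0" "\<And>y. \<bar>g y\<bar> \<le> K * exp (K * \<bar>y\<bar> powr \<beta>)"
    using g unfolding exp_growth_def by blast
  have gY[measurable]: "(\<lambda>\<omega>. g (Y t \<omega>)) \<in> borel_measurable M" if "t \<in> {0..T}" for t
    using measurable_compose[OF Y_measurable[OF that] g(2)] .
  show ?thesis
    unfolding unif_moments_def
  proof (intro conjI allI ballI)
    fix n :: nat
    define L where "L = (real n + 1) * K"
    obtain D where D: "\<And>y. L * \<bar>y\<bar> powr \<beta> \<le> \<eta> * y\<^sup>2 + D"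
      using powr_le_square[OF \<beta>, of L \<eta>] \<eta> K by (auto simp: L_def)
    have pt: "\<bar>g y\<bar> ^ n \<le> K ^ n * exp D * exp (\<eta> * y\<^sup>2)" for y
    proof -
      have "\<bar>g y\<bar> ^ n \<le> (K * exp (K * \<bar>y\<bar> powr \<beta>)) ^ n" by (intro power_mono K) auto
      also have "\<dots> = K ^ n * exp (real n * (K * \<bar>y\<bar> powr \<beta>))" by (simp add: power_mult_distrib exp_of_nat_mult)
      also have "real n * (K * \<bar>y\<bar> powr \<beta>) \<le> L * \<bar>y\<bar> powr \<beta>" using K by (simp add: L_def algebra_simps)
      also have "\<dots> \<le> D + \<eta> * y\<^sup>2" using D[of y] by simp
      finally show ?thesis using K by (simp add: exp_add mult.assoc)
    qed
    have "(\<integral>\<^sup>+\<omega>. ennreal (\<bar>g (Y t \<omega>)\<bar> ^ n) \<partial>M) \<le> ennreal (K ^ n * exp D * C)" if t: "t \<in> {0..T}" for t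
    proof -
      have "(\<integral>\<^sup>+\<omega>. ennreal (\<bar>g (Y t \<omega>)\<bar> ^ n) \<partial>M) \<le> (\<integral>\<^sup>+\<omega>. ennreal (K ^ n * exp D) * ennreal (exp (\<eta> * (Y t \<omega>)\<^sup>2)) \<partial>M)"
        using pt K by (intro nn_integral_mono) (auto simp: ennreal_mult'[symmetric] intro!: ennreal_leI)
      also have "\<dots> = ennreal (K ^ n * exp D) * (\<integral>\<^sup>+\<omega>. ennreal (exp (\<eta> * (Y t \<omega>)\<^sup>2)) \<partial>M)"
        using Y_measurable[OF t] by (intro nn_integral_cmult) auto
      also have "\<dots> \<le> ennreal (K ^ n * exp D) * ennreal C" by (intro mult_left_mono \<eta>(2) t) auto
      also have "\<dots> = ennreal (K ^ n * exp D * C)" using K by (simp add: ennreal_mult')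
      finally show ?thesis .
    qed
    then show "\<exists>C. \<forall>t\<in>{0..T}. (\<integral>\<^sup>+\<omega>. ennreal (\<bar>g (Y t \<omega>)\<bar> ^ n) \<partial>M) \<le> ennreal C" by blast
  qed (rule gY)
qed

subsection \<open>Increments and Taylor remainders\<close>

text \<open>Multiplied by the length of the interval, this is the part of the increment of \<open>Y\<close> that is not noise.\<close>

definition drift_mean :: "real \<times> real \<Rightarrow> 'a \<Rightarrow> real" where
  "drift_mean = (\<lambda>(a, s) \<omega>. path_mean a s (\<lambda>u. \<kappa> * (\<theta> - Y u \<omega>)))"

lemma drift_mean_moments: "unif_moments M {(a, s). 0 \<le> a \<and> a \<le> s \<and> s \<le> T} drift_mean"
proof -
  have "exp_growth 1 (\<lambda>y. \<kappa> * \<theta> + - \<kappa> * y)"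
    by (intro exp_growth_add exp_growth_mult exp_growth_const exp_growth_id) simp
  then have "unif_moments M {0..T} (\<lambda>t \<omega>. \<kappa> * (\<theta> - Y t \<omega>))"
    using Y_growth_moments[of 1 "\<lambda>y. \<kappa> * \<theta> + - \<kappa> * y"] by (simp add: algebra_simps)
  from unif_moments_reindex[OF this, of "{(i, u). i \<in> {(a, s). 0 \<le> a \<and> a \<le> s \<and> s \<le> T} \<and> u \<in> {fst i..snd i}}" snd]
  have "unif_moments M {(i, u). i \<in> {(a, s). 0 \<le> a \<and> a \<le> s \<and> s \<le> T} \<and> u \<in> {fst i..snd i}} (\<lambda>(i, u) \<omega>. \<kappa> * (\<theta> - Y u \<omega>))"
    by (auto simp: case_prod_beta')
  then have "unif_moments M {(a, s). 0 \<le> a \<and> a \<le> s \<and> s \<le> T} (\<lambda>i \<omega>. path_mean (fst i) (snd i) (\<lambda>u. \<kappa> * (\<theta> - Y u \<omega>)))"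
  proof (rule unif_moments_path_mean)
    fix i assume i: "i \<in> {(a, s). 0 \<le> a \<and> a \<le> s \<and> s \<le> T}"
    show "AE \<omega> in M. continuous_on {fst i..snd i} (\<lambda>u. \<kappa> * (\<theta> - Y u \<omega>))"
      using AE_paths
    proof eventually_elim
      case (elim \<omega>)
      then have "continuous_on {fst i..snd i} (\<lambda>t. Y t \<omega>)" using i by (elim conjE continuous_on_subset) auto
      then show ?case by (intro continuous_intros)
    qed
  qed auto
  then show ?thesis by (simp add: drift_mean_def case_prod_beta')
qed

lemma AE_increment:
  "AE \<omega> in M. \<forall>a s. 0 \<le> a \<and> a \<le> s \<and> s \<le> T \<longrightarrow>
     Y s \<omega> - Y a \<omega> = \<nu> * (W s \<omega> - W a \<omega>) + (s - a) * drift_mean (a, s) \<omega>"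
  using AE_paths
proof eventually_elim
  case (elim \<omega>)
  define m where "m u = \<kappa> * (\<theta> - Y u \<omega>)" for u
  have "continuous_on {0..T} (\<lambda>u. Y u \<omega>)" using elim by blast
  then have cm: "continuous_on {0..T} m"
    unfolding m_def by (intro continuous_intros)
  have eq: "Y t \<omega> = y0 + \<nu> * W t \<omega> + integral {0..t} m" if "t \<in> {0..T}" for t
  proof -
    have "continuous_on {0..t} m" using that by (intro continuous_on_subset[OF cm]) auto
    then have "(LBINT s=ereal 0..ereal t. m s) = integral {0..t} m"
      using that by (intro interval_integral_eq_integral borel_integrable_atLeastAtMost') auto
    moreover have "Y t \<omega> = y0 + \<nu> * W t \<omega> + (LBINT s=ereal 0..ereal t. m s)"
      using elim that unfolding m_def by blast
    ultimately show ?thesis by simp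
  qed
  show ?case
  proof (intro allI impI)
    fix a s assume as: "0 \<le> a \<and> a \<le> s \<and> s \<le> T"
    have "m integrable_on {0..s}" using as by (intro integrable_continuous_real continuous_on_subset[OF cm]) auto
    then have "integral {0..a} m + integral {a..s} m = integral {0..s} m"
      using as by (intro Henstock_Kurzweil_Integration.integral_combine) auto
    moreover have "(s - a) * path_mean a s m = integral {a..s} m"
      using as by (intro path_mean_integral continuous_on_subset[OF cm]) auto
    moreover have "drift_mean (a, s) \<omega> = path_mean a s m"
      by (simp only: drift_mean_def m_def[abs_def] split_conv)
    moreover have "\<nu> * (W s \<omega> - W a \<omega>) = \<nu> * W s \<omega> - \<nu> * W a \<omega>" by (rule right_diff_distrib)
    ultimately show "Y s \<omega> - Y a \<omega> = \<nu> * (W s \<omega> - W a \<omega>) + (s - a) * drift_mean (a, s) \<omega>"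
      using eq[of a] eq[of s] as by simp
  qed
qed

text \<open>The error of the linearisation in which only the noise part of the increment of \<open>Y\<close> is kept. This
  takes the place of a stochastic expansion: it is of the order of the time step, and it is
  defined outcome by outcome.\<close>

definition remainder :: "(real \<Rightarrow> real) \<Rightarrow> (real \<Rightarrow> real) \<Rightarrow> real \<Rightarrow> real \<Rightarrow> 'a \<Rightarrow> real" where
  "remainder g g' a s \<omega> = g (Y s \<omega>) - g (Y a \<omega>) - \<nu> * g' (Y a \<omega>) * (W s \<omega> - W a \<omega>)"

text \<open>Taylor's formula leaves \<open>g''\<close> at an intermediate point times the squared increment of \<open>Y\<close>, and
  \<open>g'\<close> times its drift part; both are of the order of \<open>s - a\<close>. The intermediate point lies between
  \<open>Y a\<close> and \<open>Y s\<close>, and the growth bound is monotone in \<open>\<bar>y\<bar>\<close>, so moments at the two end points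
  suffice. At \<open>s = a\<close> the quotient is \<open>0\<close>.\<close>

lemma remainder_moments:
  fixes g g' g'' :: "real \<Rightarrow> real"
  assumes \<beta>: "0 \<le> \<beta>" "\<beta> < 2"
    and g: "\<And>y. (g has_real_derivative g' y) (at y)" and g': "\<And>y. (g' has_real_derivative g'' y) (at y)"
    and growth: "exp_growth \<beta> g'" "exp_growth \<beta> g''"
  shows "unif_moments M {(a, s). 0 \<le> a \<and> a \<le> s \<and> s \<le> T} (\<lambda>(a, s) \<omega>. remainder g g' a s \<omega> / (s - a))"
proof -
  let ?I = "{(a, s). 0 \<le> a \<and> a \<le> s \<and> s \<le> T}"
  have gc: "continuous_on UNIV g" "continuous_on UNIV g'"
    using g g' by (auto intro!: DERIV_continuous_on)
  have gm: "g \<in> borel_measurable borel" "g' \<in> borel_measurable borel"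
    using gc by (auto intro: borel_measurable_continuous_onI)
  obtain K where K: "K > 0" "\<And>y. \<bar>g'' y\<bar> \<le> K * exp (K * \<bar>y\<bar> powr \<beta>)"
    using growth unfolding exp_growth_def by blast
  define \<Phi> where "\<Phi> y = K * exp (K * \<bar>y\<bar> powr \<beta>)" for y
  have \<Phi>: "exp_growth \<beta> \<Phi>" "\<Phi> \<in> borel_measurable borel"
    unfolding \<Phi>_def using K by (auto intro!: exp_growthI[of _ K K])
  define N where "N = (\<lambda>(a, s) \<omega>. (W s \<omega> - W a \<omega>) / sqrt (s - a))"
  have N: "unif_moments M ?I N" unfolding N_def by (rule W_increment_moments)
  have \<Phi>s: "unif_moments M ?I (\<lambda>i \<omega>. \<Phi> (Y (snd i) \<omega>))" and \<Phi>a: "unif_moments M ?I (\<lambda>i \<omega>. \<Phi> (Y (fst i) \<omega>))"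
    and g'a: "unif_moments M ?I (\<lambda>i \<omega>. g' (Y (fst i) \<omega>))"
    using unif_moments_reindex[OF Y_growth_moments[OF \<beta> \<Phi>], of ?I snd]
      unif_moments_reindex[OF Y_growth_moments[OF \<beta> \<Phi>], of ?I fst]
      unif_moments_reindex[OF Y_growth_moments[OF \<beta> growth(1) gm(2)], of ?I fst] by auto
  show ?thesis
  proof (rule unif_moments_dominated)
    show "unif_moments M ?I (\<lambda>i \<omega>. (\<Phi> (Y (snd i) \<omega>) + \<Phi> (Y (fst i) \<omega>)) * (2 * \<nu>\<^sup>2 * N i \<omega> ^ 2 + 2 * T * drift_mean i \<omega> ^ 2)
        + \<bar>g' (Y (fst i) \<omega>)\<bar> * \<bar>drift_mean i \<omega>\<bar>)"
      by (intro unif_moments_add unif_moments_mult unif_moments_power unif_moments_abs N \<Phi>s \<Phi>a g'a drift_mean_moments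
          unif_moments_constant)
    fix i assume "i \<in> ?I"
    then obtain a s where i: "i = (a, s)" and as: "0 \<le> a" "a \<le> s" "s \<le> T" by auto
    have [measurable]: "Y s \<in> borel_measurable M" "Y a \<in> borel_measurable M" "W s \<in> borel_measurable M" "W a \<in> borel_measurable M"
      using as Y_measurable W_measurable by auto
    note gm[measurable]
    show "(case i of (a, s) \<Rightarrow> \<lambda>\<omega>. remainder g g' a s \<omega> / (s - a)) \<in> borel_measurable M"
      unfolding i remainder_def by simp
    show "AE \<omega> in M. \<bar>(case i of (a, s) \<Rightarrow> \<lambda>\<omega>. remainder g g' a s \<omega> / (s - a)) \<omega>\<bar>
      \<le> \<bar>(\<Phi> (Y (snd i) \<omega>) + \<Phi> (Y (fst i) \<omega>)) * (2 * \<nu>\<^sup>2 * N i \<omega> ^ 2 + 2 * T * drift_mean i \<omega> ^ 2)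
        + \<bar>g' (Y (fst i) \<omega>)\<bar> * \<bar>drift_mean i \<omega>\<bar>\<bar>"
      using AE_increment
    proof eventually_elim
      case (elim \<omega>)
      define d where "d = s - a"
      define P where "P = drift_mean (a, s) \<omega>"
      define n where "n = N (a, s) \<omega>"
      define G where "G = \<Phi> (Y s \<omega>) + \<Phi> (Y a \<omega>)"
      have d0: "0 \<le> d" "d \<le> T" using as by (auto simp: d_def)
      have \<Phi>0: "0 \<le> \<Phi> y" for y using K by (simp add: \<Phi>_def)
      have G0: "0 \<le> G" using \<Phi>0 by (simp add: G_def)
      have inc: "Y s \<omega> - Y a \<omega> = \<nu> * (W s \<omega> - W a \<omega>) + d * P"
        using elim as by (simp add: d_def P_def)
      have wn: "W s \<omega> - W a \<omega> = sqrt d * n"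
        using as by (cases "s = a") (auto simp: n_def N_def d_def)
      have seg: "\<bar>g'' y\<bar> \<le> G" if y: "y \<in> closed_segment (Y a \<omega>) (Y s \<omega>)" for y
      proof -
        have "\<bar>y\<bar> \<le> \<bar>Y s \<omega>\<bar> \<or> \<bar>y\<bar> \<le> \<bar>Y a \<omega>\<bar>"
          using y by (auto simp: closed_segment_eq_real_ivl split: if_splits)
        then have "\<Phi> y \<le> \<Phi> (Y s \<omega>) \<or> \<Phi> y \<le> \<Phi> (Y a \<omega>)"
          unfolding \<Phi>_def using K \<beta> by (auto intro!: powr_mono2)
        then have "\<Phi> y \<le> G" using \<Phi>0[of "Y s \<omega>"] \<Phi>0[of "Y a \<omega>"] by (auto simp: G_def)
        then show ?thesis using K(2)[of y] by (simp add: \<Phi>_def)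
      qed
      have tay: "\<bar>g (Y s \<omega>) - g (Y a \<omega>) - g' (Y a \<omega>) * (Y s \<omega> - Y a \<omega>)\<bar> \<le> G * (Y s \<omega> - Y a \<omega>)\<^sup>2"
        by (rule taylor2_bound[OF g g' seg])
      have sq: "(Y s \<omega> - Y a \<omega>)\<^sup>2 \<le> d * (2 * \<nu>\<^sup>2 * n\<^sup>2 + 2 * T * P\<^sup>2)"
      proof -
        have "(Y s \<omega> - Y a \<omega>)\<^sup>2 \<le> 2 * (\<nu> * (sqrt d * n))\<^sup>2 + 2 * (d * P)\<^sup>2"
          unfolding inc wn using zero_le_power2[of "\<nu> * (sqrt d * n) - d * P"] by (simp add: power2_sum power2_diff)
        also have "\<dots> = d * (2 * \<nu>\<^sup>2 * n\<^sup>2) + d * (2 * d * P\<^sup>2)"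
          using d0 by (simp add: power_mult_distrib power2_eq_square[of d])
        also have "d * (2 * d * P\<^sup>2) \<le> d * (2 * T * P\<^sup>2)"
          using d0 by (intro mult_left_mono mult_right_mono) auto
        finally show ?thesis by (simp add: distrib_left)
      qed
      have "remainder g g' a s \<omega> = (g (Y s \<omega>) - g (Y a \<omega>) - g' (Y a \<omega>) * (Y s \<omega> - Y a \<omega>)) + g' (Y a \<omega>) * (d * P)"
        unfolding remainder_def inc by (simp add: algebra_simps)
      then have "\<bar>remainder g g' a s \<omega>\<bar> \<le> G * (Y s \<omega> - Y a \<omega>)\<^sup>2 + \<bar>g' (Y a \<omega>) * (d * P)\<bar>"
        using tay by linarith
      also have "G * (Y s \<omega> - Y a \<omega>)\<^sup>2 \<le> G * (d * (2 * \<nu>\<^sup>2 * n\<^sup>2 + 2 * T * P\<^sup>2))"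
        by (intro mult_left_mono sq G0)
      also have "\<bar>g' (Y a \<omega>) * (d * P)\<bar> = d * (\<bar>g' (Y a \<omega>)\<bar> * \<bar>P\<bar>)" using d0 by (simp add: abs_mult)
      finally have le: "\<bar>remainder g g' a s \<omega>\<bar> \<le> d * (G * (2 * \<nu>\<^sup>2 * n\<^sup>2 + 2 * T * P\<^sup>2) + \<bar>g' (Y a \<omega>)\<bar> * \<bar>P\<bar>)"
        by (simp add: algebra_simps)
      define Q where "Q = G * (2 * \<nu>\<^sup>2 * n\<^sup>2 + 2 * T * P\<^sup>2) + \<bar>g' (Y a \<omega>)\<bar> * \<bar>P\<bar>"
      have Q0: "0 \<le> Q" unfolding Q_def using G0 T_pos by (intro add_nonneg_nonneg mult_nonneg_nonneg) auto
      have "\<bar>remainder g g' a s \<omega>\<bar> / d \<le> Q"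
      proof (cases "d = 0")
        case False
        then show ?thesis using le d0 unfolding Q_def[symmetric] by (simp add: divide_le_eq mult.commute)
      qed (use Q0 in simp)
      then show ?case
        using d0 Q0 unfolding i Q_def G_def P_def n_def d_def by simp
    qed
  qed
qed

lemma remainder_mean_moments:
  fixes g g' g'' :: "real \<Rightarrow> real"
  assumes \<beta>: "0 \<le> \<beta>" "\<beta> < 2"
    and g: "\<And>y. (g has_real_derivative g' y) (at y)" and g': "\<And>y. (g' has_real_derivative g'' y) (at y)"
    and growth: "exp_growth \<beta> g'" "exp_growth \<beta> g''"
  shows "unif_moments M {(a, b). 0 \<le> a \<and> a < b \<and> b \<le> T}
    (\<lambda>i \<omega>. path_mean (fst i) (snd i) (\<lambda>s. \<bar>remainder g g' (fst i) s \<omega>\<bar> / (snd i - fst i)))"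
proof (rule unif_moments_path_mean)
  let ?I = "{(a, b). 0 \<le> a \<and> a < b \<and> b \<le> T}"
  let ?J = "{(i, s). i \<in> ?I \<and> s \<in> {fst i..snd i}}"
  have gc: "continuous_on UNIV g" "continuous_on UNIV g'"
    using g g' by (auto intro!: DERIV_continuous_on)
  have gm: "g \<in> borel_measurable borel" "g' \<in> borel_measurable borel"
    using gc by (auto intro: borel_measurable_continuous_onI)
  have "unif_moments M ?J (\<lambda>j. case (fst (fst j), snd j) of (a, s) \<Rightarrow> \<lambda>\<omega>. remainder g g' a s \<omega> / (s - a))"
    by (rule unif_moments_reindex[OF remainder_moments[OF assms]]) auto
  then show "unif_moments M ?J (\<lambda>(i, s) \<omega>. \<bar>remainder g g' (fst i) s \<omega>\<bar> / (snd i - fst i))"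
  proof (rule unif_moments_dominated)
    fix j assume "j \<in> ?J"
    then obtain a b s where j: "j = ((a, b), s)" and abs: "0 \<le> a" "a < b" "b \<le> T" "a \<le> s" "s \<le> b" by auto
    have [measurable]: "Y s \<in> borel_measurable M" "Y a \<in> borel_measurable M" "W s \<in> borel_measurable M" "W a \<in> borel_measurable M"
      using abs Y_measurable W_measurable by auto
    note gm[measurable]
    show "(case j of (i, s) \<Rightarrow> \<lambda>\<omega>. \<bar>remainder g g' (fst i) s \<omega>\<bar> / (snd i - fst i)) \<in> borel_measurable M"
      unfolding j remainder_def by simp
    have "\<bar>remainder g g' a s \<omega>\<bar> / (b - a) \<le> \<bar>remainder g g' a s \<omega>\<bar> / (s - a)" for \<omega>
    proof (cases "s = a")
      case True
      then show ?thesis by (simp add: remainder_def)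
    next
      case False
      then show ?thesis using abs by (intro divide_left_mono) auto
    qed
    then show "AE \<omega> in M. \<bar>(case j of (i, s) \<Rightarrow> \<lambda>\<omega>. \<bar>remainder g g' (fst i) s \<omega>\<bar> / (snd i - fst i)) \<omega>\<bar>
      \<le> \<bar>(case (fst (fst j), snd j) of (a, s) \<Rightarrow> \<lambda>\<omega>. remainder g g' a s \<omega> / (s - a)) \<omega>\<bar>"
      unfolding j using abs by auto
  qed
  fix i assume i: "i \<in> ?I"
  show "AE \<omega> in M. continuous_on {fst i..snd i} (\<lambda>s. \<bar>remainder g g' (fst i) s \<omega>\<bar> / (snd i - fst i))"
    using AE_paths
  proof eventually_elim
    case (elim \<omega>)
    then have "continuous_on {fst i..snd i} (\<lambda>t. Y t \<omega>)" "continuous_on {fst i..snd i} (\<lambda>t. W t \<omega>)"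
      using i by (elim conjE continuous_on_subset; auto)+
    then show ?case unfolding remainder_def using i
      by (intro continuous_intros continuous_on_compose2[OF gc(1)]) auto
  qed
qed auto

end

section \<open>The drift error\<close>

lemma add_powr_le:
  fixes x y r :: real
  assumes "0 \<le> x" "0 \<le> y" "0 \<le> r"
  shows "(x + y) powr r \<le> 2 powr r * (x powr r + y powr r)"
proof -
  have "(x + y) powr r \<le> (2 * max x y) powr r" using assms by (intro powr_mono2) auto
  also have "\<dots> = 2 powr r * max x y powr r" using assms by (intro powr_mult) 
  also have "max x y powr r \<le> x powr r + y powr r" by (auto simp: max_def)
  finally show ?thesis by simp
qed

context ou_process
begin

lemma path_mean_remainder:
  assumes cY: "continuous_on {a..b} (\<lambda>s. Y s \<omega>)" and cW: "continuous_on {a..b} (\<lambda>s. W s \<omega>)"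
    and ab: "a \<le> b" and g: "continuous_on UNIV g"
  shows "path_mean a b (\<lambda>s. g (Y s \<omega>)) - g (Y a \<omega>)
    = path_mean a b (\<lambda>s. remainder g g' a s \<omega>) + \<nu> * g' (Y a \<omega>) * path_mean a b (\<lambda>s. W s \<omega> - W a \<omega>)"
proof -
  have c1: "continuous_on {a..b} (\<lambda>s. g (Y s \<omega>))" by (rule continuous_on_compose2[OF g cY]) auto
  have c2: "continuous_on {a..b} (\<lambda>s. W s \<omega> - W a \<omega>)" by (intro continuous_intros cW)
  have c3: "continuous_on {a..b} (\<lambda>s. \<nu> * g' (Y a \<omega>) * (W s \<omega> - W a \<omega>))" by (intro continuous_intros cW)
  have c4: "continuous_on {a..b} (\<lambda>s. g (Y s \<omega>) - g (Y a \<omega>))" by (intro continuous_intros c1)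
  show ?thesis
    unfolding remainder_def path_mean_diff[OF c4 c3 ab] path_mean_diff[OF c1 continuous_on_const ab]
      path_mean_cmult[OF c2 ab] path_mean_const by simp
qed

text \<open>Normalised by the step, so that its moments are bounded uniformly over all grids.\<close>

definition remainder_size :: "(real \<Rightarrow> real) \<Rightarrow> (real \<Rightarrow> real) \<Rightarrow> nat \<Rightarrow> nat \<Rightarrow> 'a \<Rightarrow> real" where
  "remainder_size g g' N l \<omega> =
     path_mean (grid T N l) (grid T N (Suc l)) (\<lambda>s. \<bar>remainder g g' (grid T N l) s \<omega>\<bar> / step T N)"

lemma AE_grid_paths:
  assumes N: "N \<ge> 1"
  shows "AE \<omega> in M. \<forall>l<N. continuous_on {grid T N l..grid T N (Suc l)} (\<lambda>s. Y s \<omega>) \<and>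
    continuous_on {grid T N l..grid T N (Suc l)} (\<lambda>s. W s \<omega>) \<and>
    (\<forall>s\<in>{grid T N l..grid T N (Suc l)}. Y s \<omega> = Y_past s \<omega>)"
  using AE_paths
proof eventually_elim
  case (elim \<omega>)
  note g = grid_facts[OF N]
  show ?case
  proof (intro allI impI)
    fix l assume "l < N"
    then have "{grid T N l..grid T N (Suc l)} \<subseteq> {0..T}" using g(4)[of l] g(5)[of "Suc l"] by auto
    then show "continuous_on {grid T N l..grid T N (Suc l)} (\<lambda>s. Y s \<omega>) \<and>
      continuous_on {grid T N l..grid T N (Suc l)} (\<lambda>s. W s \<omega>) \<and>
      (\<forall>s\<in>{grid T N l..grid T N (Suc l)}. Y s \<omega> = Y_past s \<omega>)"
      using elim continuous_on_subset by blast
  qed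
qed

lemma path_mean_remainder_le:
  assumes N: "N \<ge> 1" and c: "continuous_on {grid T N l..grid T N (Suc l)} (\<lambda>s. Y s \<omega>)"
    "continuous_on {grid T N l..grid T N (Suc l)} (\<lambda>s. W s \<omega>)" and g: "continuous_on UNIV g"
  shows "\<bar>path_mean (grid T N l) (grid T N (Suc l)) (\<lambda>s. remainder g g' (grid T N l) s \<omega>)\<bar>
    \<le> step T N * remainder_size g g' N l \<omega>"
proof -
  note gr = grid_facts[OF N]
  have cr: "continuous_on {grid T N l..grid T N (Suc l)} (\<lambda>s. remainder g g' (grid T N l) s \<omega>)"
    unfolding remainder_def by (intro continuous_intros c continuous_on_compose2[OF g c(1)]) auto
  have "\<bar>path_mean (grid T N l) (grid T N (Suc l)) (\<lambda>s. remainder g g' (grid T N l) s \<omega>)\<bar>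
      \<le> path_mean (grid T N l) (grid T N (Suc l)) (\<lambda>s. \<bar>remainder g g' (grid T N l) s \<omega>\<bar>)"
    using gr by (intro path_mean_mono_abs cr continuous_on_rabs) auto
  also have "\<dots> = step T N * remainder_size g g' N l \<omega>"
    using path_mean_cmult[OF continuous_on_rabs[OF cr] gr(3), of "1 / step T N"] gr(1)
    by (simp add: remainder_size_def)
  finally show ?thesis .
qed

lemma remainder_size_moments:
  assumes "0 \<le> \<beta>" "\<beta> < 2"
    and "\<And>y. (g has_real_derivative g' y) (at y)" and "\<And>y. (g' has_real_derivative g'' y) (at y)"
    and "exp_growth \<beta> g'" "exp_growth \<beta> g''"
  shows "unif_moments M {(N, l). 1 \<le> N \<and> l < N} (\<lambda>(N, l). remainder_size g g' N l)"
proof -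
  have base: "unif_moments M {(N, l). 1 \<le> N \<and> l < N} (\<lambda>j \<omega>. (\<lambda>i. path_mean (fst i) (snd i)
      (\<lambda>s. \<bar>remainder g g' (fst i) s \<omega>\<bar> / (snd i - fst i))) (grid T (fst j) (snd j), grid T (fst j) (Suc (snd j))))"
  proof (rule unif_moments_reindex[OF remainder_mean_moments[OF assms]])
    fix j :: "nat \<times> nat" assume "j \<in> {(N, l). 1 \<le> N \<and> l < N}"
    then have N: "1 \<le> fst j" and l: "snd j < fst j" by auto
    show "(grid T (fst j) (snd j), grid T (fst j) (Suc (snd j))) \<in> {(a, b). 0 \<le> a \<and> a < b \<and> b \<le> T}"
      using grid_facts(1)[OF N] grid_facts(2,4)[OF N, of "snd j"] grid_facts(5)[OF N, of "Suc (snd j)"] l by auto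
  qed
  then show ?thesis
  proof (rule unif_moments_dominated)
    fix j :: "nat \<times> nat" assume j: "j \<in> {(N, l). 1 \<le> N \<and> l < N}"
    then have N: "1 \<le> fst j" by auto
    have eq: "(case j of (N, l) \<Rightarrow> remainder_size g g' N l) = (\<lambda>\<omega>. (\<lambda>i. path_mean (fst i) (snd i)
      (\<lambda>s. \<bar>remainder g g' (fst i) s \<omega>\<bar> / (snd i - fst i))) (grid T (fst j) (snd j), grid T (fst j) (Suc (snd j))))"
      using grid_facts(2)[OF N] by (auto simp: remainder_size_def fun_eq_iff case_prod_beta')
    show "(case j of (N, l) \<Rightarrow> remainder_size g g' N l) \<in> borel_measurable M"
      unfolding eq using unif_moments_measurable[OF base j] by simp
    show "AE \<omega> in M. \<bar>(case j of (N, l) \<Rightarrow> remainder_size g g' N l) \<omega>\<bar> \<le> \<bar>(\<lambda>i. path_mean (fst i) (snd i)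
      (\<lambda>s. \<bar>remainder g g' (fst i) s \<omega>\<bar> / (snd i - fst i))) (grid T (fst j) (snd j), grid T (fst j) (Suc (snd j)))\<bar>"
      unfolding eq by simp
  qed
qed

text \<open>The \<open>N\<close> terms are of size \<open>step\<^sup>2\<close>, so the triangle inequality already gives the order \<open>1 / N\<close>.\<close>

lemma remainder_sum_moment:
  assumes g: "0 \<le> \<beta>" "\<beta> < 2"
    "\<And>y. (g has_real_derivative g' y) (at y)" "\<And>y. (g' has_real_derivative g'' y) (at y)"
    "exp_growth \<beta> g'" "exp_growth \<beta> g''" and p: "p \<ge> 1"
  shows "\<exists>C\<ge>0. \<forall>N\<ge>1. (\<integral>\<^sup>+\<omega>. ennreal (\<bar>\<Sum>l<N. (step T N)\<^sup>2 * remainder_size g g' N l \<omega>\<bar> powr (2 * p)) \<partial>M)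
      \<le> ennreal (C / real N powr (2 * p))"
proof -
  define m where "m = nat \<lceil>p\<rceil>"
  have m: "p \<le> real m" "m \<ge> 1" using p by (auto simp: m_def) linarith
  note U = remainder_size_moments[OF g]
  obtain K where K: "K \<ge> 0" "\<And>i. i \<in> {(N, l). 1 \<le> N \<and> l < N} \<Longrightarrow>
      (\<integral>\<^sup>+\<omega>. ennreal (\<bar>(\<lambda>(N, l). remainder_size g g' N l) i \<omega>\<bar> ^ (2 * m)) \<partial>M) \<le> ennreal K"
    using unif_momentsE[OF U] by blast
  define C where "C = (1 + K) * (T\<^sup>2) powr (2 * p)"
  have "(\<integral>\<^sup>+\<omega>. ennreal (\<bar>\<Sum>l<N. (step T N)\<^sup>2 * remainder_size g g' N l \<omega>\<bar> powr (2 * p)) \<partial>M)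
      \<le> ennreal (C / real N powr (2 * p))" if N: "N \<ge> 1" for N
  proof -
    define R where "R l = remainder_size g g' N l" for l
    define \<sigma> where "\<sigma> = T\<^sup>2 / real N"
    have \<sigma>: "\<sigma> > 0" using N T_pos by (simp add: \<sigma>_def)
    have Rm[measurable]: "R l \<in> borel_measurable M" if "l < N" for l
      using unif_moments_measurable[OF U, of "(N, l)"] N that by (simp add: R_def)
    have ER: "(\<integral>\<^sup>+\<omega>. ennreal (R l \<omega> ^ (2 * m)) \<partial>M) \<le> ennreal K" if "l < N" for l
      using K(2)[of "(N, l)"] N that by (simp add: R_def power_even_abs)
    define A where "A \<omega> = \<bar>\<Sum>l<N. (step T N)\<^sup>2 * R l \<omega>\<bar>" for \<omega>
    have Am: "A \<in> borel_measurable M"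
      unfolding A_def by (intro borel_measurable_abs borel_measurable_sum borel_measurable_times) auto
    have eq: "(A \<omega> / \<sigma>) ^ (2 * m) = ((\<Sum>l<N. R l \<omega>) / real N) ^ (2 * m)" for \<omega>
    proof -
      have "A \<omega> = (step T N)\<^sup>2 * \<bar>\<Sum>l<N. R l \<omega>\<bar>"
        by (simp add: A_def sum_distrib_left[symmetric] abs_mult)
      then have "A \<omega> / \<sigma> = \<bar>(\<Sum>l<N. R l \<omega>) / real N\<bar>"
        using N T_pos by (simp add: \<sigma>_def step_def power_divide power2_eq_square)
      then show ?thesis by (simp only: power_mult power2_abs)
    qed
    have "(\<integral>\<^sup>+\<omega>. ennreal ((A \<omega> / \<sigma>) ^ (2 * m)) \<partial>M) \<le> ennreal K"
      unfolding eq using ER N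
      by (intro nn_integral_mean_convex[where C=UNIV and \<phi>="\<lambda>x. x ^ (2 * m)"]) (auto intro: convex_power_even)
    then have "(\<integral>\<^sup>+\<omega>. ennreal (A \<omega> powr (2 * p)) \<partial>M) \<le> ennreal ((1 + K) * \<sigma> powr (2 * p))"
      using p m K(1) by (intro nn_integral_powr_le_power[OF Am _ \<sigma>]) (auto simp: A_def)
    also have "(1 + K) * \<sigma> powr (2 * p) = C / real N powr (2 * p)"
      using N T_pos by (simp add: C_def \<sigma>_def powr_divide)
    finally show ?thesis unfolding A_def R_def .
  qed
  moreover have "C \<ge> 0" using K by (simp add: C_def)
  ultimately show ?thesis by blast
qed

lemma increment_mean_moments:
  "unif_moments M {(a, b). 0 \<le> a \<and> a < b \<and> b \<le> T}
    (\<lambda>i \<omega>. path_mean (fst i) (snd i) (\<lambda>s. (W s \<omega> - W (fst i) \<omega>) / sqrt (snd i - fst i)))"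
proof (rule unif_moments_path_mean)
  let ?I = "{(a, b). 0 \<le> a \<and> a < b \<and> b \<le> T}"
  let ?J = "{(i, s). i \<in> ?I \<and> s \<in> {fst i..snd i}}"
  have "unif_moments M ?J (\<lambda>j. case (fst (fst j), snd j) of (s, t) \<Rightarrow> \<lambda>\<omega>. (W t \<omega> - W s \<omega>) / sqrt (t - s))"
    by (rule unif_moments_reindex[OF W_increment_moments]) auto
  then show "unif_moments M ?J (\<lambda>(i, s) \<omega>. (W s \<omega> - W (fst i) \<omega>) / sqrt (snd i - fst i))"
  proof (rule unif_moments_dominated)
    fix j assume "j \<in> ?J"
    then obtain a b s where j: "j = ((a, b), s)" and abs: "0 \<le> a" "a < b" "b \<le> T" "a \<le> s" "s \<le> b" by auto
    have [measurable]: "W s \<in> borel_measurable M" "W a \<in> borel_measurable M"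
      using abs W_measurable by auto
    show "(case j of (i, s) \<Rightarrow> \<lambda>\<omega>. (W s \<omega> - W (fst i) \<omega>) / sqrt (snd i - fst i)) \<in> borel_measurable M"
      unfolding j by simp
    have "\<bar>W s \<omega> - W a \<omega>\<bar> / sqrt (b - a) \<le> \<bar>W s \<omega> - W a \<omega>\<bar> / sqrt (s - a)" for \<omega>
      using abs by (cases "s = a") (auto intro!: divide_left_mono)
    then show "AE \<omega> in M. \<bar>(case j of (i, s) \<Rightarrow> \<lambda>\<omega>. (W s \<omega> - W (fst i) \<omega>) / sqrt (snd i - fst i)) \<omega>\<bar>
      \<le> \<bar>(case (fst (fst j), snd j) of (s, t) \<Rightarrow> \<lambda>\<omega>. (W t \<omega> - W s \<omega>) / sqrt (t - s)) \<omega>\<bar>"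
      unfolding j using abs by simp
  qed
  fix i assume i: "i \<in> ?I"
  show "AE \<omega> in M. continuous_on {fst i..snd i} (\<lambda>s. (W s \<omega> - W (fst i) \<omega>) / sqrt (snd i - fst i))"
    using AE_paths
  proof eventually_elim
    case (elim \<omega>)
    then have "continuous_on {fst i..snd i} (\<lambda>t. W t \<omega>)"
      using i by (elim conjE continuous_on_subset; auto)
    then show ?case using i by (intro continuous_intros) auto
  qed
qed auto

text \<open>Each term has size \<open>step powr (3/2)\<close>, so the triangle inequality would give only \<open>1 / sqrt N\<close>.
  The terms are orthogonal to the past, and the cancellation in a sum of \<open>N\<close> of them gains the missing
  factor \<open>1 / sqrt N\<close>.\<close>

lemma martingale_part_moment:
  assumes \<beta>: "0 \<le> \<beta>" "\<beta> < 2" and g': "exp_growth \<beta> g'" "g' \<in> borel_measurable borel" and p: "p \<ge> 1"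
  shows "\<exists>C\<ge>0. \<forall>N\<ge>1. (\<integral>\<^sup>+\<omega>. ennreal (running_max (\<lambda>k. \<Sum>l<k. step T N * (\<nu> * g' (Y_past (grid T N l) \<omega>)
        * path_mean (grid T N l) (grid T N (Suc l)) (\<lambda>s. W s \<omega> - W (grid T N l) \<omega>))) N powr (2 * p)) \<partial>M)
      \<le> ennreal (C / real N powr (2 * p))"
proof -
  define m where "m = nat \<lceil>p\<rceil>"
  have m: "p \<le> real m" "m \<ge> 1" using p by (auto simp: m_def) linarith
  define q where "q = 2 * m"
  note [measurable] = g'(2)
  let ?J = "{(N :: nat, l). 1 \<le> N \<and> l < N}"
  define I where "I N l \<omega> = path_mean (grid T N l) (grid T N (Suc l)) (\<lambda>s. W s \<omega> - W (grid T N l) \<omega>)" for N l \<omega>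
  define z where "z = (\<lambda>(N, l) \<omega>. \<nu> * g' (Y_past (grid T N l) \<omega>) * (I N l \<omega> / sqrt (step T N)))"
  have grid_in: "grid T N l \<in> {0..T}" if "(N, l) \<in> ?J" for N l
    using that grid_facts(4,5)[of N l] by auto
  have YpM: "Y_past (grid T N l) \<in> borel_measurable M" if "(N, l) \<in> ?J" for N l
    using Y_past_measurable[OF grid_in[OF that]] .
  have IM: "I N l \<in> borel_measurable M" if "(N, l) \<in> ?J" for N l
    unfolding I_def using that grid_facts(3,4)[of N l] grid_facts(5)[of N "Suc l"]
    by (intro path_mean_measurable borel_measurable_diff W_measurable) auto
  have zU: "unif_moments M ?J z"
  proof (rule unif_moments_dominated)
    show "unif_moments M ?J (\<lambda>j \<omega>. \<nu> * g' (Y (grid T (fst j) (snd j)) \<omega>) *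
      (\<lambda>i. path_mean (fst i) (snd i) (\<lambda>s. (W s \<omega> - W (fst i) \<omega>) / sqrt (snd i - fst i))) (grid T (fst j) (snd j), grid T (fst j) (Suc (snd j))))"
    proof (intro unif_moments_mult unif_moments_constant)
      show "unif_moments M ?J (\<lambda>j \<omega>. g' (Y (grid T (fst j) (snd j)) \<omega>))"
        by (rule unif_moments_reindex[OF Y_growth_moments[OF \<beta> g']]) (use grid_in in auto)
      show "unif_moments M ?J (\<lambda>j \<omega>. (\<lambda>i. path_mean (fst i) (snd i) (\<lambda>s. (W s \<omega> - W (fst i) \<omega>) / sqrt (snd i - fst i)))
          (grid T (fst j) (snd j), grid T (fst j) (Suc (snd j))))"
      proof (rule unif_moments_reindex[OF increment_mean_moments])
        fix j :: "nat \<times> nat" assume "j \<in> ?J"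
        then have N: "1 \<le> fst j" and l: "snd j < fst j" by auto
        show "(grid T (fst j) (snd j), grid T (fst j) (Suc (snd j))) \<in> {(a, b). 0 \<le> a \<and> a < b \<and> b \<le> T}"
          using grid_facts(1)[OF N] grid_facts(2,4)[OF N, of "snd j"] grid_facts(5)[OF N, of "Suc (snd j)"] l by auto
      qed
    qed
    fix j assume j: "j \<in> ?J"
    then obtain N l where Nl: "j = (N, l)" "1 \<le> N" "l < N" by auto
    have [measurable]: "Y_past (grid T N l) \<in> borel_measurable M" "I N l \<in> borel_measurable M"
      using YpM IM Nl by auto
    show "z j \<in> borel_measurable M" unfolding z_def Nl by simp
    show "AE \<omega> in M. \<bar>z j \<omega>\<bar> \<le> \<bar>\<nu> * g' (Y (grid T (fst j) (snd j)) \<omega>) *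
      (\<lambda>i. path_mean (fst i) (snd i) (\<lambda>s. (W s \<omega> - W (fst i) \<omega>) / sqrt (snd i - fst i))) (grid T (fst j) (snd j), grid T (fst j) (Suc (snd j)))\<bar>"
      using AE_grid_paths[OF Nl(2)]
    proof eventually_elim
      case (elim \<omega>)
      note gr = grid_facts[OF Nl(2)]
      have "continuous_on {grid T N l..grid T N (Suc l)} (\<lambda>s. W s \<omega>)" using elim Nl by blast
      then have c: "continuous_on {grid T N l..grid T N (Suc l)} (\<lambda>s. W s \<omega> - W (grid T N l) \<omega>)"
        by (intro continuous_intros)
      have "path_mean (grid T N l) (grid T N (Suc l)) (\<lambda>s. (W s \<omega> - W (grid T N l) \<omega>) / sqrt (step T N)) = I N l \<omega> / sqrt (step T N)"
        using path_mean_cmult[OF c gr(3), of "1 / sqrt (step T N)"] by (simp add: I_def)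
      moreover have "Y (grid T N l) \<omega> = Y_past (grid T N l) \<omega>" using elim Nl gr(3)[of l] by auto
      ultimately show ?case unfolding Nl z_def using gr(2) by simp
    qed
  qed
  obtain K where K: "K \<ge> 0" "\<And>j. j \<in> ?J \<Longrightarrow> (LINT \<omega>|M. \<bar>z j \<omega>\<bar> ^ q) \<le> K"
    using unif_moments_expectation[OF zU] by blast
  define D where "D = 4 ^ q * (2 * K * exp (2 ^ q))"
  define C where "C = (1 + D) * (T * sqrt T) powr (2 * p)"
  have D0: "D \<ge> 0" using K by (simp add: D_def)
  have "(\<integral>\<^sup>+\<omega>. ennreal (running_max (\<lambda>k. \<Sum>l<k. step T N * (\<nu> * g' (Y_past (grid T N l) \<omega>) * I N l \<omega>)) N powr (2 * p)) \<partial>M)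
      \<le> ennreal (C / real N powr (2 * p))" if N: "N \<ge> 1" for N
  proof -
    note gr = grid_facts[OF N]
    define \<sigma> where "\<sigma> = step T N * sqrt T"
    have \<sigma>: "\<sigma> > 0" using gr T_pos by (simp add: \<sigma>_def)
    define x where "x l \<omega> = step T N * (\<nu> * g' (Y_past (grid T N l) \<omega>) * I N l \<omega>) / \<sigma>" for l \<omega>
    have xz: "x l \<omega> = sqrt (1 / real N) * z (N, l) \<omega>" for l \<omega>
    proof -
      have "sqrt (step T N) = sqrt T * sqrt (1 / real N)" by (simp add: step_def real_sqrt_divide)
      then show ?thesis using gr(1) T_pos N by (simp add: x_def z_def \<sigma>_def)
    qed
    have inJ: "(N, l) \<in> ?J" if "l < N" for l using that N by simp
    have zm: "all_moments M (z (N, l))" if "l < N" for l using unif_moments_single[OF zU inJ[OF that]] .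
    have "(\<integral>\<^sup>+\<omega>. ennreal (running_max (\<lambda>k. \<Sum>l<k. x l \<omega>) N ^ q) \<partial>M) \<le> ennreal (4 ^ q * (2 * K * exp (2 ^ q)))"
    proof (rule martingale_max_moment[where F="\<lambda>k. past (grid T N k)" and b="\<lambda>_. 1 / real N" and z="\<lambda>l. z (N, l)"])
      show "subalgebra M (past (grid T N k))" if "k \<le> N" for k using that gr by (intro subalgebra_past) auto
      show "subalgebra (past (grid T N (Suc k))) (past (grid T N k))" for k
        using gr by (intro subalgebra_past_mono) auto
      have IF: "I N k \<in> borel_measurable (past (grid T N (Suc k)))" for k
        unfolding I_def
      proof (rule path_mean_measurable[OF gr(3)])
        fix s assume s: "s \<in> {grid T N k..grid T N (Suc k)}"
        have "(\<lambda>\<omega>. (W s \<omega> - W 0 \<omega>) - (W (grid T N k) \<omega> - W 0 \<omega>)) \<in> borel_measurable (past (grid T N (Suc k)))"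
          using s gr(3,4)[of k] by (intro borel_measurable_diff past_measurable) auto
        then show "(\<lambda>\<omega>. W s \<omega> - W (grid T N k) \<omega>) \<in> borel_measurable (past (grid T N (Suc k)))" by simp
      qed
      show "x k \<in> borel_measurable (past (grid T N (Suc k)))" for k
      proof -
        have [measurable]: "Y_past (grid T N k) \<in> borel_measurable (past (grid T N (Suc k)))"
          using gr by (intro Y_past_measurable_past) auto
        note IF[of k, measurable]
        show ?thesis unfolding x_def by measurable
      qed
      show "all_moments M (z (N, k))" if "k < N" for k by (rule zm[OF that])
      show "all_moments M (x k)" if "k < N" for k
      proof -
        have "x k = (\<lambda>\<omega>. sqrt (1 / real N) * z (N, k) \<omega>)" using xz by auto
        then show ?thesis using unif_moments_mult[OF unif_moments_constant zm[OF that]] by simp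
      qed
      show "expectation (\<lambda>\<omega>. \<zeta> \<omega> * x k \<omega>) = 0"
        if k: "k < N" and \<zeta>: "\<zeta> \<in> borel_measurable (past (grid T N k))" "all_moments M \<zeta>" for k \<zeta>
      proof -
        have gY: "all_moments M (\<lambda>\<omega>. g' (Y_past (grid T N k) \<omega>))"
        proof (rule unif_moments_dominated)
          show "all_moments M (\<lambda>\<omega>. g' (Y (grid T N k) \<omega>))"
            using unif_moments_single[OF Y_growth_moments[OF \<beta> g'] grid_in[OF inJ[OF k]]] .
          have [measurable]: "Y_past (grid T N k) \<in> borel_measurable M" using YpM[OF inJ[OF k]] .
          show "(\<lambda>\<omega>. g' (Y_past (grid T N k) \<omega>)) \<in> borel_measurable M" by measurable
          show "AE \<omega> in M. \<bar>g' (Y_past (grid T N k) \<omega>)\<bar> \<le> \<bar>g' (Y (grid T N k) \<omega>)\<bar>"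
            using AE_paths by eventually_elim (use grid_in[OF inJ[OF k]] in auto)
        qed
        have [measurable]: "Y_past (grid T N k) \<in> borel_measurable (past (grid T N k))"
          using gr by (intro Y_past_measurable_past) auto
        note \<zeta>(1)[measurable]
        have "expectation (\<lambda>\<omega>. (\<zeta> \<omega> * g' (Y_past (grid T N k) \<omega>)) * path_mean (grid T N k) (grid T N (Suc k)) (\<lambda>s. W s \<omega> - W (grid T N k) \<omega>)) = 0"
        proof (rule past_orthogonal_path_mean)
          show "(\<lambda>\<omega>. \<zeta> \<omega> * g' (Y_past (grid T N k) \<omega>)) \<in> borel_measurable (past (grid T N k))" by measurable
          show "all_moments M (\<lambda>\<omega>. \<zeta> \<omega> * g' (Y_past (grid T N k) \<omega>))" by (rule unif_moments_mult[OF \<zeta>(2) gY])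
        qed (use gr k in auto)
        then have "expectation (\<lambda>\<omega>. (step T N * \<nu> / \<sigma>) * ((\<zeta> \<omega> * g' (Y_past (grid T N k) \<omega>)) * I N k \<omega>)) = 0"
          unfolding I_def by (simp only: integral_mult_right_zero)
        then show ?thesis unfolding x_def by (simp add: mult.left_commute mult.assoc)
      qed
      show "even q" "q \<ge> 2" using m by (auto simp: q_def)
      show "(\<Sum>k<N. 1 / real N) \<le> 1" using N by simp
      show "x k \<omega> = sqrt (1 / real N) * z (N, k) \<omega>" for k \<omega> by (rule xz)
      show "(LINT \<omega>|M. z (N, k) \<omega> ^ q) \<le> K" if "k < N" for k
        using K(2)[OF inJ[OF that]] by (simp add: q_def power_even_abs)
    qed (use K in auto)
    moreover
    define A where "A \<omega> = running_max (\<lambda>k. \<Sum>l<k. step T N * (\<nu> * g' (Y_past (grid T N l) \<omega>) * I N l \<omega>)) N" for \<omega>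
    have "running_max (\<lambda>k. \<Sum>l<k. x l \<omega>) N = A \<omega> / \<sigma>" for \<omega>
    proof -
      have "(\<lambda>k. \<Sum>l<k. x l \<omega>) = (\<lambda>k. (1 / \<sigma>) * (\<Sum>l<k. step T N * (\<nu> * g' (Y_past (grid T N l) \<omega>) * I N l \<omega>)))"
        by (simp add: x_def sum_divide_distrib)
      then show ?thesis using running_max_scale[of "1 / \<sigma>" "\<lambda>k. \<Sum>l<k. step T N * (\<nu> * g' (Y_past (grid T N l) \<omega>) * I N l \<omega>)" N] \<sigma>
        by (simp add: A_def)
    qed
    ultimately have E: "(\<integral>\<^sup>+\<omega>. ennreal ((A \<omega> / \<sigma>) ^ q) \<partial>M) \<le> ennreal D" by (simp add: D_def)
    have Am: "A \<in> borel_measurable M"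
      unfolding A_def
    proof (rule running_max_measurable, rule borel_measurable_sum)
      fix k l assume "k \<le> N" "l \<in> {..<k}"
      then have "(N, l) \<in> ?J" using N by auto
      then have [measurable]: "Y_past (grid T N l) \<in> borel_measurable M" "I N l \<in> borel_measurable M"
        using YpM IM by auto
      show "(\<lambda>\<omega>. step T N * (\<nu> * g' (Y_past (grid T N l) \<omega>) * I N l \<omega>)) \<in> borel_measurable M" by measurable
    qed
    have "(\<integral>\<^sup>+\<omega>. ennreal (A \<omega> powr (2 * p)) \<partial>M) \<le> ennreal ((1 + D) * \<sigma> powr (2 * p))"
      by (rule nn_integral_powr_le_power[OF Am _ \<sigma> _ _ E D0]) (use p m in \<open>auto simp: A_def running_max_nonneg q_def\<close>)
    also have "(1 + D) * \<sigma> powr (2 * p) = C / real N powr (2 * p)"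
    proof -
      have "\<sigma> = (T * sqrt T) / real N" by (simp add: \<sigma>_def step_def)
      then show ?thesis using N T_pos by (simp add: C_def powr_divide)
    qed
    finally show ?thesis unfolding A_def .
  qed
  moreover have "C \<ge> 0" using D0 by (simp add: C_def)
  ultimately show ?thesis unfolding I_def by blast
qed

lemma drift_error_moment:
  assumes g: "0 \<le> \<beta>" "\<beta> < 2"
    "\<And>y. (g has_real_derivative g' y) (at y)" "\<And>y. (g' has_real_derivative g'' y) (at y)"
    "exp_growth \<beta> g'" "exp_growth \<beta> g''" and p: "p \<ge> 1"
  shows "\<exists>C\<ge>0. \<forall>N\<ge>1. (\<integral>\<^sup>+\<omega>. ennreal (running_max (\<lambda>k. \<Sum>l<k. step T N *
        (path_mean (grid T N l) (grid T N (Suc l)) (\<lambda>s. g (Y s \<omega>)) - g (Y (grid T N l) \<omega>))) N powr (2 * p)) \<partial>M)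
      \<le> ennreal (C / real N powr (2 * p))"
proof -
  have gc: "continuous_on UNIV g" "continuous_on UNIV g'"
    using g(3,4) by (auto intro!: DERIV_continuous_on)
  have gm[measurable]: "g \<in> borel_measurable borel" "g' \<in> borel_measurable borel"
    using gc by (auto intro: borel_measurable_continuous_onI)
  obtain C1 where C1: "C1 \<ge> 0" "\<And>N. N \<ge> 1 \<Longrightarrow> (\<integral>\<^sup>+\<omega>. ennreal (\<bar>\<Sum>l<N. (step T N)\<^sup>2 * remainder_size g g' N l \<omega>\<bar> powr (2 * p)) \<partial>M)
      \<le> ennreal (C1 / real N powr (2 * p))"
    using remainder_sum_moment[OF g p] by blast
  define x where "x N l \<omega> = step T N * (\<nu> * g' (Y_past (grid T N l) \<omega>)
        * path_mean (grid T N l) (grid T N (Suc l)) (\<lambda>s. W s \<omega> - W (grid T N l) \<omega>))" for N l \<omega>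
  obtain C2 where C2: "C2 \<ge> 0" "\<And>N. N \<ge> 1 \<Longrightarrow> (\<integral>\<^sup>+\<omega>. ennreal (running_max (\<lambda>k. \<Sum>l<k. x N l \<omega>) N powr (2 * p)) \<partial>M)
      \<le> ennreal (C2 / real N powr (2 * p))"
    using martingale_part_moment[OF g(1,2,5) gm(2) p] unfolding x_def by blast
  define C where "C = 2 powr (2 * p) * (C1 + C2)"
  have "(\<integral>\<^sup>+\<omega>. ennreal (running_max (\<lambda>k. \<Sum>l<k. step T N *
        (path_mean (grid T N l) (grid T N (Suc l)) (\<lambda>s. g (Y s \<omega>)) - g (Y (grid T N l) \<omega>))) N powr (2 * p)) \<partial>M)
      \<le> ennreal (C / real N powr (2 * p))" if N: "N \<ge> 1" for N
  proof -
    note gr = grid_facts[OF N]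
    define R where "R \<omega> = \<bar>\<Sum>l<N. (step T N)\<^sup>2 * remainder_size g g' N l \<omega>\<bar>" for \<omega>
    define Q where "Q \<omega> = running_max (\<lambda>k. \<Sum>l<k. x N l \<omega>) N" for \<omega>
    define D where "D \<omega> = running_max (\<lambda>k. \<Sum>l<k. step T N *
        (path_mean (grid T N l) (grid T N (Suc l)) (\<lambda>s. g (Y s \<omega>)) - g (Y (grid T N l) \<omega>))) N" for \<omega>
    have Rm[measurable]: "R \<in> borel_measurable M"
      unfolding R_def using unif_moments_measurable[OF remainder_size_moments[OF g(1-6)], of "(N, _)"] N
      by (intro borel_measurable_abs borel_measurable_sum borel_measurable_times) auto
    have Qm[measurable]: "Q \<in> borel_measurable M"
      unfolding Q_def
    proof (rule running_max_measurable, rule borel_measurable_sum)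
      fix k l assume "k \<le> N" "l \<in> {..<k}"
      then have l: "l < N" by auto
      have [measurable]: "Y_past (grid T N l) \<in> borel_measurable M"
        using gr(4)[of l] gr(5)[of l] l by (intro Y_past_measurable) auto
      have [measurable]: "(\<lambda>\<omega>. path_mean (grid T N l) (grid T N (Suc l)) (\<lambda>s. W s \<omega> - W (grid T N l) \<omega>)) \<in> borel_measurable M"
        using gr(3,4)[of l] gr(5)[of "Suc l"] gr(5)[of l] l
        by (intro path_mean_measurable borel_measurable_diff W_measurable) auto
      show "x N l \<in> borel_measurable M" unfolding x_def by measurable
    qed
    have "AE \<omega> in M. D \<omega> \<le> R \<omega> + Q \<omega>"
      using AE_grid_paths[OF N]
    proof eventually_elim
      case (elim \<omega>)
      define r where "r l = step T N * path_mean (grid T N l) (grid T N (Suc l)) (\<lambda>s. remainder g g' (grid T N l) s \<omega>)" for l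
      have split: "step T N * (path_mean (grid T N l) (grid T N (Suc l)) (\<lambda>s. g (Y s \<omega>)) - g (Y (grid T N l) \<omega>)) = r l + x N l \<omega>" if l: "l < N" for l
      proof -
        have eq: "path_mean (grid T N l) (grid T N (Suc l)) (\<lambda>s. g (Y s \<omega>)) - g (Y (grid T N l) \<omega>)
          = path_mean (grid T N l) (grid T N (Suc l)) (\<lambda>s. remainder g g' (grid T N l) s \<omega>)
            + \<nu> * g' (Y (grid T N l) \<omega>) * path_mean (grid T N l) (grid T N (Suc l)) (\<lambda>s. W s \<omega> - W (grid T N l) \<omega>)"
          using elim l gr(3) gc(1) by (intro path_mean_remainder) auto
        have "Y (grid T N l) \<omega> = Y_past (grid T N l) \<omega>" using elim l gr(3)[of l] by auto
        then show ?thesis unfolding eq by (simp add: r_def x_def distrib_left)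
      qed
      have rb: "\<bar>r l\<bar> \<le> (step T N)\<^sup>2 * remainder_size g g' N l \<omega>" if l: "l < N" for l
      proof -
        have "\<bar>r l\<bar> \<le> step T N * (step T N * remainder_size g g' N l \<omega>)"
          unfolding r_def abs_mult using gr(1) elim l gc(1)
          by (simp add: path_mean_remainder_le[OF N])
        then show ?thesis by (simp add: power2_eq_square mult.assoc)
      qed
      show ?case
        unfolding D_def
      proof (rule running_max_le)
        fix k assume k: "k \<le> N"
        have "(\<Sum>l<k. step T N * (path_mean (grid T N l) (grid T N (Suc l)) (\<lambda>s. g (Y s \<omega>)) - g (Y (grid T N l) \<omega>)))
          = (\<Sum>l<k. r l) + (\<Sum>l<k. x N l \<omega>)"
          using split k by (simp add: sum.distrib[symmetric])
        moreover have "\<bar>\<Sum>l<k. r l\<bar> \<le> R \<omega>"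
        proof -
          have "\<bar>\<Sum>l<k. r l\<bar> \<le> (\<Sum>l<k. (step T N)\<^sup>2 * remainder_size g g' N l \<omega>)"
            using rb k by (intro order_trans[OF sum_abs] sum_mono) auto
          also have "\<dots> \<le> (\<Sum>l<N. (step T N)\<^sup>2 * remainder_size g g' N l \<omega>)"
            using k by (intro sum_mono2) (auto intro: order_trans[OF abs_ge_zero rb])
          also have "\<dots> \<le> R \<omega>" by (simp add: R_def)
          finally show ?thesis .
        qed
        moreover have "\<bar>\<Sum>l<k. x N l \<omega>\<bar> \<le> Q \<omega>" unfolding Q_def using running_max_ge[OF k] by fast
        ultimately show "\<bar>\<Sum>l<k. step T N * (path_mean (grid T N l) (grid T N (Suc l)) (\<lambda>s. g (Y s \<omega>)) - g (Y (grid T N l) \<omega>))\<bar> \<le> R \<omega> + Q \<omega>"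
          by linarith
      qed
    qed
    then have "AE \<omega> in M. ennreal (D \<omega> powr (2 * p)) \<le> ennreal (2 powr (2 * p)) * (ennreal (R \<omega> powr (2 * p)) + ennreal (Q \<omega> powr (2 * p)))"
    proof eventually_elim
      case (elim \<omega>)
      have "D \<omega> powr (2 * p) \<le> (R \<omega> + Q \<omega>) powr (2 * p)"
        using elim p by (intro powr_mono2) (auto simp: D_def running_max_nonneg)
      also have "\<dots> \<le> 2 powr (2 * p) * (R \<omega> powr (2 * p) + Q \<omega> powr (2 * p))"
        using p by (intro add_powr_le) (auto simp: R_def Q_def running_max_nonneg)
      finally show ?case by (simp add: ennreal_mult'[symmetric] ennreal_plus[symmetric] ennreal_leI del: ennreal_plus)
    qed
    then have "(\<integral>\<^sup>+\<omega>. ennreal (D \<omega> powr (2 * p)) \<partial>M) \<le> (\<integral>\<^sup>+\<omega>. ennreal (2 powr (2 * p)) * (ennreal (R \<omega> powr (2 * p)) + ennreal (Q \<omega> powr (2 * p))) \<partial>M)"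
      by (rule nn_integral_mono_AE)
    also have "\<dots> = ennreal (2 powr (2 * p)) * ((\<integral>\<^sup>+\<omega>. ennreal (R \<omega> powr (2 * p)) \<partial>M) + (\<integral>\<^sup>+\<omega>. ennreal (Q \<omega> powr (2 * p)) \<partial>M))"
      by (simp add: nn_integral_cmult nn_integral_add)
    also have "\<dots> \<le> ennreal (2 powr (2 * p)) * (ennreal (C1 / real N powr (2 * p)) + ennreal (C2 / real N powr (2 * p)))"
      using C1(2)[OF N] C2(2)[OF N] unfolding R_def Q_def by (intro mult_left_mono add_mono) auto
    also have "\<dots> = ennreal (C / real N powr (2 * p))"
      using C1(1) C2(1) by (simp add: C_def ennreal_mult'[symmetric] ennreal_plus[symmetric] add_divide_distrib distrib_left del: ennreal_plus)
    finally show ?thesis unfolding D_def .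
  qed
  moreover have "C \<ge> 0" using C1 C2 by (simp add: C_def)
  ultimately show ?thesis by blast
qed

end

section \<open>The volatility error\<close>

text \<open>Given \<open>X\<close> the weights are deterministic. Independence makes the joint law a product, so the bound
  for deterministic weights holds for every fixed value of \<open>X\<close> and is then integrated.\<close>

lemma (in brownian) independent_weights_max:
  fixes X :: "'a \<Rightarrow> real \<Rightarrow> real"
  assumes ind: "indep_var S X (PiM {0..T} (\<lambda>_. borel)) (\<lambda>\<omega>. \<lambda>t\<in>{0..T}. W t \<omega>)" and p: "p \<ge> 1"
  shows "\<exists>C\<ge>0. \<forall>N\<ge>1. \<forall>\<alpha>. (\<forall>l<N. \<alpha> l \<in> borel_measurable S) \<longrightarrow>
    (\<integral>\<^sup>+\<omega>. ennreal (running_max (\<lambda>k. \<Sum>l<k. \<alpha> l (X \<omega>) * (W (grid T N (Suc l)) \<omega> - W (grid T N l) \<omega>)) N powr (2 * p)) \<partial>M)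
      \<le> (\<integral>\<^sup>+\<omega>. ennreal (C * (\<Sum>l<N. (\<alpha> l (X \<omega>))\<^sup>2 * step T N) powr p) \<partial>M)"
proof -
  obtain C where C: "C \<ge> 0" "\<And>N a. N \<ge> 1 \<Longrightarrow>
    (\<integral>\<^sup>+\<omega>. ennreal (running_max (\<lambda>k. \<Sum>l<k. a l * (W (grid T N (Suc l)) \<omega> - W (grid T N l) \<omega>)) N powr (2 * p)) \<partial>M)
      \<le> ennreal (C * (\<Sum>l<N. (a l)\<^sup>2 * step T N) powr p)"
    using weighted_increments_max[OF p] by blast
  have "(\<integral>\<^sup>+\<omega>. ennreal (running_max (\<lambda>k. \<Sum>l<k. \<alpha> l (X \<omega>) * (W (grid T N (Suc l)) \<omega> - W (grid T N l) \<omega>)) N powr (2 * p)) \<partial>M)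
      \<le> (\<integral>\<^sup>+\<omega>. ennreal (C * (\<Sum>l<N. (\<alpha> l (X \<omega>))\<^sup>2 * step T N) powr p) \<partial>M)"
    if N: "N \<ge> 1" and \<alpha>: "\<And>l. l < N \<Longrightarrow> \<alpha> l \<in> borel_measurable S" for N \<alpha>
  proof -
    note g = grid_facts[OF N]
    define P where "P = PiM {0..T} (\<lambda>_. borel :: real measure)"
    define W' where "W' \<omega> = (\<lambda>t\<in>{0..T}. W t \<omega>)" for \<omega>
    have gin: "grid T N k \<in> {0..T}" if "k \<le> N" for k using g that by auto
    define H where "H x b = running_max (\<lambda>k. \<Sum>l<k. \<alpha> l x * (b (grid T N (Suc l)) - b (grid T N l))) N powr (2 * p)"
      for x and b :: "real \<Rightarrow> real"
    have indP: "indep_var S X P W'" using ind unfolding P_def W'_def[abs_def] .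
    have Xm: "X \<in> measurable M S" and Wm: "W' \<in> measurable M P"
      using indep_var_rv1[OF indP] indep_var_rv2[OF indP] .
    have dist: "distr M S X \<Otimes>\<^sub>M distr M P W' = distr M (S \<Otimes>\<^sub>M P) (\<lambda>\<omega>. (X \<omega>, W' \<omega>))"
      using indP by (simp add: indep_var_distribution_eq)
    interpret PW: prob_space "distr M P W'" by (rule prob_space_distr[OF Wm])
    have bm: "(\<lambda>b. b (grid T N k)) \<in> borel_measurable P" if "k \<le> N" for k
      unfolding P_def using gin[OF that] by (rule measurable_component_singleton)
    have Hm: "(\<lambda>(x, b). ennreal (H x b)) \<in> borel_measurable (S \<Otimes>\<^sub>M P)"
    proof -
      have "(\<lambda>xb. running_max (\<lambda>k. \<Sum>l<k. \<alpha> l (fst xb) * (snd xb (grid T N (Suc l)) - snd xb (grid T N l))) N) \<in> borel_measurable (S \<Otimes>\<^sub>M P)"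
      proof (rule running_max_measurable, rule borel_measurable_sum)
        fix k l assume "k \<le> N" "l \<in> {..<k}"
        then have l: "l < N" by auto
        note [measurable] = \<alpha>[OF l] bm[of l] bm[of "Suc l"]
        show "(\<lambda>xb. \<alpha> l (fst xb) * (snd xb (grid T N (Suc l)) - snd xb (grid T N l))) \<in> borel_measurable (S \<Otimes>\<^sub>M P)"
          using l measurable_compose[OF measurable_fst \<alpha>[OF l], of P]
            measurable_compose[OF measurable_snd bm[of l], of S] measurable_compose[OF measurable_snd bm[of "Suc l"], of S]
          by (intro borel_measurable_times borel_measurable_diff) auto
      qed
      then show ?thesis unfolding H_def case_prod_beta' by measurable
    qed
    define V where "V x = ennreal (C * (\<Sum>l<N. (\<alpha> l x)\<^sup>2 * step T N) powr p)" for x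
    have Vm: "V \<in> borel_measurable S"
    proof -
      have "(\<lambda>x. \<Sum>l<N. (\<alpha> l x)\<^sup>2 * step T N) \<in> borel_measurable S"
        using \<alpha> by (intro borel_measurable_sum borel_measurable_times borel_measurable_power) auto
      then show ?thesis unfolding V_def by measurable
    qed
    have HW: "H x (W' \<omega>) = running_max (\<lambda>k. \<Sum>l<k. \<alpha> l x * (W (grid T N (Suc l)) \<omega> - W (grid T N l) \<omega>)) N powr (2 * p)" for x \<omega>
    proof -
      have "(\<Sum>l<k. \<alpha> l x * (W' \<omega> (grid T N (Suc l)) - W' \<omega> (grid T N l))) = (\<Sum>l<k. \<alpha> l x * (W (grid T N (Suc l)) \<omega> - W (grid T N l) \<omega>))"
        if "k \<le> N" for k
        using that gin by (intro sum.cong) (auto simp: W'_def)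
      then have "(\<lambda>j. \<bar>\<Sum>l<j. \<alpha> l x * (W' \<omega> (grid T N (Suc l)) - W' \<omega> (grid T N l))\<bar>) ` {..N}
        = (\<lambda>j. \<bar>\<Sum>l<j. \<alpha> l x * (W (grid T N (Suc l)) \<omega> - W (grid T N l) \<omega>)\<bar>) ` {..N}"
        by (intro image_cong) auto
      then show ?thesis unfolding H_def running_max_def by simp
    qed
    have "(\<integral>\<^sup>+\<omega>. ennreal (H (X \<omega>) (W' \<omega>)) \<partial>M) = (\<integral>\<^sup>+xb. (\<lambda>(x, b). ennreal (H x b)) xb \<partial>distr M (S \<Otimes>\<^sub>M P) (\<lambda>\<omega>. (X \<omega>, W' \<omega>)))"
      using Hm Xm Wm by (subst nn_integral_distr) auto
    also have "\<dots> = (\<integral>\<^sup>+xb. (\<lambda>(x, b). ennreal (H x b)) xb \<partial>(distr M S X \<Otimes>\<^sub>M distr M P W'))"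
      unfolding dist ..
    also have "\<dots> = (\<integral>\<^sup>+x. (\<integral>\<^sup>+b. ennreal (H x b) \<partial>distr M P W') \<partial>distr M S X)"
    proof (subst PW.nn_integral_fst[symmetric])
      show "(\<lambda>(x, b). ennreal (H x b)) \<in> borel_measurable (distr M S X \<Otimes>\<^sub>M distr M P W')"
        using Hm by (simp cong: measurable_cong_sets)
    qed simp
    also have "\<dots> \<le> (\<integral>\<^sup>+x. V x \<partial>distr M S X)"
    proof (rule nn_integral_mono)
      fix x assume "x \<in> space (distr M S X)"
      then have x: "x \<in> space S" by simp
      have "(\<lambda>b. ennreal (H x b)) \<in> borel_measurable P"
        using measurable_compose[OF measurable_Pair1'[OF x] Hm] by simp
      then have "(\<integral>\<^sup>+b. ennreal (H x b) \<partial>distr M P W') = (\<integral>\<^sup>+\<omega>. ennreal (H x (W' \<omega>)) \<partial>M)"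
        using Wm by (subst nn_integral_distr) auto
      also have "\<dots> \<le> V x" unfolding HW V_def by (rule C(2)[OF N])
      finally show "(\<integral>\<^sup>+b. ennreal (H x b) \<partial>distr M P W') \<le> V x" .
    qed
    also have "\<dots> = (\<integral>\<^sup>+\<omega>. V (X \<omega>) \<partial>M)" using Xm Vm by (subst nn_integral_distr) auto
    finally show ?thesis unfolding HW V_def .
  qed
  then show ?thesis using C(1) by blast
qed

text \<open>Young's inequality, with the conjugate exponent \<open>(1 + \<epsilon>) / \<epsilon>\<close> and constants replaced by \<open>1\<close>: the
  larger of \<open>b\<close> and \<open>a powr (1 / \<epsilon>)\<close> absorbs the product.\<close>

lemma young_powr:
  fixes a b p \<epsilon> :: real
  assumes "a > 0" "b > 0" "p > 0" "\<epsilon> > 0"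
  shows "a powr p * b powr p \<le> a powr (p * (1 + \<epsilon>) / \<epsilon>) + b powr (p * (1 + \<epsilon>))"
proof (cases "b \<le> a powr (1 / \<epsilon>)")
  case True
  then have "b powr p \<le> (a powr (1 / \<epsilon>)) powr p" using assms by (intro powr_mono2) auto
  then have "a powr p * b powr p \<le> a powr p * a powr (p / \<epsilon>)"
    using assms by (simp add: powr_powr mult_left_mono)
  also have "\<dots> = a powr (p * (1 + \<epsilon>) / \<epsilon>)"
    using assms by (simp add: powr_add[symmetric] field_simps)
  finally show ?thesis by (simp add: add_increasing2)
next
  case False
  then have "(a powr (1 / \<epsilon>)) powr \<epsilon> \<le> b powr \<epsilon>" using assms by (intro powr_mono2) auto
  then have "a \<le> b powr \<epsilon>" using assms by (simp add: powr_powr)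
  then have "a powr p \<le> (b powr \<epsilon>) powr p" using assms by (intro powr_mono2) auto
  then have "a powr p * b powr p \<le> b powr (p * \<epsilon>) * b powr p"
    using assms by (simp add: powr_powr mult_right_mono mult.commute)
  also have "\<dots> = b powr (p * (1 + \<epsilon>))" by (simp add: powr_add[symmetric] distrib_left add.commute)
  finally show ?thesis by (simp add: add_increasing)
qed

text \<open>The cut-off at \<open>c \<le> v\<close> can only bring \<open>u\<close> closer to \<open>v\<close>, and the square root is Lipschitz with
  constant \<open>1 / sqrt v\<close> when one of the two points is \<open>v\<close>.\<close>

lemma sqrt_diff_square_le:
  fixes v u c e :: real
  assumes v: "v > 0" and c: "0 \<le> c" "c \<le> v" and e: "\<bar>v - u\<bar> \<le> e"
  shows "(sqrt v - sqrt (max u c))\<^sup>2 \<le> e\<^sup>2 / v"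
proof -
  define u' where "u' = max u c"
  have u': "0 \<le> u'" "\<bar>v - u'\<bar> \<le> e" using c e by (auto simp: u'_def)
  have "(sqrt v - sqrt u') * (sqrt v + sqrt u') = v - u'"
    using v u' by (simp add: algebra_simps)
  then have "\<bar>sqrt v - sqrt u'\<bar> * (sqrt v + sqrt u') = \<bar>v - u'\<bar>"
    using v u' by (metis abs_mult abs_of_nonneg add_nonneg_nonneg less_imp_le real_sqrt_ge_zero)
  then have "\<bar>sqrt v - sqrt u'\<bar> * sqrt v \<le> e"
    using u' v mult_left_mono[of "sqrt v" "sqrt v + sqrt u'" "\<bar>sqrt v - sqrt u'\<bar>"] by simp
  then have "(\<bar>sqrt v - sqrt u'\<bar> * sqrt v)\<^sup>2 \<le> e\<^sup>2" using v by (intro power_mono) auto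
  then have "(sqrt v - sqrt u')\<^sup>2 * v \<le> e\<^sup>2" using v by (simp add: power_mult_distrib)
  then show ?thesis using v by (simp add: u'_def field_simps)
qed

lemma convex_on_powr_neg:
  assumes "\<alpha> > 0"
  shows "convex_on {0<..} (\<lambda>x::real. x powr (- \<alpha>))"
proof (rule f''_ge0_imp_convex[where f'="\<lambda>x. - \<alpha> * x powr (- \<alpha> - 1)" and f''="\<lambda>x. \<alpha> * (\<alpha> + 1) * x powr (- \<alpha> - 2)"])
  fix x :: real assume "x \<in> {0<..}"
  then have x: "x > 0" by simp
  show "((\<lambda>x. x powr - \<alpha>) has_real_derivative - \<alpha> * x powr (- \<alpha> - 1)) (at x)"
    using x by (auto intro!: derivative_eq_intros)
  show "((\<lambda>x. - \<alpha> * x powr (- \<alpha> - 1)) has_real_derivative \<alpha> * (\<alpha> + 1) * x powr (- \<alpha> - 2)) (at x)"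
    using x by (auto intro!: derivative_eq_intros simp: algebra_simps)
  show "0 \<le> \<alpha> * (\<alpha> + 1) * x powr (- \<alpha> - 2)" using assms by simp
qed simp

text \<open>The difference between the exact and the approximate volatility of one step, as a functional of
  the path \<open>w\<close> of the Brownian motion that drives \<open>Y\<close>. In this form its
  independence of \<open>B\<close> is inherited from that path.\<close>

definition vol_weight :: "real \<Rightarrow> real \<Rightarrow> real \<Rightarrow> real \<Rightarrow> (real \<Rightarrow> real) \<Rightarrow> (real \<Rightarrow> real) \<Rightarrow> real \<Rightarrow>
    real \<Rightarrow> real \<Rightarrow> (real \<Rightarrow> real) \<Rightarrow> real" where
  "vol_weight \<nu> \<kappa> \<theta> y0 g g' c a b w =
     sqrt (path_mean a b (\<lambda>s. g (ou_path \<nu> \<kappa> \<theta> y0 (\<lambda>u. w u - w 0) s)))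
     - sqrt (max (g (ou_path \<nu> \<kappa> \<theta> y0 (\<lambda>u. w u - w 0) a)
         + \<nu> * g' (ou_path \<nu> \<kappa> \<theta> y0 (\<lambda>u. w u - w 0) a) * path_mean a b (\<lambda>s. w s - w a)) c)"

lemma vol_weight_measurable:
  assumes ab: "0 \<le> a" "a \<le> b" "b \<le> T" and g[measurable]: "g \<in> borel_measurable borel" "g' \<in> borel_measurable borel"
  shows "vol_weight \<nu> \<kappa> \<theta> y0 g g' c a b \<in> borel_measurable (PiM {0..T} (\<lambda>_. borel))"
proof -
  let ?P = "PiM {0..T} (\<lambda>_. borel :: real measure)"
  have w: "(\<lambda>w. w s) \<in> borel_measurable ?P" if "s \<in> {0..T}" for s
    using that by (rule measurable_component_singleton)
  have y: "(\<lambda>w. ou_path \<nu> \<kappa> \<theta> y0 (\<lambda>u. w u - w 0) s) \<in> borel_measurable ?P" if "s \<in> {0..T}" for s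
    using that by (intro ou_path_measurable borel_measurable_diff w) auto
  note [measurable] = y[of a]
  have [measurable]: "(\<lambda>w. path_mean a b (\<lambda>s. w s - w a)) \<in> borel_measurable ?P"
    using ab by (intro path_mean_measurable borel_measurable_diff w) auto
  have [measurable]: "(\<lambda>w. path_mean a b (\<lambda>s. g (ou_path \<nu> \<kappa> \<theta> y0 (\<lambda>u. w u - w 0) s))) \<in> borel_measurable ?P"
    using ab by (intro path_mean_measurable measurable_compose[OF y g(1)]) auto
  have "a \<in> {0..T}" using ab by auto
  then show ?thesis unfolding vol_weight_def by measurable
qed

context ou_process
begin

lemma vol_weight_eq:
  assumes ab: "0 \<le> a" "a \<le> b" "b \<le> T" and eq: "\<forall>s\<in>{a..b}. Y s \<omega> = Y_past s \<omega>"
  shows "vol_weight \<nu> \<kappa> \<theta> y0 g g' c a b (\<lambda>t\<in>{0..T}. W t \<omega>)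
    = sqrt (path_mean a b (\<lambda>s. g (Y s \<omega>)))
     - sqrt (max (g (Y a \<omega>) + \<nu> * g' (Y a \<omega>) * path_mean a b (\<lambda>s. W s \<omega> - W a \<omega>)) c)"
proof -
  define w where "w = (\<lambda>t\<in>{0..T}. W t \<omega>)"
  have y: "ou_path \<nu> \<kappa> \<theta> y0 (\<lambda>u. w u - w 0) s = Y s \<omega>" if s: "s \<in> {a..b}" for s
  proof -
    have "ou_path \<nu> \<kappa> \<theta> y0 (\<lambda>u. w u - w 0) s = Y_past s \<omega>"
      unfolding Y_past_def using s ab T_pos by (intro ou_path_cong) (auto simp: w_def)
    then show ?thesis using eq s by simp
  qed
  have "path_mean a b (\<lambda>s. w s - w a) = path_mean a b (\<lambda>s. W s \<omega> - W a \<omega>)"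
    using ab by (intro path_mean_cong) (auto simp: w_def)
  moreover have "path_mean a b (\<lambda>s. g (ou_path \<nu> \<kappa> \<theta> y0 (\<lambda>u. w u - w 0) s)) = path_mean a b (\<lambda>s. g (Y s \<omega>))"
    using ab y by (intro path_mean_cong) auto
  ultimately show ?thesis unfolding vol_weight_def w_def[symmetric] using y[of a] ab by simp
qed

text \<open>The inverse of the mean volatility is controlled through the convexity of \<open>x powr - \<alpha>\<close>: its
  moments are at most those of \<open>1 / g (Y t)\<close>. Young's inequality spends the spare exponent \<open>\<epsilon>\<close> on the
  remainder, all of whose moments are bounded. The summand \<open>1\<close> makes the terms positive, as convexity
  of \<open>x powr p\<close> is used on the positive half-line.\<close>

lemma weight_sum_moment:
  assumes g: "0 \<le> \<beta>" "\<beta> < 2"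
    "\<And>y. (g has_real_derivative g' y) (at y)" "\<And>y. (g' has_real_derivative g'' y) (at y)"
    "exp_growth \<beta> g'" "exp_growth \<beta> g''"
    and pos: "\<And>y. 0 < g y" and p: "p \<ge> 1" and \<epsilon>: "\<epsilon> > 0"
    and K: "\<And>t. t \<in> {0..T} \<Longrightarrow> (\<integral>\<^sup>+\<omega>. ennreal (1 / g (Y t \<omega>) powr (p * (1 + \<epsilon>))) \<partial>M) \<le> ennreal K"
  shows "\<exists>C\<ge>0. \<forall>N\<ge>1. (\<integral>\<^sup>+\<omega>. ennreal ((\<Sum>l<N. (step T N)\<^sup>2 * ((1 + (remainder_size g g' N l \<omega>)\<^sup>2)
        / path_mean (grid T N l) (grid T N (Suc l)) (\<lambda>s. g (Y s \<omega>))) * step T N) powr p) \<partial>M)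
      \<le> ennreal (C / real N powr (2 * p))"
proof -
  define \<alpha> where "\<alpha> = p * (1 + \<epsilon>)"
  have \<alpha>: "\<alpha> > 0" using p \<epsilon> by (simp add: \<alpha>_def)
  define m where "m = nat \<lceil>\<alpha> / \<epsilon>\<rceil>"
  have m: "\<alpha> / \<epsilon> \<le> real m" unfolding m_def by linarith
  have gc: "continuous_on UNIV g" using g(3) by (auto intro!: DERIV_continuous_on)
  have gm[measurable]: "g \<in> borel_measurable borel"
    using gc by (auto intro: borel_measurable_continuous_onI)
  let ?J = "{(N :: nat, l). 1 \<le> N \<and> l < N}"
  note U = remainder_size_moments[OF g(1-6)]
  have U1: "unif_moments M ?J (\<lambda>j \<omega>. 1 + ((\<lambda>(N, l). remainder_size g g' N l) j \<omega>)\<^sup>2)"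
    by (intro unif_moments_add unif_moments_constant unif_moments_power U)
  obtain K1 where K1: "K1 \<ge> 0" "\<And>j. j \<in> ?J \<Longrightarrow>
      (\<integral>\<^sup>+\<omega>. ennreal (\<bar>1 + ((\<lambda>(N, l). remainder_size g g' N l) j \<omega>)\<^sup>2\<bar> ^ m) \<partial>M) \<le> ennreal K1"
    using unif_momentsE[OF U1] by blast
  define K2 where "K2 = max K 0"
  define C where "C = (K1 + K2) * (T ^ 3) powr p"
  have "(\<integral>\<^sup>+\<omega>. ennreal ((\<Sum>l<N. (step T N)\<^sup>2 * ((1 + (remainder_size g g' N l \<omega>)\<^sup>2)
        / path_mean (grid T N l) (grid T N (Suc l)) (\<lambda>s. g (Y s \<omega>))) * step T N) powr p) \<partial>M)
      \<le> ennreal (C / real N powr (2 * p))" if N: "N \<ge> 1" for N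
  proof -
    note gr = grid_facts[OF N]
    define A where "A l = remainder_size g g' N l" for l
    define v where "v l \<omega> = path_mean (grid T N l) (grid T N (Suc l)) (\<lambda>s. g (Y s \<omega>))" for l \<omega>
    define u where "u l \<omega> = (1 + (A l \<omega>)\<^sup>2) / v l \<omega>" for l \<omega>
    have in01: "{grid T N l..grid T N (Suc l)} \<subseteq> {0..T}" if "l < N" for l
      using gr(4)[of l] gr(5)[of "Suc l"] that by auto
    have Am[measurable]: "A l \<in> borel_measurable M" if "l < N" for l
      using unif_moments_measurable[OF U, of "(N, l)"] N that by (simp add: A_def)
    have gY: "(\<lambda>\<omega>. g (Y s \<omega>)) \<in> borel_measurable M" if "s \<in> {0..T}" for s
      using measurable_compose[OF Y_measurable[OF that] gm] .
    have vm[measurable]: "v l \<in> borel_measurable M" if "l < N" for l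
      unfolding v_def using in01[OF that] gr(3) by (intro path_mean_measurable gY) auto
    have um: "u l \<in> borel_measurable M" if "l < N" for l
      unfolding u_def using that by measurable
    have cont: "AE \<omega> in M. \<forall>l<N. continuous_on {grid T N l..grid T N (Suc l)} (\<lambda>s. g (Y s \<omega>))"
      using AE_grid_paths[OF N]
      by eventually_elim (auto intro: continuous_on_compose2[OF gc])
    then have vpos: "AE \<omega> in M. \<forall>l<N. v l \<omega> > 0"
    proof eventually_elim
      case (elim \<omega>)
      show ?case
      proof (intro allI impI)
        fix l assume "l < N"
        then have "v l \<omega> \<in> {0<..}"
          unfolding v_def using elim gr(3) pos by (intro path_mean_in) auto
        then show "v l \<omega> > 0" by simp
      qed
    qed
    have Ev: "(\<integral>\<^sup>+\<omega>. ennreal (v l \<omega> powr (- \<alpha>)) \<partial>M) \<le> ennreal K2" if l: "l < N" for l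
      unfolding v_def
    proof (rule nn_integral_path_mean_convex[where C="{0<..}" and \<phi>="\<lambda>x. x powr (- \<alpha>)"])
      show "convex_on {0<..} (\<lambda>x. x powr (- \<alpha>))" by (rule convex_on_powr_neg[OF \<alpha>])
      show "continuous_on {0<..} (\<lambda>x::real. x powr (- \<alpha>))" by (intro continuous_intros) auto
      show "AE \<omega> in M. continuous_on {grid T N l..grid T N (Suc l)} (\<lambda>s. g (Y s \<omega>)) \<and> (\<forall>s\<in>{grid T N l..grid T N (Suc l)}. g (Y s \<omega>) \<in> {0<..})"
        using cont by eventually_elim (use l pos in auto)
      fix s assume "s \<in> {grid T N l..grid T N (Suc l)}"
      then have s: "s \<in> {0..T}" using in01[OF l] by auto
      show "(\<lambda>\<omega>. g (Y s \<omega>)) \<in> borel_measurable M" by (rule gY[OF s])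
      have "(\<integral>\<^sup>+\<omega>. ennreal (g (Y s \<omega>) powr (- \<alpha>)) \<partial>M) = (\<integral>\<^sup>+\<omega>. ennreal (1 / g (Y s \<omega>) powr (p * (1 + \<epsilon>))) \<partial>M)"
        by (simp add: powr_minus_divide \<alpha>_def)
      also have "\<dots> \<le> ennreal K2" using K[OF s] by (rule order_trans) (simp add: K2_def ennreal_leI)
      finally show "(\<integral>\<^sup>+\<omega>. ennreal (g (Y s \<omega>) powr (- \<alpha>)) \<partial>M) \<le> ennreal K2" .
    qed (use gr(3) in auto)
    have EA: "(\<integral>\<^sup>+\<omega>. ennreal ((1 + (A l \<omega>)\<^sup>2) ^ m) \<partial>M) \<le> ennreal K1" if "l < N" for l
    proof -
      have "\<bar>1 + (A l \<omega>)\<^sup>2\<bar> = 1 + (A l \<omega>)\<^sup>2" for \<omega> by (intro abs_of_nonneg) simp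
      then show ?thesis using K1(2)[of "(N, l)"] N that by (simp add: A_def)
    qed
    have Eu: "(\<integral>\<^sup>+\<omega>. ennreal (u l \<omega> powr p) \<partial>M) \<le> ennreal (K1 + K2)" if l: "l < N" for l
    proof -
      have "AE \<omega> in M. ennreal (u l \<omega> powr p) \<le> ennreal ((1 + (A l \<omega>)\<^sup>2) ^ m) + ennreal (v l \<omega> powr (- \<alpha>))"
        using vpos
      proof eventually_elim
        case (elim \<omega>)
        then have v: "v l \<omega> > 0" using l by blast
        define a where "a = 1 + (A l \<omega>)\<^sup>2"
        have a: "a \<ge> 1" by (simp add: a_def)
        have "u l \<omega> powr p = a powr p * (1 / v l \<omega>) powr p"
          using a v by (simp add: u_def a_def powr_mult[symmetric])
        also have "\<dots> \<le> a powr (p * (1 + \<epsilon>) / \<epsilon>) + (1 / v l \<omega>) powr (p * (1 + \<epsilon>))"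
          using a v p \<epsilon> by (intro young_powr) auto
        also have "a powr (p * (1 + \<epsilon>) / \<epsilon>) \<le> a powr (real m)"
          using a m by (intro powr_mono) (auto simp: \<alpha>_def)
        also have "a powr (real m) = a ^ m" using a by (simp add: powr_realpow)
        also have "(1 / v l \<omega>) powr (p * (1 + \<epsilon>)) = v l \<omega> powr (- \<alpha>)"
          using v by (simp add: \<alpha>_def powr_minus_divide powr_divide)
        finally have "u l \<omega> powr p \<le> a ^ m + v l \<omega> powr (- \<alpha>)" by simp
        then show ?case
          using a unfolding a_def[symmetric] by (simp add: ennreal_plus[symmetric] ennreal_leI del: ennreal_plus)
      qed
      then have "(\<integral>\<^sup>+\<omega>. ennreal (u l \<omega> powr p) \<partial>M) \<le> (\<integral>\<^sup>+\<omega>. ennreal ((1 + (A l \<omega>)\<^sup>2) ^ m) + ennreal (v l \<omega> powr (- \<alpha>)) \<partial>M)"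
        by (rule nn_integral_mono_AE)
      also have "\<dots> = (\<integral>\<^sup>+\<omega>. ennreal ((1 + (A l \<omega>)\<^sup>2) ^ m) \<partial>M) + (\<integral>\<^sup>+\<omega>. ennreal (v l \<omega> powr (- \<alpha>)) \<partial>M)"
      proof (rule nn_integral_add)
        show "(\<lambda>\<omega>. ennreal ((1 + (A l \<omega>)\<^sup>2) ^ m)) \<in> borel_measurable M" using Am[OF l] by simp
        show "(\<lambda>\<omega>. ennreal (v l \<omega> powr (- \<alpha>))) \<in> borel_measurable M" using vm[OF l] by simp
      qed
      also have "\<dots> \<le> ennreal K1 + ennreal K2" by (intro add_mono EA Ev l)
      finally show ?thesis using K1(1) by (simp add: K2_def)
    qed
    have mean: "(\<integral>\<^sup>+\<omega>. ennreal (((\<Sum>l<N. u l \<omega>) / real N) powr p) \<partial>M) \<le> ennreal (K1 + K2)"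
    proof (rule nn_integral_mean_convex[where C="{0<..}" and \<phi>="\<lambda>x. x powr p"])
      show "convex_on {0<..} (\<lambda>x. x powr p)" by (rule powr_convex[OF p])
      show "AE \<omega> in M. \<forall>i<N. u i \<omega> \<in> {0<..}"
        using vpos by eventually_elim (auto simp: u_def add_pos_nonneg)
    qed (use N um Eu in auto)
    have eq: "(\<Sum>l<N. (step T N)\<^sup>2 * u l \<omega> * step T N) = (T ^ 3 / (real N)\<^sup>2) * ((\<Sum>l<N. u l \<omega>) / real N)" for \<omega>
    proof -
      have "(\<Sum>l<N. (step T N)\<^sup>2 * u l \<omega> * step T N) = (step T N)\<^sup>2 * step T N * (\<Sum>l<N. u l \<omega>)"
        unfolding sum_distrib_left by (intro sum.cong) (auto simp: mult_ac)
      then show ?thesis using N by (simp add: step_def power_divide power2_eq_square power3_eq_cube)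
    qed
    have "(\<integral>\<^sup>+\<omega>. ennreal ((\<Sum>l<N. (step T N)\<^sup>2 * u l \<omega> * step T N) powr p) \<partial>M)
      = (\<integral>\<^sup>+\<omega>. ennreal ((T ^ 3 / (real N)\<^sup>2) powr p) * ennreal (((\<Sum>l<N. u l \<omega>) / real N) powr p) \<partial>M)"
      unfolding eq by (intro nn_integral_cong) (simp only: powr_mult ennreal_mult' powr_ge_zero)
    also have "\<dots> = ennreal ((T ^ 3 / (real N)\<^sup>2) powr p) * (\<integral>\<^sup>+\<omega>. ennreal (((\<Sum>l<N. u l \<omega>) / real N) powr p) \<partial>M)"
    proof (rule nn_integral_cmult)
      have [measurable]: "(\<lambda>\<omega>. (\<Sum>l<N. u l \<omega>) / real N) \<in> borel_measurable M"
        using um by (intro borel_measurable_divide borel_measurable_sum) auto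
      show "(\<lambda>\<omega>. ennreal (((\<Sum>l<N. u l \<omega>) / real N) powr p)) \<in> borel_measurable M" by measurable
    qed
    also have "\<dots> \<le> ennreal ((T ^ 3 / (real N)\<^sup>2) powr p) * ennreal (K1 + K2)"
      by (intro mult_left_mono mean) auto
    also have "\<dots> = ennreal (C / real N powr (2 * p))"
    proof -
      have "(real N)\<^sup>2 = real N powr 2" using N by (simp add: powr_numeral)
      then have "((real N)\<^sup>2) powr p = real N powr (2 * p)" by (simp only: powr_powr)
      then have "(T ^ 3 / (real N)\<^sup>2) powr p = (T ^ 3) powr p / real N powr (2 * p)"
        using T_pos by (simp add: powr_divide)
      then have "C / real N powr (2 * p) = (T ^ 3 / (real N)\<^sup>2) powr p * (K1 + K2)"
        by (simp add: C_def)
      then show ?thesis by (simp only: ennreal_mult' powr_ge_zero)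
    qed
    finally show ?thesis unfolding u_def A_def v_def .
  qed
  moreover have "C \<ge> 0" using K1 by (simp add: C_def K2_def)
  ultimately show ?thesis by blast
qed

lemma volatility_error_moment:
  assumes B: "brownian_motion M T B" "indep_processes M T W B"
    and g: "0 \<le> \<beta>" "\<beta> < 2"
    "\<And>y. (g has_real_derivative g' y) (at y)" "\<And>y. (g' has_real_derivative g'' y) (at y)"
    "exp_growth \<beta> g'" "exp_growth \<beta> g''"
    and pos: "\<And>y. 0 < g y" and c: "0 \<le> c" "\<And>y. c \<le> g y" and p: "p \<ge> 1" and \<epsilon>: "\<epsilon> > 0"
    and K: "\<And>t. t \<in> {0..T} \<Longrightarrow> (\<integral>\<^sup>+\<omega>. ennreal (1 / g (Y t \<omega>) powr (p * (1 + \<epsilon>))) \<partial>M) \<le> ennreal K"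
  shows "\<exists>C\<ge>0. \<forall>N\<ge>1. (\<integral>\<^sup>+\<omega>. ennreal (running_max (\<lambda>k. \<Sum>l<k.
        vol_weight \<nu> \<kappa> \<theta> y0 g g' c (grid T N l) (grid T N (Suc l)) (\<lambda>t\<in>{0..T}. W t \<omega>)
        * (B (grid T N (Suc l)) \<omega> - B (grid T N l) \<omega>)) N powr (2 * p)) \<partial>M)
      \<le> ennreal (C / real N powr (2 * p))"
proof -
  interpret B: brownian M T B by unfold_locales (use T_pos B in auto)
  have gc: "continuous_on UNIV g" "continuous_on UNIV g'"
    using g(3,4) by (auto intro!: DERIV_continuous_on)
  have gm: "g \<in> borel_measurable borel" "g' \<in> borel_measurable borel"
    using gc by (auto intro: borel_measurable_continuous_onI)
  define W' where "W' \<omega> = (\<lambda>t\<in>{0..T}. W t \<omega>)" for \<omega>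
  have "indep_var (PiM {0..T} (\<lambda>_. borel)) W' (PiM {0..T} (\<lambda>_. borel)) (\<lambda>\<omega>. \<lambda>t\<in>{0..T}. B t \<omega>)"
    using B(2) unfolding indep_processes_def W'_def .
  from B.independent_weights_max[OF this p] obtain C1 where C1: "C1 \<ge> 0" "\<And>N \<alpha>. N \<ge> 1 \<Longrightarrow>
    (\<And>l. l < N \<Longrightarrow> \<alpha> l \<in> borel_measurable (PiM {0..T} (\<lambda>_. borel))) \<Longrightarrow>
    (\<integral>\<^sup>+\<omega>. ennreal (running_max (\<lambda>k. \<Sum>l<k. \<alpha> l (W' \<omega>) * (B (grid T N (Suc l)) \<omega> - B (grid T N l) \<omega>)) N powr (2 * p)) \<partial>M)
      \<le> (\<integral>\<^sup>+\<omega>. ennreal (C1 * (\<Sum>l<N. (\<alpha> l (W' \<omega>))\<^sup>2 * step T N) powr p) \<partial>M)"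
    by blast
  obtain C2 where C2: "C2 \<ge> 0" "\<And>N. N \<ge> 1 \<Longrightarrow> (\<integral>\<^sup>+\<omega>. ennreal ((\<Sum>l<N. (step T N)\<^sup>2 * ((1 + (remainder_size g g' N l \<omega>)\<^sup>2)
        / path_mean (grid T N l) (grid T N (Suc l)) (\<lambda>s. g (Y s \<omega>))) * step T N) powr p) \<partial>M)
      \<le> ennreal (C2 / real N powr (2 * p))"
    using weight_sum_moment[OF g pos p \<epsilon> K] by blast
  have "(\<integral>\<^sup>+\<omega>. ennreal (running_max (\<lambda>k. \<Sum>l<k.
        vol_weight \<nu> \<kappa> \<theta> y0 g g' c (grid T N l) (grid T N (Suc l)) (W' \<omega>)
        * (B (grid T N (Suc l)) \<omega> - B (grid T N l) \<omega>)) N powr (2 * p)) \<partial>M)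
      \<le> ennreal (C1 * C2 / real N powr (2 * p))" if N: "N \<ge> 1" for N
  proof -
    note gr = grid_facts[OF N]
    define \<alpha> where "\<alpha> l = vol_weight \<nu> \<kappa> \<theta> y0 g g' c (grid T N l) (grid T N (Suc l))" for l
    define u where "u l \<omega> = (1 + (remainder_size g g' N l \<omega>)\<^sup>2)
        / path_mean (grid T N l) (grid T N (Suc l)) (\<lambda>s. g (Y s \<omega>))" for l \<omega>
    have \<alpha>m: "\<alpha> l \<in> borel_measurable (PiM {0..T} (\<lambda>_. borel))" if "l < N" for l
      unfolding \<alpha>_def using gr(3,4)[of l] gr(5)[of "Suc l"] that gm by (intro vol_weight_measurable) auto
    have sums: "AE \<omega> in M. (\<Sum>l<N. (\<alpha> l (W' \<omega>))\<^sup>2 * step T N) \<le> (\<Sum>l<N. (step T N)\<^sup>2 * u l \<omega> * step T N)"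
      using AE_grid_paths[OF N]
    proof eventually_elim
      case (elim \<omega>)
      show ?case
      proof (rule sum_mono)
        fix l assume "l \<in> {..<N}"
        then have l: "l < N" by simp
        define a b where "a = grid T N l" and "b = grid T N (Suc l)"
        define v where "v = path_mean a b (\<lambda>s. g (Y s \<omega>))"
        define e where "e = step T N * remainder_size g g' N l \<omega>"
        have ab: "0 \<le> a" "a \<le> b" "b \<le> T" using gr(3,4)[of l] gr(5)[of "Suc l"] l by (auto simp: a_def b_def)
        have el: "continuous_on {a..b} (\<lambda>s. Y s \<omega>)" "continuous_on {a..b} (\<lambda>s. W s \<omega>)"
          "\<forall>s\<in>{a..b}. Y s \<omega> = Y_past s \<omega>"
          using elim l by (auto simp: a_def b_def)
        have cg: "continuous_on {a..b} (\<lambda>s. g (Y s \<omega>))" by (rule continuous_on_compose2[OF gc(1) el(1)]) auto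
        have "v \<in> {0<..}" unfolding v_def using ab pos by (intro path_mean_in cg) auto
        then have v: "v > 0" by simp
        have "v \<in> {c..}" unfolding v_def using ab c(2) by (intro path_mean_in cg) auto
        then have cv: "c \<le> v" by simp
        have \<alpha>: "\<alpha> l (W' \<omega>) = sqrt v - sqrt (max (g (Y a \<omega>) + \<nu> * g' (Y a \<omega>) * path_mean a b (\<lambda>s. W s \<omega> - W a \<omega>)) c)"
          unfolding \<alpha>_def W'_def v_def a_def[symmetric] b_def[symmetric] by (rule vol_weight_eq[OF ab el(3)])
        have "v - (g (Y a \<omega>) + \<nu> * g' (Y a \<omega>) * path_mean a b (\<lambda>s. W s \<omega> - W a \<omega>))
          = path_mean a b (\<lambda>s. remainder g g' a s \<omega>)"
          using path_mean_remainder[OF el(1,2) ab(2) gc(1), of g'] unfolding v_def by simp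
        then have "\<bar>v - (g (Y a \<omega>) + \<nu> * g' (Y a \<omega>) * path_mean a b (\<lambda>s. W s \<omega> - W a \<omega>))\<bar> \<le> e"
          using path_mean_remainder_le[OF N el(1,2)[unfolded a_def b_def] gc(1), of g'] by (simp add: e_def a_def b_def)
        then have "(\<alpha> l (W' \<omega>))\<^sup>2 \<le> e\<^sup>2 / v"
          unfolding \<alpha> by (intro sqrt_diff_square_le v c(1) cv)
        also have "\<dots> \<le> (step T N)\<^sup>2 * u l \<omega>"
          using v by (simp add: e_def u_def v_def a_def b_def power_mult_distrib divide_right_mono distrib_left)
        finally show "(\<alpha> l (W' \<omega>))\<^sup>2 * step T N \<le> (step T N)\<^sup>2 * u l \<omega> * step T N"
          using gr(1) by (intro mult_right_mono) auto
      qed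
    qed
    have "(\<integral>\<^sup>+\<omega>. ennreal (running_max (\<lambda>k. \<Sum>l<k. \<alpha> l (W' \<omega>) * (B (grid T N (Suc l)) \<omega> - B (grid T N l) \<omega>)) N powr (2 * p)) \<partial>M)
      \<le> (\<integral>\<^sup>+\<omega>. ennreal (C1 * (\<Sum>l<N. (\<alpha> l (W' \<omega>))\<^sup>2 * step T N) powr p) \<partial>M)"
      by (rule C1(2)[OF N \<alpha>m])
    also have "\<dots> \<le> (\<integral>\<^sup>+\<omega>. ennreal C1 * ennreal ((\<Sum>l<N. (step T N)\<^sup>2 * u l \<omega> * step T N) powr p) \<partial>M)"
    proof (rule nn_integral_mono_AE)
      show "AE \<omega> in M. ennreal (C1 * (\<Sum>l<N. (\<alpha> l (W' \<omega>))\<^sup>2 * step T N) powr p)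
        \<le> ennreal C1 * ennreal ((\<Sum>l<N. (step T N)\<^sup>2 * u l \<omega> * step T N) powr p)"
        using sums
      proof eventually_elim
        case (elim \<omega>)
        have "(\<Sum>l<N. (\<alpha> l (W' \<omega>))\<^sup>2 * step T N) powr p \<le> (\<Sum>l<N. (step T N)\<^sup>2 * u l \<omega> * step T N) powr p"
          using elim p gr(1) by (intro powr_mono2) (auto intro!: sum_nonneg)
        then show ?case using C1(1) by (simp add: ennreal_mult'[symmetric] ennreal_leI mult_left_mono)
      qed
    qed
    also have "\<dots> = ennreal C1 * (\<integral>\<^sup>+\<omega>. ennreal ((\<Sum>l<N. (step T N)\<^sup>2 * u l \<omega> * step T N) powr p) \<partial>M)"
    proof (rule nn_integral_cmult)
      have "u l \<in> borel_measurable M" if l: "l < N" for l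
      proof -
        have [measurable]: "remainder_size g g' N l \<in> borel_measurable M"
          using unif_moments_measurable[OF remainder_size_moments[OF g], of "(N, l)"] N l by simp
        have [measurable]: "(\<lambda>\<omega>. path_mean (grid T N l) (grid T N (Suc l)) (\<lambda>s. g (Y s \<omega>))) \<in> borel_measurable M"
          using gr(3,4)[of l] gr(5)[of "Suc l"] l
          by (intro path_mean_measurable measurable_compose[OF Y_measurable gm(1)]) auto
        show ?thesis unfolding u_def by measurable
      qed
      then have [measurable]: "(\<lambda>\<omega>. \<Sum>l<N. (step T N)\<^sup>2 * u l \<omega> * step T N) \<in> borel_measurable M"
        by (intro borel_measurable_sum borel_measurable_times) auto
      show "(\<lambda>\<omega>. ennreal ((\<Sum>l<N. (step T N)\<^sup>2 * u l \<omega> * step T N) powr p)) \<in> borel_measurable M" by measurable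
    qed
    also have "\<dots> \<le> ennreal C1 * ennreal (C2 / real N powr (2 * p))"
      using C2(2)[OF N] unfolding u_def by (intro mult_left_mono) auto
    also have "\<dots> = ennreal (C1 * C2 / real N powr (2 * p))"
      using C1(1) by (simp add: ennreal_mult'[symmetric])
    finally show ?thesis unfolding \<alpha>_def .
  qed
  moreover have "C1 * C2 \<ge> 0" using C1 C2 by simp
  ultimately show ?thesis unfolding W'_def by blast
qed

section \<open>The error of the scheme\<close>

text \<open>Path means over the cells add up to the integral, the weights being the equal cell lengths.\<close>

lemma LBINT_grid:
  assumes N: "N \<ge> 1" and c: "continuous_on {0..T} x" and k: "k \<le> N"
  shows "(LBINT s=ereal 0..ereal (grid T N k). x s) = (\<Sum>l<k. step T N * path_mean (grid T N l) (grid T N (Suc l)) x)"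
proof -
  note gr = grid_facts[OF N]
  have "integral {0..grid T N k} x = (\<Sum>l<k. step T N * path_mean (grid T N l) (grid T N (Suc l)) x)"
    using k
  proof (induction k)
    case 0
    then show ?case by (simp add: grid_def)
  next
    case (Suc k)
    have le: "grid T N (Suc k) \<le> T" using gr(5) Suc.prems by blast
    have "x integrable_on {0..grid T N (Suc k)}"
      using le by (intro integrable_continuous_real continuous_on_subset[OF c]) auto
    then have "integral {0..grid T N k} x + integral {grid T N k..grid T N (Suc k)} x = integral {0..grid T N (Suc k)} x"
      using gr(3,4) by (intro Henstock_Kurzweil_Integration.integral_combine) auto
    moreover have "(grid T N (Suc k) - grid T N k) * path_mean (grid T N k) (grid T N (Suc k)) x = integral {grid T N k..grid T N (Suc k)} x"
      using le gr(3,4) by (intro path_mean_integral continuous_on_subset[OF c]) (auto intro: order_trans)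
    ultimately show ?case using Suc gr(2)[of k] by simp
  qed
  moreover have "continuous_on {0..grid T N k} x"
    using gr(5)[OF k] by (intro continuous_on_subset[OF c]) auto
  ultimately show ?thesis
    using gr(4)[of k] by (simp add: interval_integral_eq_integral borel_integrable_atLeastAtMost')
qed

text \<open>The terms with \<open>F\<close> telescope and cancel, which leaves a drift error that depends on \<open>Y\<close> only and a
  volatility error that is linear in the increments of \<open>B\<close>.\<close>

lemma AE_error_decomposition:
  assumes N: "N \<ge> 1" and h: "continuous_on UNIV (h_drift r \<rho> \<nu> \<kappa> \<theta> f)" and f: "continuous_on UNIV (psi f)"
  shows "AE \<omega> in M. \<forall>k\<le>N. X_tilde T r \<rho> s0 \<nu> \<kappa> \<theta> f B Y N k \<omega> - X_scheme T r \<rho> s0 \<nu> \<kappa> \<theta> f W B Y N k \<omega>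
    = (\<Sum>l<k. step T N * (path_mean (grid T N l) (grid T N (Suc l)) (\<lambda>s. h_drift r \<rho> \<nu> \<kappa> \<theta> f (Y s \<omega>))
          - h_drift r \<rho> \<nu> \<kappa> \<theta> f (Y (grid T N l) \<omega>)))
      + sqrt (1 - \<rho>\<^sup>2) * (\<Sum>l<k. vol_weight \<nu> \<kappa> \<theta> y0 (psi f) (deriv (psi f)) (psi_inf f) (grid T N l) (grid T N (Suc l)) (\<lambda>t\<in>{0..T}. W t \<omega>)
        * (B (grid T N (Suc l)) \<omega> - B (grid T N l) \<omega>))"
  using AE_grid_paths[OF N] AE_paths
proof eventually_elim
  case (elim \<omega>)
  note gr = grid_facts[OF N]
  define h where "h = h_drift r \<rho> \<nu> \<kappa> \<theta> f"
  define y where "y l = Y (grid T N l) \<omega>" for l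
  define \<Delta> where "\<Delta> l = B (grid T N (Suc l)) \<omega> - B (grid T N l) \<omega>" for l
  define v where "v l = path_mean (grid T N l) (grid T N (Suc l)) (\<lambda>s. psi f (Y s \<omega>))" for l
  define u where "u l = max (psi f (y l) + \<nu> * deriv (psi f) (y l) * path_mean (grid T N l) (grid T N (Suc l)) (\<lambda>s. W s \<omega> - W (grid T N l) \<omega>)) (psi_inf f)" for l
  define H where "H l = path_mean (grid T N l) (grid T N (Suc l)) (\<lambda>s. h (Y s \<omega>))" for l
  have cY: "continuous_on {0..T} (\<lambda>s. h (Y s \<omega>))"
    using elim(2) h unfolding h_def by (auto intro: continuous_on_compose2)
  have vw: "vol_weight \<nu> \<kappa> \<theta> y0 (psi f) (deriv (psi f)) (psi_inf f) (grid T N l) (grid T N (Suc l)) (\<lambda>t\<in>{0..T}. W t \<omega>) = sqrt (v l) - sqrt (u l)"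
    if "l < N" for l
    unfolding v_def u_def y_def using that gr(3,4)[of l] gr(5)[of "Suc l"] elim(1)
    by (intro vol_weight_eq) auto
  have mean: "mean_psi T f Y N l \<omega> = v l" if l: "l < N" for l
  proof -
    have "continuous_on {grid T N l..grid T N (Suc l)} (\<lambda>s. psi f (Y s \<omega>))"
      using elim(1) l by (auto intro: continuous_on_compose2[OF f])
    from path_mean_LBINT[OF this gr(3)] gr(1) show ?thesis
      unfolding mean_psi_def v_def by (simp add: gr(2))
  qed
  have tilde: "X_tilde T r \<rho> s0 \<nu> \<kappa> \<theta> f B Y N k \<omega> = ln s0 + \<rho> * (F_prim \<nu> f (y k) - F_prim \<nu> f (y 0))
      + (\<Sum>l<k. step T N * H l) + sqrt (1 - \<rho>\<^sup>2) * (\<Sum>l<k. sqrt (v l) * \<Delta> l)" if k: "k \<le> N" for k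
  proof -
    have "(\<Sum>l<k. sqrt (mean_psi T f Y N l \<omega>) * \<Delta> l) = (\<Sum>l<k. sqrt (v l) * \<Delta> l)"
      using k mean by (intro sum.cong) auto
    moreover have "(LBINT s=ereal 0..ereal (grid T N k). h (Y s \<omega>)) = (\<Sum>l<k. step T N * H l)"
      unfolding H_def by (rule LBINT_grid[OF N cY k])
    ultimately show ?thesis unfolding X_tilde_def h_def[symmetric] y_def[symmetric] \<Delta>_def[symmetric] by (simp only:)
  qed
  have scheme: "X_scheme T r \<rho> s0 \<nu> \<kappa> \<theta> f W B Y N k \<omega> = ln s0 + \<rho> * (F_prim \<nu> f (y k) - F_prim \<nu> f (y 0))
      + (\<Sum>l<k. step T N * h (y l)) + sqrt (1 - \<rho>\<^sup>2) * (\<Sum>l<k. sqrt (u l) * \<Delta> l)" if k: "k \<le> N" for k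
    using k
  proof (induction k)
    case 0
    then show ?case by simp
  next
    case (Suc k)
    then have kN: "k < N" by simp
    have "continuous_on {grid T N k..grid T N (Suc k)} (\<lambda>s. W s \<omega>)" using elim(1) kN by blast
    then have "continuous_on {grid T N k..grid T N (Suc k)} (\<lambda>s. W s \<omega> - W (grid T N k) \<omega>)"
      by (intro continuous_intros)
    from path_mean_LBINT[OF this gr(3)]
    have I: "(LBINT s=ereal (grid T N k)..ereal (grid T N (Suc k)). W s \<omega> - W (grid T N k) \<omega>)
      = step T N * path_mean (grid T N k) (grid T N (Suc k)) (\<lambda>s. W s \<omega> - W (grid T N k) \<omega>)"
      by (simp add: gr(2))
    have ueq: "max (psi f (y k) + \<nu> * deriv (psi f) (y k) / step T N
               * (LBINT s=ereal (grid T N k)..ereal (grid T N (Suc k)). W s \<omega> - W (grid T N k) \<omega>)) (psi_inf f) = u k"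
      unfolding u_def I using gr(1) by simp
    show ?case
      unfolding X_scheme.simps y_def[symmetric] h_def[symmetric] \<Delta>_def[symmetric] ueq
      using Suc by (simp add: algebra_simps)
  qed
  show ?case
  proof (intro allI impI)
    fix k assume k: "k \<le> N"
    have "(\<Sum>l<k. vol_weight \<nu> \<kappa> \<theta> y0 (psi f) (deriv (psi f)) (psi_inf f) (grid T N l) (grid T N (Suc l)) (\<lambda>t\<in>{0..T}. W t \<omega>) * \<Delta> l)
      = (\<Sum>l<k. sqrt (v l) * \<Delta> l) - (\<Sum>l<k. sqrt (u l) * \<Delta> l)"
      unfolding sum_subtractf[symmetric] using k vw by (intro sum.cong) (auto simp: left_diff_distrib)
    moreover have "(\<Sum>l<k. step T N * (H l - h (y l))) = (\<Sum>l<k. step T N * H l) - (\<Sum>l<k. step T N * h (y l))"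
      by (simp add: right_diff_distrib sum_subtractf)
    ultimately show "X_tilde T r \<rho> s0 \<nu> \<kappa> \<theta> f B Y N k \<omega> - X_scheme T r \<rho> s0 \<nu> \<kappa> \<theta> f W B Y N k \<omega>
      = (\<Sum>l<k. step T N * (path_mean (grid T N l) (grid T N (Suc l)) (\<lambda>s. h_drift r \<rho> \<nu> \<kappa> \<theta> f (Y s \<omega>))
          - h_drift r \<rho> \<nu> \<kappa> \<theta> f (Y (grid T N l) \<omega>)))
      + sqrt (1 - \<rho>\<^sup>2) * (\<Sum>l<k. vol_weight \<nu> \<kappa> \<theta> y0 (psi f) (deriv (psi f)) (psi_inf f) (grid T N l) (grid T N (Suc l)) (\<lambda>t\<in>{0..T}. W t \<omega>)
        * (B (grid T N (Suc l)) \<omega> - B (grid T N l) \<omega>))"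
      unfolding tilde[OF k] scheme[OF k] h_def[symmetric] y_def[symmetric] \<Delta>_def[symmetric] H_def[symmetric]
      by (simp add: right_diff_distrib)
  qed
qed

end

text \<open>By the mean value theorem integration costs a factor \<open>\<bar>y\<bar>\<close>, which the class absorbs. This passes
  from the growth of \<open>\<psi>''\<close> to that of \<open>\<psi>'\<close>.\<close>

lemma exp_growth_antiderivative:
  assumes \<beta>: "\<beta> \<ge> 1" and d: "\<And>y. (g has_real_derivative g' y) (at y)" and g': "exp_growth \<beta> g'"
  shows "exp_growth \<beta> g"
proof -
  obtain K where K: "K > 0" "\<And>y. \<bar>g' y\<bar> \<le> K * exp (K * \<bar>y\<bar> powr \<beta>)"
    using g' unfolding exp_growth_def by blast
  have abs: "exp_growth \<beta> (\<lambda>y. \<bar>y\<bar>)" by (rule exp_growth_mono[OF exp_growth_id[OF \<beta>]]) simp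
  have E: "exp_growth \<beta> (\<lambda>y. K * exp (K * \<bar>y\<bar> powr \<beta>))" using K by (intro exp_growthI[of _ K K]) auto
  have "exp_growth \<beta> (\<lambda>y. \<bar>g 0\<bar> + K * exp (K * \<bar>y\<bar> powr \<beta>) * \<bar>y\<bar>)"
    by (intro exp_growth_add exp_growth_const exp_growth_mult[OF E abs])
  then show ?thesis
  proof (rule exp_growth_mono)
    fix y
    have "norm (g y - g 0) \<le> K * exp (K * \<bar>y\<bar> powr \<beta>) * norm (y - 0)"
    proof (rule field_differentiable_bound[of "closed_segment 0 y" g g'])
      show "(g has_field_derivative g' z) (at z within closed_segment 0 y)" for z
        by (rule has_field_derivative_at_within[OF d])
      fix z assume "z \<in> closed_segment 0 y"
      then have "\<bar>z\<bar> \<le> \<bar>y\<bar>" by (auto simp: closed_segment_eq_real_ivl split: if_splits)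
      then have "\<bar>z\<bar> powr \<beta> \<le> \<bar>y\<bar> powr \<beta>" using \<beta> by (intro powr_mono2) auto
      then have "K * exp (K * \<bar>z\<bar> powr \<beta>) \<le> K * exp (K * \<bar>y\<bar> powr \<beta>)" using K by simp
      then show "norm (g' z) \<le> K * exp (K * \<bar>y\<bar> powr \<beta>)" using K(2)[of z] by simp
    qed auto
    then have "\<bar>g y\<bar> \<le> \<bar>g 0\<bar> + K * exp (K * \<bar>y\<bar> powr \<beta>) * \<bar>y\<bar>" by simp
    then show "\<bar>g y\<bar> \<le> \<bar>\<bar>g 0\<bar> + K * exp (K * \<bar>y\<bar> powr \<beta>) * \<bar>y\<bar>\<bar>" by linarith
  qed
qed

text \<open>The generator bound is the only information on the second derivative of the drift function: solving
  for it costs the linear factor \<open>\<theta> - y\<close>, which the growth class absorbs.\<close>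

lemma exp_growth_second_derivative:
  assumes \<beta>: "\<beta> \<ge> 1" and \<nu>: "\<nu> > 0" and L: "exp_growth \<beta> (ou_generator \<nu> \<kappa> \<theta> g)" and g': "exp_growth \<beta> (deriv g)"
  shows "exp_growth \<beta> (deriv (deriv g))"
proof -
  have eq: "deriv (deriv g) y = 2 / \<nu>\<^sup>2 * (ou_generator \<nu> \<kappa> \<theta> g y + (- \<kappa> * \<theta> + \<kappa> * y) * deriv g y)" for y
    using \<nu> by (simp add: ou_generator_def field_simps)
  have "exp_growth \<beta> (\<lambda>y. 2 / \<nu>\<^sup>2 * (ou_generator \<nu> \<kappa> \<theta> g y + (- \<kappa> * \<theta> + \<kappa> * y) * deriv g y))"
    by (intro exp_growth_mult exp_growth_add exp_growth_const exp_growth_id \<beta> L g')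
  then show ?thesis by (rule exp_growth_mono) (simp add: eq)
qed

lemma C3_derivatives:
  assumes "C_k 3 f"
  shows "(f has_real_derivative deriv f y) (at y)" "(deriv f has_real_derivative deriv (deriv f) y) (at y)"
    "(deriv (deriv f) has_real_derivative deriv (deriv (deriv f)) y) (at y)"
proof -
  have d: "(deriv ^^ i) f differentiable (at y)" if "i < 3" for i y using assms that by (simp add: C_k_def)
  show "(f has_real_derivative deriv f y) (at y)" "(deriv f has_real_derivative deriv (deriv f) y) (at y)"
    "(deriv (deriv f) has_real_derivative deriv (deriv (deriv f)) y) (at y)"
    using d[of 0] d[of 1] d[of 2] by (simp_all add: DERIV_deriv_iff_real_differentiable numeral_2_eq_2)
qed

lemma psi_derivatives:
  assumes f: "C_k 3 f"
  shows "(psi f has_real_derivative deriv (psi f) y) (at y)"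
    "(deriv (psi f) has_real_derivative deriv (deriv (psi f)) y) (at y)"
proof -
  note [derivative_intros] = DERIV_chain2[OF C3_derivatives(1)[OF f]] DERIV_chain2[OF C3_derivatives(2)[OF f]]
  have 1: "(psi f has_real_derivative 2 * f y * deriv f y) (at y)" for y
    unfolding psi_def[abs_def] by (auto intro!: derivative_eq_intros)
  then have e: "deriv (psi f) = (\<lambda>y. 2 * f y * deriv f y)" by (auto intro: DERIV_imp_deriv)
  show "(psi f has_real_derivative deriv (psi f) y) (at y)" using 1 by (simp add: e)
  have "\<exists>d. (deriv (psi f) has_real_derivative d) (at y)"
    unfolding e by (rule exI) (auto intro!: derivative_eq_intros)
  then show "(deriv (psi f) has_real_derivative deriv (deriv (psi f)) y) (at y)" using DERIV_imp_deriv by blast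
qed

lemma h_drift_derivatives:
  assumes f: "C_k 3 f" and \<nu>: "\<nu> \<noteq> 0"
  shows "(h_drift r \<rho> \<nu> \<kappa> \<theta> f has_real_derivative deriv (h_drift r \<rho> \<nu> \<kappa> \<theta> f) y) (at y)"
    "(deriv (h_drift r \<rho> \<nu> \<kappa> \<theta> f) has_real_derivative deriv (deriv (h_drift r \<rho> \<nu> \<kappa> \<theta> f)) y) (at y)"
proof -
  note [derivative_intros] = DERIV_chain2[OF C3_derivatives(1)[OF f]] DERIV_chain2[OF C3_derivatives(2)[OF f]]
    DERIV_chain2[OF C3_derivatives(3)[OF f]]
  let ?d = "\<lambda>y. - f y * deriv f y - \<rho> * (- \<kappa> / \<nu> * f y + \<kappa> * (\<theta> - y) / \<nu> * deriv f y + \<nu> / 2 * deriv (deriv f) y)"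
  have 1: "(h_drift r \<rho> \<nu> \<kappa> \<theta> f has_real_derivative ?d y) (at y)" for y
    unfolding h_drift_def[abs_def] using \<nu> by (auto intro!: derivative_eq_intros simp: field_simps)
  then have e: "deriv (h_drift r \<rho> \<nu> \<kappa> \<theta> f) = ?d" by (auto intro: DERIV_imp_deriv)
  show "(h_drift r \<rho> \<nu> \<kappa> \<theta> f has_real_derivative deriv (h_drift r \<rho> \<nu> \<kappa> \<theta> f) y) (at y)" using 1 by (simp add: e)
  have "\<exists>d. (deriv (h_drift r \<rho> \<nu> \<kappa> \<theta> f) has_real_derivative d) (at y)"
    unfolding e by (rule exI) (use \<nu> in \<open>auto intro!: derivative_eq_intros\<close>)
  then show "(deriv (h_drift r \<rho> \<nu> \<kappa> \<theta> f) has_real_derivative deriv (deriv (h_drift r \<rho> \<nu> \<kappa> \<theta> f)) y) (at y)"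
    using DERIV_imp_deriv by blast
qed

theorem theorem9:
  fixes M :: "'a measure"
    and T r \<rho> s0 y0 \<nu> \<kappa> \<theta> p c0 c1 c2 :: real
    and f :: "real \<Rightarrow> real"
    and W B Y :: "real \<Rightarrow> 'a \<Rightarrow> real"
  assumes "prob_space M"
    and "T > 0" and "-1 \<le> \<rho>" and "\<rho> \<le> 1" and "s0 > 0" and "\<nu> > 0" and "p \<ge> 1"
    and "brownian_motion M T W" and "brownian_motion M T B" and "indep_processes M T W B"
    and "ou_solution M T \<nu> \<kappa> \<theta> y0 W Y"
    and "psi_inf f > 0 \<or>
      ((\<forall>y. psi f y > 0) \<and>
       (\<exists>\<epsilon>>0. (SUP t\<in>{0..T}. \<integral>\<^sup>+\<omega>. ennreal (1 / psi f (Y t \<omega>) powr (p * (1 + \<epsilon>))) \<partial>M) < \<infinity>))"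
    and "C_k 3 f"
    and "c0 > 0" and "c1 > 0" and "0 \<le> c2" and "c2 < 1"
    and "\<forall>y. \<bar>ou_generator \<nu> \<kappa> \<theta> (h_drift r \<rho> \<nu> \<kappa> \<theta> f) y\<bar> \<le> c0 * exp (c1 * \<bar>y\<bar> powr (1 + c2))"
    and "\<forall>y. \<bar>deriv (h_drift r \<rho> \<nu> \<kappa> \<theta> f) y\<bar> \<le> c0 * exp (c1 * \<bar>y\<bar> powr (1 + c2))"
    and "\<forall>y. \<bar>ou_generator \<nu> \<kappa> \<theta> (psi f) y\<bar> \<le> c0 * exp (c1 * \<bar>y\<bar> powr (1 + c2))"
    and "\<forall>y. \<bar>deriv (deriv (psi f)) y\<bar> \<le> c0 * exp (c1 * \<bar>y\<bar> powr (1 + c2))"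
  shows "\<exists>C::real. C \<ge> 0 \<and> (\<forall>N::nat. N \<ge> 1 \<longrightarrow>
    (\<integral>\<^sup>+\<omega>. ennreal (MAX k\<in>{0..N}.
        \<bar>X_tilde T r \<rho> s0 \<nu> \<kappa> \<theta> f B Y N k \<omega> - X_scheme T r \<rho> s0 \<nu> \<kappa> \<theta> f W B Y N k \<omega>\<bar> powr (2 * p)) \<partial>M)
      \<le> ennreal (C / real N powr (2 * p)))"
proof -
  interpret prob_space M by fact
  interpret ou_process M T W \<nu> \<kappa> \<theta> y0 Y by unfold_locales fact+
  define h where "h = h_drift r \<rho> \<nu> \<kappa> \<theta> f"
  define \<beta> where "\<beta> = 1 + c2"
  have \<beta>: "1 \<le> \<beta>" "0 \<le> \<beta>" "\<beta> < 2" using assms by (auto simp: \<beta>_def)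
  note p = \<open>p \<ge> 1\<close>
  note dh = h_drift_derivatives[OF \<open>C_k 3 f\<close>, of \<nu> r \<rho> \<kappa> \<theta>, folded h_def]
    and d\<psi> = psi_derivatives[OF \<open>C_k 3 f\<close>]
  have \<nu>0: "\<nu> \<noteq> 0" using \<nu>_pos by simp
  have gh': "exp_growth \<beta> (deriv h)" and Lh: "exp_growth \<beta> (ou_generator \<nu> \<kappa> \<theta> h)"
    and g\<psi>'': "exp_growth \<beta> (deriv (deriv (psi f)))"
    using assms unfolding h_def \<beta>_def by (auto intro: exp_growthI[of _ c0 c1])
  have gh'': "exp_growth \<beta> (deriv (deriv h))"
    by (rule exp_growth_second_derivative[OF \<beta>(1) \<nu>_pos Lh gh'])
  have g\<psi>': "exp_growth \<beta> (deriv (psi f))"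
    by (rule exp_growth_antiderivative[OF \<beta>(1) d\<psi>(2) g\<psi>''])
  have hc: "continuous_on UNIV h" and \<psi>c: "continuous_on UNIV (psi f)"
    using dh(1)[OF \<nu>0] d\<psi>(1) by (auto intro!: DERIV_continuous_on)
  have bdd: "bdd_below (range (psi f))" by (rule bdd_belowI[of _ 0]) (auto simp: psi_def)
  have inf0: "0 \<le> psi_inf f" unfolding psi_inf_def by (rule cINF_greatest) (auto simp: psi_def)
  have infle: "psi_inf f \<le> psi f y" for y unfolding psi_inf_def by (rule cINF_lower[OF bdd]) simp
  obtain \<epsilon> K where \<epsilon>: "\<epsilon> > 0" and pos: "\<And>y. 0 < psi f y"
    and K: "\<And>t. t \<in> {0..T} \<Longrightarrow> (\<integral>\<^sup>+\<omega>. ennreal (1 / psi f (Y t \<omega>) powr (p * (1 + \<epsilon>))) \<partial>M) \<le> ennreal K"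
  proof (cases "psi_inf f > 0")
    case True
    show ?thesis
    \<comment> \<open>A uniform lower bound is a special case of the moment condition, with any \<open>\<epsilon>\<close>.\<close>
    proof (rule that[of 1 "1 / psi_inf f powr (p * (1 + 1))"])
      show "0 < psi f y" for y using True infle[of y] by linarith
      fix t
      have "1 / psi f y powr (p * (1 + 1)) \<le> 1 / psi_inf f powr (p * (1 + 1))" for y
        using True infle[of y] p by (intro divide_left_mono powr_mono2 mult_pos_pos) auto
      then have "(\<integral>\<^sup>+\<omega>. ennreal (1 / psi f (Y t \<omega>) powr (p * (1 + 1))) \<partial>M)
        \<le> (\<integral>\<^sup>+\<omega>. ennreal (1 / psi_inf f powr (p * (1 + 1))) \<partial>M)"
        by (intro nn_integral_mono ennreal_leI)
      then show "(\<integral>\<^sup>+\<omega>. ennreal (1 / psi f (Y t \<omega>) powr (p * (1 + 1))) \<partial>M) \<le> ennreal (1 / psi_inf f powr (p * (1 + 1)))"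
        by (simp add: emeasure_space_1)
    qed simp
  next
    case False
    then obtain \<epsilon> where e: "\<epsilon> > 0" "\<forall>y. psi f y > 0"
      "(SUP t\<in>{0..T}. \<integral>\<^sup>+\<omega>. ennreal (1 / psi f (Y t \<omega>) powr (p * (1 + \<epsilon>))) \<partial>M) < \<infinity>"
      using assms by blast
    then obtain K where "(SUP t\<in>{0..T}. \<integral>\<^sup>+\<omega>. ennreal (1 / psi f (Y t \<omega>) powr (p * (1 + \<epsilon>))) \<partial>M) = ennreal K"
      by (cases "SUP t\<in>{0..T}. \<integral>\<^sup>+\<omega>. ennreal (1 / psi f (Y t \<omega>) powr (p * (1 + \<epsilon>))) \<partial>M") auto
    then show ?thesis using e by (intro that[of \<epsilon> K]) (auto intro: SUP_upper simp flip: \<open>_ = ennreal K\<close>)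
  qed
  define D where "D N k \<omega> = (\<Sum>l<k. step T N *
      (path_mean (grid T N l) (grid T N (Suc l)) (\<lambda>s. h (Y s \<omega>)) - h (Y (grid T N l) \<omega>)))" for N k \<omega>
  define G where "G N k \<omega> = (\<Sum>l<k. vol_weight \<nu> \<kappa> \<theta> y0 (psi f) (deriv (psi f)) (psi_inf f)
      (grid T N l) (grid T N (Suc l)) (\<lambda>t\<in>{0..T}. W t \<omega>) * (B (grid T N (Suc l)) \<omega> - B (grid T N l) \<omega>))" for N k \<omega>
  obtain C1 where C1: "C1 \<ge> 0" "\<And>N. N \<ge> 1 \<Longrightarrow>
      (\<integral>\<^sup>+\<omega>. ennreal (running_max (\<lambda>k. D N k \<omega>) N powr (2 * p)) \<partial>M) \<le> ennreal (C1 / real N powr (2 * p))"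
    using drift_error_moment[OF \<beta>(2,3) dh(1)[OF \<nu>0] dh(2)[OF \<nu>0] gh' gh'' p] unfolding D_def by blast
  obtain C2 where C2: "C2 \<ge> 0" "\<And>N. N \<ge> 1 \<Longrightarrow>
      (\<integral>\<^sup>+\<omega>. ennreal (running_max (\<lambda>k. G N k \<omega>) N powr (2 * p)) \<partial>M) \<le> ennreal (C2 / real N powr (2 * p))"
    using volatility_error_moment[OF \<open>brownian_motion M T B\<close> \<open>indep_processes M T W B\<close> \<beta>(2,3) d\<psi> g\<psi>' g\<psi>'' pos inf0 infle p \<epsilon> K]
    unfolding G_def by blast
  define C where "C = 2 powr (2 * p) * (C1 + C2)"
  show ?thesis
  proof (intro exI[of _ C] conjI allI impI)
    show "C \<ge> 0" using C1 C2 by (simp add: C_def)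
    fix N :: nat assume N: "N \<ge> 1"
    note gr = grid_facts[OF N]
    define RD where "RD \<omega> = running_max (\<lambda>k. D N k \<omega>) N" for \<omega>
    define RG where "RG \<omega> = running_max (\<lambda>k. G N k \<omega>) N" for \<omega>
    have hm: "h \<in> borel_measurable borel" using hc by (rule borel_measurable_continuous_onI)
    have RDm[measurable]: "RD \<in> borel_measurable M"
      unfolding RD_def
    proof (rule running_max_measurable)
      fix k assume "k \<le> N"
      then show "D N k \<in> borel_measurable M"
        unfolding D_def using gr(3,4) gr(5)
        by (intro borel_measurable_sum borel_measurable_times borel_measurable_diff path_mean_measurable
            measurable_compose[OF Y_measurable hm] borel_measurable_const) (auto intro: order_trans)
    qed
    have "AE \<omega> in M. ennreal (MAX k\<in>{0..N}. \<bar>X_tilde T r \<rho> s0 \<nu> \<kappa> \<theta> f B Y N k \<omega> - X_scheme T r \<rho> s0 \<nu> \<kappa> \<theta> f W B Y N k \<omega>\<bar> powr (2 * p))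
      \<le> ennreal (2 powr (2 * p)) * (ennreal (RD \<omega> powr (2 * p)) + ennreal (RG \<omega> powr (2 * p)))"
      using AE_error_decomposition[OF N hc[unfolded h_def] \<psi>c, of s0 B]
    proof eventually_elim
      case (elim \<omega>)
      have "(MAX k\<in>{0..N}. \<bar>X_tilde T r \<rho> s0 \<nu> \<kappa> \<theta> f B Y N k \<omega> - X_scheme T r \<rho> s0 \<nu> \<kappa> \<theta> f W B Y N k \<omega>\<bar> powr (2 * p))
        \<le> 2 powr (2 * p) * (RD \<omega> powr (2 * p) + RG \<omega> powr (2 * p))"
      proof (rule Max.boundedI)
        fix z assume "z \<in> (\<lambda>k. \<bar>X_tilde T r \<rho> s0 \<nu> \<kappa> \<theta> f B Y N k \<omega> - X_scheme T r \<rho> s0 \<nu> \<kappa> \<theta> f W B Y N k \<omega>\<bar> powr (2 * p)) ` {0..N}"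
        then obtain k where k: "k \<le> N"
          and z: "z = \<bar>X_tilde T r \<rho> s0 \<nu> \<kappa> \<theta> f B Y N k \<omega> - X_scheme T r \<rho> s0 \<nu> \<kappa> \<theta> f W B Y N k \<omega>\<bar> powr (2 * p)" by auto
        have "X_tilde T r \<rho> s0 \<nu> \<kappa> \<theta> f B Y N k \<omega> - X_scheme T r \<rho> s0 \<nu> \<kappa> \<theta> f W B Y N k \<omega> = D N k \<omega> + sqrt (1 - \<rho>\<^sup>2) * G N k \<omega>"
          using elim k unfolding D_def G_def h_def by blast
        moreover have "\<bar>D N k \<omega>\<bar> \<le> RD \<omega>" unfolding RD_def by (rule running_max_ge[OF k])
        moreover have "\<bar>sqrt (1 - \<rho>\<^sup>2) * G N k \<omega>\<bar> \<le> RG \<omega>"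
        proof -
          have "\<rho>\<^sup>2 \<le> 1" using assms(3,4) by (simp add: abs_square_le_1 abs_le_iff)
          then have "\<bar>sqrt (1 - \<rho>\<^sup>2)\<bar> \<le> 1" by simp
          then have "\<bar>sqrt (1 - \<rho>\<^sup>2)\<bar> * \<bar>G N k \<omega>\<bar> \<le> 1 * \<bar>G N k \<omega>\<bar>" by (rule mult_right_mono) simp
          also have "\<dots> \<le> RG \<omega>" unfolding RG_def using running_max_ge[OF k, of "\<lambda>k. G N k \<omega>"] by simp
          finally show ?thesis by (simp add: abs_mult)
        qed
        ultimately have "\<bar>X_tilde T r \<rho> s0 \<nu> \<kappa> \<theta> f B Y N k \<omega> - X_scheme T r \<rho> s0 \<nu> \<kappa> \<theta> f W B Y N k \<omega>\<bar> \<le> RD \<omega> + RG \<omega>"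
          by linarith
        then have "z \<le> (RD \<omega> + RG \<omega>) powr (2 * p)" unfolding z using p by (intro powr_mono2) auto
        also have "\<dots> \<le> 2 powr (2 * p) * (RD \<omega> powr (2 * p) + RG \<omega> powr (2 * p))"
          using p by (intro add_powr_le) (auto simp: RD_def RG_def running_max_nonneg)
        finally show "z \<le> 2 powr (2 * p) * (RD \<omega> powr (2 * p) + RG \<omega> powr (2 * p))" .
      qed auto
      then show ?case by (simp add: ennreal_mult'[symmetric] ennreal_plus[symmetric] ennreal_leI del: ennreal_plus)
    qed
    then have "(\<integral>\<^sup>+\<omega>. ennreal (MAX k\<in>{0..N}. \<bar>X_tilde T r \<rho> s0 \<nu> \<kappa> \<theta> f B Y N k \<omega> - X_scheme T r \<rho> s0 \<nu> \<kappa> \<theta> f W B Y N k \<omega>\<bar> powr (2 * p)) \<partial>M)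
      \<le> (\<integral>\<^sup>+\<omega>. ennreal (2 powr (2 * p)) * (ennreal (RD \<omega> powr (2 * p)) + ennreal (RG \<omega> powr (2 * p))) \<partial>M)"
      by (rule nn_integral_mono_AE)
    also have "\<dots> = ennreal (2 powr (2 * p)) * ((\<integral>\<^sup>+\<omega>. ennreal (RD \<omega> powr (2 * p)) \<partial>M) + (\<integral>\<^sup>+\<omega>. ennreal (RG \<omega> powr (2 * p)) \<partial>M))"
    proof -
      have [measurable]: "RG \<in> borel_measurable M"
        unfolding RG_def
      proof (rule running_max_measurable)
        fix k assume k: "k \<le> N"
        interpret B: brownian M T B by unfold_locales fact+
        have W': "(\<lambda>\<omega>. \<lambda>t\<in>{0..T}. W t \<omega>) \<in> measurable M (PiM {0..T} (\<lambda>_. borel))"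
          using W_measurable by (intro measurable_restrict) auto
        have \<psi>m: "psi f \<in> borel_measurable borel" "deriv (psi f) \<in> borel_measurable borel"
          using d\<psi> by (auto intro!: borel_measurable_continuous_onI DERIV_continuous_on)
        show "G N k \<in> borel_measurable M"
          unfolding G_def
        proof (intro borel_measurable_sum borel_measurable_times borel_measurable_diff B.W_measurable)
          fix l assume "l \<in> {..<k}"
          then have l: "l < N" using k by auto
          show "(\<lambda>\<omega>. vol_weight \<nu> \<kappa> \<theta> y0 (psi f) (deriv (psi f)) (psi_inf f) (grid T N l) (grid T N (Suc l)) (\<lambda>t\<in>{0..T}. W t \<omega>)) \<in> borel_measurable M"
            using gr(3,4)[of l] gr(5)[of "Suc l"] l
            by (intro measurable_compose[OF W' vol_weight_measurable] \<psi>m) auto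
          show "grid T N (Suc l) \<in> {0..T}" "grid T N l \<in> {0..T}" using gr(4,5) l by auto
        qed
      qed
      show ?thesis by (simp add: nn_integral_cmult nn_integral_add)
    qed
    also have "\<dots> \<le> ennreal (2 powr (2 * p)) * (ennreal (C1 / real N powr (2 * p)) + ennreal (C2 / real N powr (2 * p)))"
      using C1(2)[OF N] C2(2)[OF N] unfolding RD_def RG_def by (intro mult_left_mono add_mono) auto
    also have "\<dots> = ennreal (C / real N powr (2 * p))"
      using C1(1) C2(1)
      by (simp add: C_def ennreal_mult'[symmetric] ennreal_plus[symmetric] add_divide_distrib distrib_left del: ennreal_plus)
    finally show "(\<integral>\<^sup>+\<omega>. ennreal (MAX k\<in>{0..N}. \<bar>X_tilde T r \<rho> s0 \<nu> \<kappa> \<theta> f B Y N k \<omega> - X_scheme T r \<rho> s0 \<nu> \<kappa> \<theta> f W B Y N k \<omega>\<bar> powr (2 * p)) \<partial>M)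
      \<le> ennreal (C / real N powr (2 * p))" .
  qed
qed

end
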